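(* Let $V$ be a finite-dimensional real Euclidean vector space, let $R$ be a reduced root system in $V$ (not assumed irreducible, and not assumed to span $V$), and let $W\subset O(V)$ be its Weyl group. Let $a\in V$ be a minuscule element, and let $W_a=\{w\in W: w(a)=a\}$ be the stabilizer of $a$ in $W$. Then the $\mathbb{R}$-algebra of $W_a$-invariant polynomial functions on $V$ is generated by the $W$-invariant polynomial functions $f:V\rightarrow\mathbb{R}$ together with their translates $v\mapsto f(v+a)$.
   Context: $V$ carries a $W$-invariant scalar product $(-,-)$, and $W\subset O(V)$ is the finite group generated by the orthogonal reflections $s_\alpha$ for $\alpha\in R$. If $R$ does not span $V$, then $R$ is a root system in its span and $W$ acts trivially on the orthogonal complement of that span. For a subgroup $G\subset W$, a polynomial function $f:V\to\mathbb{R}$ is $G$-invariant if $f(g(v))=f(v)$ for all $g\in G$ and $v\in V$. An element $a\in V$ is called minuscule (with respect to $R$) if for every irreducible component $R_i$ of $R$, the set of real numbers $\{(\alpha,a):\alpha\in R_i\}$ has at most $3$ elements. *)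

theory Defs
  imports "HOL-Analysis.Analysis"
begin

definition reflection :: "'a::real_inner \<Rightarrow> 'a \<Rightarrow> 'a" where
  "reflection \<alpha> v = v - (2 * (v \<bullet> \<alpha>) / (\<alpha> \<bullet> \<alpha>)) *\<^sub>R \<alpha>"

text \<open>Root systems are crystallographic and need not span the ambient space.\<close>

definition root_system :: "'a::real_inner set \<Rightarrow> bool" where
  "root_system R \<longleftrightarrow>
     finite R \<and> 0 \<notin> R \<and>
     (\<forall>\<alpha>\<in>R. reflection \<alpha> ` R = R) \<and>
     (\<forall>\<alpha>\<in>R. \<forall>\<beta>\<in>R. 2 * (\<beta> \<bullet> \<alpha>) / (\<alpha> \<bullet> \<alpha>) \<in> \<int>)"

definition reduced_root_system :: "'a::real_inner set \<Rightarrow> bool" where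
  "reduced_root_system R \<longleftrightarrow>
     root_system R \<and> (\<forall>\<alpha>\<in>R. \<forall>c. c *\<^sub>R \<alpha> \<in> R \<longrightarrow> c = 1 \<or> c = -1)"

definition irreducible_roots :: "'a::real_inner set \<Rightarrow> bool" where
  "irreducible_roots S \<longleftrightarrow>
     S \<noteq> {} \<and>
     \<not> (\<exists>A B. A \<noteq> {} \<and> B \<noteq> {} \<and> A \<inter> B = {} \<and> A \<union> B = S \<and>
          (\<forall>\<alpha>\<in>A. \<forall>\<beta>\<in>B. \<alpha> \<bullet> \<beta> = 0))"

definition irreducible_component :: "'a::real_inner set \<Rightarrow> 'a set \<Rightarrow> bool" where
  "irreducible_component R S \<longleftrightarrow>
     S \<subseteq> R \<and> irreducible_roots S \<and> (\<forall>\<alpha>\<in>S. \<forall>\<beta>\<in>R - S. \<alpha> \<bullet> \<beta> = 0)"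

text \<open>
  For finite \<open>R\<close> the sets below are finite, so the value 0 of \<^const>\<open>card\<close> on
  infinite sets plays no role.
\<close>

definition minuscule :: "'a::real_inner set \<Rightarrow> 'a \<Rightarrow> bool" where
  "minuscule R a \<longleftrightarrow>
     (\<forall>S. irreducible_component R S \<longrightarrow> card ((\<lambda>\<alpha>. \<alpha> \<bullet> a) ` S) \<le> 3)"

inductive_set weyl_group :: "('a::real_inner) set \<Rightarrow> ('a \<Rightarrow> 'a) set" for R where
  id: "id \<in> weyl_group R"
| refl: "\<alpha> \<in> R \<Longrightarrow> reflection \<alpha> \<in> weyl_group R"
| comp: "v \<in> weyl_group R \<Longrightarrow> w \<in> weyl_group R \<Longrightarrow> v \<circ> w \<in> weyl_group R"
| inv: "w \<in> weyl_group R \<Longrightarrow> inv w \<in> weyl_group R"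

definition weyl_stabilizer :: "'a::real_inner set \<Rightarrow> 'a \<Rightarrow> ('a \<Rightarrow> 'a) set" where
  "weyl_stabilizer R a = {w \<in> weyl_group R. w a = a}"

definition invariant_polynomials :: "('a::real_inner \<Rightarrow> 'a) set \<Rightarrow> ('a \<Rightarrow> real) set" where
  "invariant_polynomials G =
     {f. real_polynomial_function f \<and> (\<forall>g\<in>G. \<forall>v. f (g v) = f v)}"

text \<open>
  The smallest set of functions containing \<open>S\<close> that is a unital real subalgebra of the
  algebra of all real-valued functions; scalar multiples arise from \<open>const\<close> and \<open>mult\<close>.
\<close>

inductive_set generated_algebra :: "('a \<Rightarrow> real) set \<Rightarrow> ('a \<Rightarrow> real) set" for S where
  gen: "f \<in> S \<Longrightarrow> f \<in> generated_algebra S"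
| const: "(\<lambda>_. c) \<in> generated_algebra S"
| add: "f \<in> generated_algebra S \<Longrightarrow> g \<in> generated_algebra S \<Longrightarrow>
    (\<lambda>v. f v + g v) \<in> generated_algebra S"
| mult: "f \<in> generated_algebra S \<Longrightarrow> g \<in> generated_algebra S \<Longrightarrow>
    (\<lambda>v. f v * g v) \<in> generated_algebra S"

end

theory Submission
  imports Defs
begin

text \<open>
  After rescaling the components of \<open>R\<close>, all \<open>(\<alpha>, a)\<close> lie in \<open>{-1, 0, 1}\<close>. Let \<open>T\<close> be the space of functions
  \<open>F(v, y) = \<Sum>\<^sub>i p\<^sub>i(v) g\<^sub>i(y)\<close> with \<open>p\<^sub>i\<close> polynomial and \<open>g\<^sub>i\<close> \<open>W\<close>-invariant, to be evaluated at \<open>y = v + b\<close>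
  for \<open>b\<close> in the orbit \<open>W a\<close>. The crucial point is to find \<open>F\<close> in \<open>T\<close> with \<open>F(v, v + b) = 0\<close> for \<open>b \<noteq> a\<close> and
  \<open>F(v, v + a) = \<Prod> (\<alpha>, v)\<close>, the product over the roots with \<open>(\<alpha>, a) < 0\<close>. Given such an \<open>F\<close>, multiplying it by a
  \<open>W\<^sub>a\<close>-invariant \<open>h\<close> and antisymmetrizing in \<open>v\<close> expresses \<open>h(v)\<close> as \<open>\<Sum>\<^sub>i f\<^sub>i(v) g\<^sub>i(v + a)\<close> with
  \<open>W\<close>-invariant \<open>f\<^sub>i\<close>.

  The polynomials \<open>d\<close> for which \<open>d \<Prod> (\<alpha>, v)\<close> can be attained in place of \<open>\<Prod> (\<alpha>, v)\<close> form an ideal, and it suffices to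
  show that no prime ideal contains it. Near a point \<open>x\<close> only the roots with \<open>(\<alpha>, x)\<close> an integer matter. They generate a finite
  reflection group for which \<open>x\<close> and \<open>x + a\<close> lie in a common closed chamber, and the required local function is a Schubert
  class of that group, translated by an element of the stabilizer of \<open>x\<close>. Two points \<open>x + a\<close> and \<open>x + b\<close> interfere only if they are
  \<open>W\<close>-conjugate, and since \<open>a\<close> is minuscule, \<open>b\<close> then lies in the orbit of \<open>a\<close> under the stabilizer of \<open>x\<close>.
\<close>

section \<open>Polynomial functions and linear factors\<close>

text \<open>The target \<Prod> (\<alpha>, v) is what antisymmetrization can absorb. By invariance in
  y, F(w v, v + a) = F(w v, w v + w a), so a sum over W keeps only the terms with w a = a. An
  antisymmetric sum may be divided by the product of a positive system. If that system contains the
  roots with (\<alpha>, a) < 0, the target supplies exactly the factors that the positive roots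
  orthogonal to a leave missing. The obstacle is F itself: the points v + b become W-conjugate at
  many v, also far from the origin, so no single Schubert class does the job. Locally, a family of
  polynomials indexed by the group and congruent along reflecting hyperplanes always comes from a
  sum of products, which reduces the construction to prescribing values on graphs. Being minuscule
  enters twice. At roots integral at x, |(\<alpha>, a)| \<le> 1 keeps x and x + a in a common closed
  chamber. Moreover each w a - a is an integral combination of coroots, so a conjugation of x + b to
  x + a becomes an affine Weyl group element fixing x.\<close>

text \<open>The bound is strict: \<open>pdeg n f\<close> means degree less than \<open>n\<close>, so that only 0 satisfies \<open>pdeg 0\<close>.\<close>

inductive pdeg :: "nat \<Rightarrow> ('a::euclidean_space \<Rightarrow> real) \<Rightarrow> bool" where
  zero: "pdeg n (\<lambda>_. 0)"
| const: "pdeg (Suc n) (\<lambda>_. c)"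
| lin: "pdeg n f \<Longrightarrow> pdeg (Suc n) (\<lambda>v. (v \<bullet> u) * f v)"
| add: "pdeg n f \<Longrightarrow> pdeg n g \<Longrightarrow> pdeg n (\<lambda>v. f v + g v)"

lemma polynomial_inner [simp]: "real_polynomial_function (\<lambda>v::'a::euclidean_space. v \<bullet> u)"
  by (rule real_polynomial_function.intros(1)) (rule bounded_linear_inner_left)

lemma pdeg_imp_polynomial: "pdeg n f \<Longrightarrow> real_polynomial_function f"
  by (induction rule: pdeg.induct) (auto intro: real_polynomial_function.intros)

lemma pdeg_0: "pdeg n f \<Longrightarrow> n = 0 \<Longrightarrow> f = (\<lambda>_. 0)"
  by (induction rule: pdeg.induct) auto

lemma pdeg_Suc: "pdeg n f \<Longrightarrow> pdeg (Suc n) f"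
  by (induction rule: pdeg.induct) (auto intro: pdeg.intros)

lemma pdeg_mono: "pdeg n f \<Longrightarrow> n \<le> m \<Longrightarrow> pdeg m f"
  by (induction m) (auto simp: le_Suc_eq intro: pdeg_Suc)

lemma pdeg_cmult: "pdeg n f \<Longrightarrow> pdeg n (\<lambda>v. c * f v)"
proof (induction rule: pdeg.induct)
  case (lin n f u)
  then show ?case using pdeg.lin[OF lin.IH, of u] by (simp add: mult.left_commute)
qed (auto intro: pdeg.intros simp: distrib_left)

lemma pdeg_diff: "pdeg n f \<Longrightarrow> pdeg n g \<Longrightarrow> pdeg n (\<lambda>v. f v - g v)"
  using pdeg.add[of n f "\<lambda>v. (-1) * g v"] pdeg_cmult[of n g "-1"] by simp

lemma pdeg_mult: "pdeg n f \<Longrightarrow> pdeg m g \<Longrightarrow> pdeg (n + m) (\<lambda>v. f v * g v)"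
proof (induction rule: pdeg.induct)
  case (zero n) then show ?case by (auto intro: pdeg.intros)
next
  case (const n c)
  then show ?case using pdeg_mono[OF pdeg_cmult[of m g c], of "Suc n + m"] by simp
next
  case (lin n f u)
  then show ?case using pdeg.lin[of "n+m" "\<lambda>v. f v * g v" u] by (simp add: mult.assoc)
next
  case (add n f f')
  then show ?case using pdeg.add[of "n+m" "\<lambda>v. f v * g v" "\<lambda>v. f' v * g v"] by (simp add: distrib_right)
qed

lemma polynomial_imp_pdeg:
  fixes f :: "'a::euclidean_space \<Rightarrow> real"
  shows "real_polynomial_function f \<Longrightarrow> \<exists>n. pdeg n f"
proof (induction rule: real_polynomial_function.induct)
  case (linear f)
  then have l: "linear f" by (simp add: bounded_linear.linear)
  have "f = (\<lambda>v. (v \<bullet> adjoint f 1) * 1)"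
    using adjoint_works[OF l, of _ 1] by (simp add: fun_eq_iff)
  moreover have "pdeg (Suc (Suc 0)) (\<lambda>v. (v \<bullet> adjoint f 1) * 1)"
    by (intro pdeg.lin pdeg.const)
  ultimately have "pdeg (Suc (Suc 0)) f" by simp
  then show ?case by blast
next
  case (const c) then show ?case using pdeg.const by blast
next
  case (add f g)
  then obtain n m where "pdeg n f" "pdeg m g" by blast
  then have "pdeg (max n m) f" "pdeg (max n m) g" by (auto intro: pdeg_mono)
  then show ?case by (blast intro: pdeg.add)
next
  case (mult f g) then show ?case by (blast intro: pdeg_mult)
qed

lemma pdeg_linear_comp:
  fixes w :: "'a::euclidean_space \<Rightarrow> 'a"
  assumes "linear w" shows "pdeg n f \<Longrightarrow> pdeg n (\<lambda>v. f (w v))"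
proof (induction rule: pdeg.induct)
  case (lin n f u)
  have "w v \<bullet> u = v \<bullet> adjoint w u" for v using adjoint_works[OF assms, of v u] by simp
  then show ?case using pdeg.lin[OF lin.IH, of "adjoint w u"] by simp
qed (auto intro: pdeg.intros)

definition hyperproj :: "'a::euclidean_space \<Rightarrow> 'a \<Rightarrow> 'a" where
  "hyperproj \<alpha> v = v - ((v \<bullet> \<alpha>) / (\<alpha> \<bullet> \<alpha>)) *\<^sub>R \<alpha>"

lemma linear_hyperproj: "linear (hyperproj \<alpha>)"
  by (rule linearI) (simp_all add: hyperproj_def inner_add_left add_divide_distrib scaleR_add_left scaleR_diff_right)

lemma hyperproj_inner: "\<alpha> \<noteq> 0 \<Longrightarrow> hyperproj \<alpha> v \<bullet> \<alpha> = 0"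
  by (simp add: hyperproj_def inner_diff_left)

text \<open>The factor theorem with a degree count: \<open>v\<close> and
  \<open>hyperproj \<alpha> v\<close> differ by a multiple of \<alpha> with coefficient proportional
  to \<open>v \<bullet> \<alpha>\<close>, and a product rule carries the divisibility from
  \<open>f\<close> to \<open>(v \<bullet> u) * f v\<close>. The drop in degree drives the later
  induction over divided differences.\<close>

lemma pdeg_diff_hyperproj:
  assumes "\<alpha> \<noteq> 0"
  shows "pdeg n f \<Longrightarrow> \<exists>g. pdeg (n - 1) g \<and> (\<forall>v. f v - f (hyperproj \<alpha> v) = (v \<bullet> \<alpha>) * g v)"
proof (induction rule: pdeg.induct)
  case (zero n)
  have "pdeg (n-1) (\<lambda>_. 0)" by (rule pdeg.zero)
  then show ?case by (intro exI[of _ "\<lambda>_. 0"]) auto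
next
  case (const n c)
  have "pdeg (Suc n-1) (\<lambda>_. 0)" by (rule pdeg.zero)
  then show ?case by (intro exI[of _ "\<lambda>_. 0"]) auto
next
  case (add n f f')
  then obtain g g' where "pdeg (n - 1) g" "\<forall>v. f v - f (hyperproj \<alpha> v) = (v \<bullet> \<alpha>) * g v"
    "pdeg (n - 1) g'" "\<forall>v. f' v - f' (hyperproj \<alpha> v) = (v \<bullet> \<alpha>) * g' v" by blast
  then show ?case
    by (intro exI[of _ "\<lambda>v. g v + g' v"]) (simp add: pdeg.add distrib_left add_diff_add)
next
  case (lin n f u)
  show ?case
  proof (cases n)
    \<comment> \<open>Split off because \<open>(v \<bullet> u) * g v\<close> has bound
      \<open>Suc (n - 1)\<close>, which equals \<open>n\<close> only for positive
      \<open>n\<close>.\<close>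
    case 0
    then have "f = (\<lambda>_. 0)" using lin pdeg_0 by blast
    then show ?thesis by (intro exI[of _ "\<lambda>_. 0"]) (auto intro: pdeg.zero)
  next
    case (Suc m)
    obtain g where g: "pdeg m g" "\<And>v. f v - f (hyperproj \<alpha> v) = (v \<bullet> \<alpha>) * g v"
      using lin.IH Suc by auto
    let ?g = "\<lambda>v. (v \<bullet> u) * g v + (\<alpha> \<bullet> u / (\<alpha> \<bullet> \<alpha>)) * f (hyperproj \<alpha> v)"
    have "pdeg n ?g" unfolding Suc
      using g(1) pdeg_linear_comp[OF linear_hyperproj lin.hyps, of \<alpha>] Suc
      by (intro pdeg.add pdeg.lin pdeg_cmult) auto
    moreover have "(v \<bullet> u) * f v - (hyperproj \<alpha> v \<bullet> u) * f (hyperproj \<alpha> v) = (v \<bullet> \<alpha>) * ?g v" for v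
    proof -
      have 1: "hyperproj \<alpha> v \<bullet> u = v \<bullet> u - (v \<bullet> \<alpha>) * (\<alpha> \<bullet> u / (\<alpha> \<bullet> \<alpha>))"
        by (simp add: hyperproj_def inner_diff_left)
      have 2: "f v = f (hyperproj \<alpha> v) + (v \<bullet> \<alpha>) * g v" using g(2)[of v] by simp
      show ?thesis unfolding 1 by (subst 2) (simp add: algebra_simps)
    qed
    ultimately show ?thesis by (intro exI[of _ ?g]) simp
  qed
qed

lemma pdeg_divide:
  assumes "pdeg (Suc n) f" "\<alpha> \<noteq> 0" "\<And>v. v \<bullet> \<alpha> = 0 \<Longrightarrow> f v = 0"
  shows "\<exists>g. pdeg n g \<and> (\<forall>v. f v = (v \<bullet> \<alpha>) * g v)"
  using pdeg_diff_hyperproj[OF assms(2,1)] assms(3)[OF hyperproj_inner[OF assms(2)]] by simp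

lemma polynomial_divide:
  fixes f :: "'a::euclidean_space \<Rightarrow> real"
  assumes "real_polynomial_function f" "\<alpha> \<noteq> 0" "\<And>v. v \<bullet> \<alpha> = 0 \<Longrightarrow> f v = 0"
  shows "\<exists>g. real_polynomial_function g \<and> (\<forall>v. f v = (v \<bullet> \<alpha>) * g v)"
proof -
  obtain n where "pdeg n f" using polynomial_imp_pdeg assms(1) by blast
  then have "pdeg (Suc n) f" by (rule pdeg_Suc)
  then show ?thesis using pdeg_divide assms(2,3) pdeg_imp_polynomial by metis
qed

text \<open>Since \<open>u\<close> leaves the hyperplane, its complement is dense in
  \<open>S\<close>, and continuity of \<open>f\<close> gives the rest. The version relative to a
  subspace serves to compare polynomials on a reflecting hyperplane.\<close>

lemma cancel_linear_factor:
  fixes f :: "'a::euclidean_space \<Rightarrow> real"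
  assumes "real_polynomial_function f" "subspace S" "u \<in> S" "u \<bullet> \<alpha> \<noteq> 0"
    "\<And>v. v \<in> S \<Longrightarrow> (v \<bullet> \<alpha>) * f v = 0" "v \<in> S"
  shows "f v = 0"
proof (cases "v \<bullet> \<alpha> = 0")
  case False then show ?thesis using assms by fastforce
next
  case True
  have c: "continuous (at v) f" using assms(1) by (rule continuous_real_polymonial_function)
  have t: "(\<lambda>n. v + (1 / real (Suc n)) *\<^sub>R u) \<longlonglongrightarrow> v + 0 *\<^sub>R u"
    by (intro tendsto_intros LIMSEQ_Suc[OF lim_1_over_n])
  have "(\<lambda>n. f (v + (1 / real (Suc n)) *\<^sub>R u)) \<longlonglongrightarrow> f v"
    using isCont_tendsto_compose[OF c] t by simp
  moreover have "f (v + (1 / real (Suc n)) *\<^sub>R u) = 0" for n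
  proof -
    have "v + (1 / real (Suc n)) *\<^sub>R u \<in> S"
      using assms by (intro subspace_add subspace_scale)
    then have "((v + (1 / real (Suc n)) *\<^sub>R u) \<bullet> \<alpha>) * f (v + (1 / real (Suc n)) *\<^sub>R u) = 0"
      using assms(5) by blast
    moreover have "(v + (1 / real (Suc n)) *\<^sub>R u) \<bullet> \<alpha> \<noteq> 0"
      using True assms(4) by (simp add: inner_add_left)
    ultimately show ?thesis by simp
  qed
  ultimately show ?thesis by (simp add: LIMSEQ_const_iff)
qed

lemma cancel_linear_factor_UNIV:
  fixes f :: "'a::euclidean_space \<Rightarrow> real"
  assumes "real_polynomial_function f" "\<alpha> \<noteq> 0" "\<And>v. (v \<bullet> \<alpha>) * f v = 0"
  shows "f v = 0"
  using cancel_linear_factor[of f UNIV \<alpha> \<alpha> v] assms by auto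

lemma polynomial_sum:
  fixes f :: "'i \<Rightarrow> 'a::euclidean_space \<Rightarrow> real"
  shows "(\<And>i. i \<in> I \<Longrightarrow> real_polynomial_function (f i)) \<Longrightarrow> real_polynomial_function (\<lambda>v. \<Sum>i\<in>I. f i v)"
  by (induction I rule: infinite_finite_induct) (auto intro: real_polynomial_function.intros)

lemma polynomial_prod:
  fixes f :: "'i \<Rightarrow> 'a::euclidean_space \<Rightarrow> real"
  shows "(\<And>i. i \<in> I \<Longrightarrow> real_polynomial_function (f i)) \<Longrightarrow> real_polynomial_function (\<lambda>v. \<Prod>i\<in>I. f i v)"
  by (induction I rule: infinite_finite_induct) (auto intro: real_polynomial_function.intros)

lemma polynomial_linear_comp:
  fixes f :: "'a::euclidean_space \<Rightarrow> real" and w :: "'a \<Rightarrow> 'a"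
  assumes "real_polynomial_function f" "linear w"
  shows "real_polynomial_function (\<lambda>v. f (w v))"
  using polynomial_imp_pdeg[OF assms(1)] pdeg_linear_comp[OF assms(2)] pdeg_imp_polynomial by blast

lemma polynomial_shift_comp:
  fixes f :: "'a::euclidean_space \<Rightarrow> real"
  assumes "real_polynomial_function f"
  shows "real_polynomial_function (\<lambda>v::'a::euclidean_space. f (v + c))"
proof -
  have "polynomial_function (\<lambda>v::'a. v + c)"
    by (intro polynomial_function_add polynomial_function_const polynomial_function_bounded_linear) (rule bounded_linear_ident)
  then show ?thesis using real_polynomial_function_compose[OF _ assms] by (simp add: o_def)
qed

lemma cancel_prod_linear:
  fixes f :: "'a::euclidean_space \<Rightarrow> real"
  assumes "finite Q" "0 \<notin> Q" "real_polynomial_function f" "\<And>v. (\<Prod>\<alpha>\<in>Q. v \<bullet> \<alpha>) * f v = 0"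
  shows "f v = 0"
  using assms
proof (induction Q arbitrary: f v rule: finite_induct)
  case empty then show ?case by simp
next
  case (insert \<alpha> Q)
  have "(\<Prod>\<beta>\<in>Q. v \<bullet> \<beta>) * f v = 0" for v
  proof (rule cancel_linear_factor_UNIV[of "\<lambda>v. (\<Prod>\<beta>\<in>Q. v \<bullet> \<beta>) * f v" \<alpha>])
    show "real_polynomial_function (\<lambda>v. (\<Prod>\<beta>\<in>Q. v \<bullet> \<beta>) * f v)"
      by (rule real_polynomial_function.intros(4)[OF polynomial_prod insert.prems(2)]) (rule polynomial_inner)
    show "\<alpha> \<noteq> 0" using insert.prems by auto
    show "(v \<bullet> \<alpha>) * ((\<Prod>\<beta>\<in>Q. v \<bullet> \<beta>) * f v) = 0" for v
      using insert.prems(3)[of v] insert.hyps by (simp add: mult.assoc)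
  qed
  then show ?case using insert.IH[OF _ insert.prems(2)] insert.prems(1) by simp
qed

text \<open>The witness is the component of \<alpha> orthogonal to \<beta>.\<close>

lemma not_proportional_witness:
  fixes \<alpha> \<beta> :: "'a::euclidean_space"
  assumes "\<beta> \<noteq> 0" "\<And>c. \<alpha> \<noteq> c *\<^sub>R \<beta>"
  obtains u where "u \<bullet> \<beta> = 0" "u \<bullet> \<alpha> \<noteq> 0"
proof
  show "hyperproj \<beta> \<alpha> \<bullet> \<beta> = 0" using assms by (simp add: hyperproj_inner)
  have "hyperproj \<beta> \<alpha> \<noteq> 0" using assms(2)[of "(\<alpha> \<bullet> \<beta>) / (\<beta> \<bullet> \<beta>)"] by (auto simp: hyperproj_def)
  moreover have "hyperproj \<beta> \<alpha> \<bullet> \<alpha> = hyperproj \<beta> \<alpha> \<bullet> hyperproj \<beta> \<alpha>"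
  proof -
    have "hyperproj \<beta> \<alpha> \<bullet> hyperproj \<beta> \<alpha> = hyperproj \<beta> \<alpha> \<bullet> (\<alpha> - ((\<alpha> \<bullet> \<beta>) / (\<beta> \<bullet> \<beta>)) *\<^sub>R \<beta>)"
      by (simp add: hyperproj_def)
    also have "\<dots> = hyperproj \<beta> \<alpha> \<bullet> \<alpha>" using hyperproj_inner[OF assms(1), of \<alpha>] by (simp add: inner_diff_right)
    finally show ?thesis by simp
  qed
  ultimately show "hyperproj \<beta> \<alpha> \<bullet> \<alpha> \<noteq> 0" by simp
qed

text \<open>One linear form is divided out at a time. The quotient still vanishes on the remaining
  hyperplanes: by non-proportionality the removed form is not identically zero on any of them, so it
  can be cancelled there.\<close>

lemma polynomial_divide_prod:
  fixes f :: "'a::euclidean_space \<Rightarrow> real"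
  assumes "finite Q" "0 \<notin> Q" "real_polynomial_function f"
    "\<And>\<alpha> v. \<alpha> \<in> Q \<Longrightarrow> v \<bullet> \<alpha> = 0 \<Longrightarrow> f v = 0"
    "\<And>\<alpha> \<beta> c. \<alpha> \<in> Q \<Longrightarrow> \<beta> \<in> Q \<Longrightarrow> \<alpha> \<noteq> \<beta> \<Longrightarrow> \<alpha> \<noteq> c *\<^sub>R \<beta>"
  shows "\<exists>g. real_polynomial_function g \<and> (\<forall>v. f v = (\<Prod>\<alpha>\<in>Q. v \<bullet> \<alpha>) * g v)"
  using assms
proof (induction Q arbitrary: f rule: finite_induct)
  case empty then show ?case by auto
next
  case (insert \<alpha> Q)
  have "\<alpha> \<noteq> 0" using insert by auto
  obtain g where g: "real_polynomial_function g" "\<And>v. f v = (v \<bullet> \<alpha>) * g v"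
    using polynomial_divide[OF insert.prems(2) \<open>\<alpha> \<noteq> 0\<close> insert.prems(3)[OF insertI1]] by blast
  have "g v = 0" if "\<beta> \<in> Q" "v \<bullet> \<beta> = 0" for \<beta> v
  proof -
    have "\<beta> \<noteq> 0" using that insert by auto
    moreover have "\<alpha> \<noteq> \<beta>" using that insert.hyps by blast
    then have "\<alpha> \<noteq> c *\<^sub>R \<beta>" for c using insert.prems(4)[of \<alpha> \<beta> c] that by simp
    ultimately obtain u where u: "u \<bullet> \<beta> = 0" "u \<bullet> \<alpha> \<noteq> 0" using not_proportional_witness by metis
    show ?thesis
    proof (rule cancel_linear_factor[OF g(1), of "{v. v \<bullet> \<beta> = 0}" u \<alpha>])
      show "subspace {v. v \<bullet> \<beta> = 0}" by (auto simp: subspace_def inner_add_left)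
    next
      fix v' assume "v' \<in> {v. v \<bullet> \<beta> = 0}"
      then show "(v' \<bullet> \<alpha>) * g v' = 0" using insert.prems(3)[of \<beta> v'] that g(2) by auto
    qed (use u that in auto)
  qed
  then obtain h where "real_polynomial_function h" "\<And>v. g v = (\<Prod>\<alpha>\<in>Q. v \<bullet> \<alpha>) * h v"
    using insert.IH[of g] g(1) insert.prems by auto
  then show ?case using g insert.hyps by (intro exI[of _ h]) auto
qed

section \<open>Reflection groups and congruences along reflecting hyperplanes\<close>

lemma linear_reflection: "linear (reflection \<alpha>)"
  by (rule linearI) (simp_all add: reflection_def inner_add_left distrib_left add_divide_distrib scaleR_add_left scaleR_diff_right)

lemma reflection_adjoint: "reflection \<alpha> u \<bullet> v = u \<bullet> reflection \<alpha> v"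
  by (simp add: reflection_def inner_diff_left inner_diff_right inner_commute)

lemma reflection_reflection [simp]: "reflection \<alpha> (reflection \<alpha> v) = v"
  by (cases "\<alpha> = 0") (simp_all add: reflection_def inner_diff_left field_simps)

lemma reflection_self: "\<alpha> \<noteq> 0 \<Longrightarrow> reflection \<alpha> \<alpha> = - \<alpha>"
  by (simp add: reflection_def scaleR_2)

lemma reflection_fix: "v \<bullet> \<alpha> = 0 \<Longrightarrow> reflection \<alpha> v = v"
  by (simp add: reflection_def)

lemma reflection_inner_self: "\<alpha> \<noteq> 0 \<Longrightarrow> reflection \<alpha> v \<bullet> \<alpha> = - (v \<bullet> \<alpha>)"
  by (simp add: reflection_adjoint reflection_self)

lemma reflection_scale: "c \<noteq> 0 \<Longrightarrow> reflection (c *\<^sub>R \<alpha>) = reflection \<alpha>"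
  by (rule ext) (simp add: reflection_def divide_simps)

lemma reflection_inner [simp]: "reflection \<alpha> u \<bullet> reflection \<alpha> v = u \<bullet> v"
  by (simp add: reflection_adjoint)

lemma orthogonal_reflection: "orthogonal_transformation (reflection \<alpha>)"
  by (simp add: orthogonal_transformation_def linear_reflection)

lemma reflection_conj:
  assumes "orthogonal_transformation w"
  shows "w (reflection \<alpha> v) = reflection (w \<alpha>) (w v)"
  using assms by (simp add: orthogonal_transformation_def reflection_def linear_diff linear_scale)

lemma weyl_orthogonal:
  fixes R :: "'a::euclidean_space set"
  shows "w \<in> weyl_group R \<Longrightarrow> orthogonal_transformation w"
proof (induction rule: weyl_group.induct)
  case id
  then show ?case using orthogonal_transformation_id by (simp add: id_def)
next
  case (comp v w)
  then show ?case by (metis orthogonal_transformation_compose)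
qed (simp_all add: orthogonal_reflection orthogonal_transformation_inv)

context
  fixes R :: "'a::euclidean_space set" and w assumes w: "w \<in> weyl_group R"
begin

lemma weyl_linear: "linear w" and weyl_inner: "w u \<bullet> w v = u \<bullet> v" and weyl_bij: "bij w"
  using weyl_orthogonal[OF w] orthogonal_transformation_bij
  by (auto simp: orthogonal_transformation_def)

lemma weyl_inv_left [simp]: "inv w (w v) = v" and weyl_inv_right [simp]: "w (inv w v) = v"
  using weyl_bij by (simp_all add: bij_is_inj bij_is_surj surj_f_inv_f)

lemma weyl_comp_inv: "w \<circ> inv w = id" "inv w \<circ> w = id"
  by (auto simp: fun_eq_iff)

lemma weyl_adjoint: "w u \<bullet> v = u \<bullet> inv w v"
  using weyl_inner[of u "inv w v"] by simp

lemma weyl_adjoint': "u \<bullet> w v = inv w u \<bullet> v"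
  using weyl_inner[of "inv w u" "v"] by simp

lemma weyl_norm: "w v \<bullet> w v = v \<bullet> v" by (rule weyl_inner)

lemma weyl_add: "w (u + v) = w u + w v" and weyl_diff: "w (u - v) = w u - w v"
  and weyl_scale: "w (c *\<^sub>R v) = c *\<^sub>R w v" and weyl_0 [simp]: "w 0 = 0"
  using weyl_linear by (auto simp: linear_add linear_diff linear_scale linear_0)

lemma weyl_fix_orthogonal: "(\<And>\<alpha>. \<alpha> \<in> R \<Longrightarrow> v \<bullet> \<alpha> = 0) \<Longrightarrow> w v = v"
proof -
  assume "\<And>\<alpha>. \<alpha> \<in> R \<Longrightarrow> v \<bullet> \<alpha> = 0"
  with w show "w v = v"
  proof (induction rule: weyl_group.induct)
    case (inv w)
    then show ?case using weyl_orthogonal orthogonal_transformation_inj by (metis inv_f_f)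
  qed (auto simp: reflection_fix)
qed

lemma bij_betw_weyl_right: "bij_betw (\<lambda>g. g \<circ> w) (weyl_group R) (weyl_group R)"
proof (rule bij_betw_byWitness[of _ "\<lambda>g. g \<circ> inv w"])
  show "\<forall>g\<in>weyl_group R. (g \<circ> w) \<circ> inv w = g" "\<forall>g\<in>weyl_group R. (g \<circ> inv w) \<circ> w = g"
    by (auto simp: fun_eq_iff)
qed (use w in \<open>auto intro: weyl_group.comp weyl_group.inv\<close>)

end

lemma weyl_mono: "R' \<subseteq> R \<Longrightarrow> weyl_group R' \<subseteq> weyl_group R"
proof
  fix w assume "R' \<subseteq> R" "w \<in> weyl_group R'"
  then show "w \<in> weyl_group R"
    by (induction rule: weyl_group.induct[OF \<open>w \<in> weyl_group R'\<close>]) (auto intro: weyl_group.intros)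
qed

lemma weyl_empty: "weyl_group {} = {id}"
proof -
  have "w = id" if "w \<in> weyl_group {}" for w :: "'a \<Rightarrow> 'a"
    using that by (induction rule: weyl_group.induct) auto
  then show ?thesis by (auto intro: weyl_group.id)
qed

text \<open>The image of a tensor product in the functions of two variables. The algebra
  \<open>I\<close> for the second variable is a parameter because the proof uses invariants of
  \<open>W\<close>, invariants of stabilizers, and all polynomials.\<close>

inductive_set tens :: "('a \<Rightarrow> real) set \<Rightarrow> ('a::euclidean_space \<Rightarrow> 'a \<Rightarrow> real) set" for I where
  base: "real_polynomial_function p \<Longrightarrow> g \<in> I \<Longrightarrow> (\<lambda>v y. p v * g y) \<in> tens I"
| add: "F \<in> tens I \<Longrightarrow> G \<in> tens I \<Longrightarrow> (\<lambda>v y. F v y + G v y) \<in> tens I"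

context
  fixes I :: "('a::euclidean_space \<Rightarrow> real) set" and H :: "('a \<Rightarrow> 'a) set"
  assumes I: "I = invariant_polynomials H"
begin

lemma tens_left: "real_polynomial_function p \<Longrightarrow> (\<lambda>v y. p v) \<in> tens I"
  using tens.base[of p "\<lambda>_. 1" I] by (simp add: I invariant_polynomials_def real_polynomial_function.intros)

lemma tens_right: "g \<in> I \<Longrightarrow> (\<lambda>v y. g y) \<in> tens I"
  using tens.base[of "\<lambda>_. 1" g I] by (simp add: real_polynomial_function.intros)

lemma tens_mult: "F \<in> tens I \<Longrightarrow> G \<in> tens I \<Longrightarrow> (\<lambda>v y. F v y * G v y) \<in> tens I"
proof (induction rule: tens.induct)
  case (base p g)
  note pg = this
  from pg(3) show ?case
  proof (induction rule: tens.induct)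
    case (base q h)
    have "(\<lambda>v y. (p v * q v) * (g y * h y)) \<in> tens I"
      using pg base by (intro tens.base) (auto simp: I invariant_polynomials_def intro: real_polynomial_function.intros)
    then show ?case by (simp add: mult_ac)
  qed (auto simp: distrib_left intro: tens.add)
qed (auto simp: distrib_right intro: tens.add)

lemma tens_cmult: "F \<in> tens I \<Longrightarrow> (\<lambda>v y. c * F v y) \<in> tens I"
  using tens_mult[OF tens_left[of "\<lambda>_. c"]] by (simp add: real_polynomial_function.intros)

lemma tens_diff: "F \<in> tens I \<Longrightarrow> G \<in> tens I \<Longrightarrow> (\<lambda>v y. F v y - G v y) \<in> tens I"
  using tens.add[OF _ tens_cmult[of G "-1"], of F] by simp

lemma tens_sum: "(\<And>i. i \<in> A \<Longrightarrow> F i \<in> tens I) \<Longrightarrow> (\<lambda>v y. \<Sum>i\<in>A. F i v y) \<in> tens I"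
  by (induction A rule: infinite_finite_induct)
    (auto intro: tens.add tens_left real_polynomial_function.intros)

lemma tens_prod: "(\<And>i. i \<in> A \<Longrightarrow> F i \<in> tens I) \<Longrightarrow> (\<lambda>v y. \<Prod>i\<in>A. F i v y) \<in> tens I"
  by (induction A rule: infinite_finite_induct)
    (auto intro: tens_mult tens_left real_polynomial_function.intros)

lemma tens_left_comp:
  assumes "\<And>p. real_polynomial_function p \<Longrightarrow> real_polynomial_function (\<lambda>v. p (f v))"
  shows "F \<in> tens I \<Longrightarrow> (\<lambda>v y. F (f v) y) \<in> tens I"
  by (induction rule: tens.induct) (auto intro: tens.intros assms)

lemma tens_invariant: "F \<in> tens I \<Longrightarrow> h \<in> H \<Longrightarrow> F v (h y) = F v y"
  by (induction rule: tens.induct) (auto simp: I invariant_polynomials_def)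

end

section \<open>Finite reduced root sets, divided differences and the congruence description\<close>

locale reflection_roots =
  fixes R :: "'a::euclidean_space set"
  assumes fin: "finite R" and nz: "0 \<notin> R"
    and refl: "\<alpha> \<in> R \<Longrightarrow> \<beta> \<in> R \<Longrightarrow> reflection \<alpha> \<beta> \<in> R"
    and red: "\<alpha> \<in> R \<Longrightarrow> c *\<^sub>R \<alpha> \<in> R \<Longrightarrow> c = 1 \<or> c = -1"
begin

lemma minus: "\<alpha> \<in> R \<Longrightarrow> - \<alpha> \<in> R"
  using refl[of \<alpha> \<alpha>] nz by (metis reflection_self)

lemma root_nz: "\<alpha> \<in> R \<Longrightarrow> \<alpha> \<noteq> 0" using nz by blast

lemma weyl_root: "w \<in> weyl_group R \<Longrightarrow> \<alpha> \<in> R \<Longrightarrow> w \<alpha> \<in> R"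
proof (induction arbitrary: \<alpha> rule: weyl_group.induct)
  case (inv w)
  have i: "inj_on w R" using weyl_bij[OF inv.hyps] by (metis bij_is_inj inj_on_subset subset_UNIV)
  have "w ` R = R" using inv.IH by (intro card_subset_eq) (auto simp: fin card_image[OF i])
  then obtain \<beta> where "\<beta> \<in> R" "\<alpha> = w \<beta>" using inv.prems by blast
  then show ?case using weyl_inv_left[OF inv.hyps] by simp
qed (auto simp: refl)

text \<open>An element is determined by its permutation of the roots, since it fixes the orthogonal
  complement of their span.\<close>

lemma finite_weyl: "finite (weyl_group R)"
proof -
  have "inj_on (\<lambda>w. restrict w R) (weyl_group R)"
  proof (rule inj_onI, rule ext)
    fix w w' v assume w: "w \<in> weyl_group R" "w' \<in> weyl_group R" and eq: "restrict w R = restrict w' R"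
    have R: "w \<alpha> = w' \<alpha>" if "\<alpha> \<in> R" for \<alpha> using eq that by (metis restrict_apply')
    obtain y z where yz: "y \<in> span R" "\<And>u. u \<in> span R \<Longrightarrow> orthogonal z u" "v = y + z"
      using orthogonal_subspace_decomp_exists[of R v] by metis
    have "w y = w' y"
      using linear_eq_on_span[OF weyl_linear[OF w(1)] weyl_linear[OF w(2)], of R y] R yz(1) by blast
    moreover have "z \<bullet> \<alpha> = 0" if "\<alpha> \<in> R" for \<alpha>
      using yz(2)[OF span_base[OF that]] by (simp add: orthogonal_def)
    then have "w z = z" "w' z = z" using w weyl_fix_orthogonal by blast+
    ultimately show "w v = w' v" using w yz(3) by (simp add: weyl_add)
  qed
  moreover have "(\<lambda>w. restrict w R) ` weyl_group R \<subseteq> R \<rightarrow>\<^sub>E R"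
    using weyl_root by (auto simp: restrict_def)
  then have "finite ((\<lambda>w. restrict w R) ` weyl_group R)"
    using finite_PiE[OF fin] fin by (metis finite_subset)
  ultimately show ?thesis using finite_imageD by blast
qed

lemma card_weyl_pos: "card (weyl_group R) > 0"
  using finite_weyl weyl_group.id[of R] card_gt_0_iff by blast

lemma not_proportional:
  assumes "\<alpha> \<in> R" "\<beta> \<in> R" "\<alpha> \<noteq> \<beta>" "\<alpha> \<noteq> - \<beta>" shows "\<alpha> \<noteq> c *\<^sub>R \<beta>"
  using red[of \<beta> c] assms by auto

lemma roots_subset:
  assumes "S \<subseteq> R" "\<And>\<alpha> \<beta>. \<alpha> \<in> S \<Longrightarrow> \<beta> \<in> S \<Longrightarrow> reflection \<alpha> \<beta> \<in> S"
  shows "reflection_roots S"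
proof
  show "finite S" using assms(1) fin finite_subset by blast
qed (use assms nz red in blast)+

text \<open>A choice that depends on the dividend only as a function: equal dividends get equal
  quotients, so invariance on cosets passes to quotients at once.\<close>

definition quot where
  "quot n \<alpha> f = (SOME g. pdeg n g \<and> (\<forall>v::'a. f v = (v \<bullet> \<alpha>) * g v))"

lemma quot:
  assumes "pdeg (Suc n) f" "\<alpha> \<in> R" "\<And>v. v \<bullet> \<alpha> = 0 \<Longrightarrow> f v = 0"
  shows "pdeg n (quot n \<alpha> f)" "f v = (v \<bullet> \<alpha>) * quot n \<alpha> f v"
proof -
  have "\<exists>g. pdeg n g \<and> (\<forall>v::'a. f v = (v \<bullet> \<alpha>) * g v)"
    using pdeg_divide[OF assms(1) root_nz[OF assms(2)]] assms(3) by blast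
  then have "pdeg n (quot n \<alpha> f) \<and> (\<forall>v::'a. f v = (v \<bullet> \<alpha>) * quot n \<alpha> f v)"
    unfolding quot_def by (rule someI_ex)
  then show "pdeg n (quot n \<alpha> f)" "f v = (v \<bullet> \<alpha>) * quot n \<alpha> f v" by auto
qed

text \<open>The congruences of Goresky, Kottwitz and MacPherson, known from the equivariant
  cohomology of partial flag varieties. If \<open>H\<close> is the stabilizer of a point, the cosets
  index the points of its orbit. The strict degree bound \<open>n\<close> is the induction
  parameter.\<close>

definition gkm where
  "gkm n H \<Phi> \<longleftrightarrow> (\<forall>w\<in>weyl_group R. pdeg n (\<Phi> w)) \<and>
     (\<forall>w\<in>weyl_group R. \<forall>h\<in>H. \<Phi> (w \<circ> h) = \<Phi> w) \<and>
     (\<forall>w\<in>weyl_group R. \<forall>\<alpha>\<in>R. \<forall>v. v \<bullet> \<alpha> = 0 \<longrightarrow> \<Phi> w v = \<Phi> (reflection \<alpha> \<circ> w) v)"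

text \<open>The function \<open>\<Theta> w\<close> is the restriction of \<open>F(v, y)\<close> to the graph \<open>v = w y\<close>.\<close>

definition represented where
  "represented H \<Theta> \<longleftrightarrow> (\<exists>F\<in>tens (invariant_polynomials H). \<forall>w\<in>weyl_group R. \<forall>y. F (w y) y = \<Theta> w y)"

lemma polynomial_zero_on_hyperplane:
  assumes "real_polynomial_function f" "\<alpha> \<in> R" "\<beta> \<in> R" "\<alpha> \<noteq> \<beta>" "\<alpha> \<noteq> - \<beta>"
    "\<And>v. v \<bullet> \<beta> = 0 \<Longrightarrow> (v \<bullet> \<alpha>) * f v = 0" "v \<bullet> \<beta> = 0"
  shows "f v = 0"
proof -
  obtain u where u: "u \<bullet> \<beta> = 0" "u \<bullet> \<alpha> \<noteq> 0"
    using not_proportional_witness[OF root_nz[OF assms(3)], of \<alpha>] not_proportional assms by metis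
  show ?thesis
  proof (rule cancel_linear_factor[OF assms(1), of "{v. v \<bullet> \<beta> = 0}" u \<alpha>])
    show "subspace {v. v \<bullet> \<beta> = 0}" by (auto simp: subspace_def inner_add_left)
  qed (use assms u in auto)
qed

text \<open>The divided difference acts on the left and so commutes with the right action of
  \<open>H\<close>. Its congruence along \<alpha> comes from a symmetry of the quotient, the one
  along another root \<beta> from conjugating the reflection in \<beta> by that in \<alpha>.\<close>

lemma gkm_divided_difference:
  assumes g: "gkm (Suc n) H \<Phi>" and H: "H \<subseteq> weyl_group R" and \<alpha>: "\<alpha> \<in> R"
  shows "\<exists>\<Psi>. gkm n H \<Psi> \<and> (\<forall>w\<in>weyl_group R. \<forall>v.
    \<Phi> w v - \<Phi> (reflection \<alpha> \<circ> w) (reflection \<alpha> v) = (v \<bullet> \<alpha>) * \<Psi> w v)"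
proof -
  define \<Psi> where "\<Psi> = (\<lambda>w. quot n \<alpha> (\<lambda>v. \<Phi> w v - \<Phi> (reflection \<alpha> \<circ> w) (reflection \<alpha> v)))"
  have deg: "pdeg (Suc n) (\<Phi> w)" if "w \<in> weyl_group R" for w using g that by (auto simp: gkm_def)
  have inv: "\<Phi> (w \<circ> h) = \<Phi> w" if "w \<in> weyl_group R" "h \<in> H" for w h using g that by (auto simp: gkm_def)
  have cong: "\<Phi> w v = \<Phi> (reflection \<alpha> \<circ> w) v" if "w \<in> weyl_group R" "\<alpha> \<in> R" "v \<bullet> \<alpha> = 0" for w v \<alpha>
    using g that by (auto simp: gkm_def)
  have sw: "reflection \<alpha> \<circ> w \<in> weyl_group R" if "w \<in> weyl_group R" "\<alpha> \<in> R" for w \<alpha>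
    using that by (auto intro: weyl_group.intros)
  have q: "pdeg n (\<Psi> w)" "\<Phi> w v - \<Phi> (reflection \<alpha> \<circ> w) (reflection \<alpha> v) = (v \<bullet> \<alpha>) * \<Psi> w v"
    if w: "w \<in> weyl_group R" for w v
  proof -
    have 1: "pdeg (Suc n) (\<lambda>v. \<Phi> w v - \<Phi> (reflection \<alpha> \<circ> w) (reflection \<alpha> v))"
      by (intro pdeg_diff deg w pdeg_linear_comp[OF linear_reflection] sw \<alpha>)
    have 2: "\<Phi> w v - \<Phi> (reflection \<alpha> \<circ> w) (reflection \<alpha> v) = 0" if "v \<bullet> \<alpha> = 0" for v
      using cong[OF w \<alpha> that] by (simp add: reflection_fix that)
    show "pdeg n (\<Psi> w)" unfolding \<Psi>_def by (rule quot(1)[OF 1 \<alpha> 2])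
    show "\<Phi> w v - \<Phi> (reflection \<alpha> \<circ> w) (reflection \<alpha> v) = (v \<bullet> \<alpha>) * \<Psi> w v"
      unfolding \<Psi>_def by (rule quot(2)[OF 1 \<alpha> 2])
  qed
  have qpoly: "real_polynomial_function (\<Psi> w)" if "w \<in> weyl_group R" for w
    using q(1)[OF that] pdeg_imp_polynomial by blast
  have inv': "\<Psi> (w \<circ> h) = \<Psi> w" if "w \<in> weyl_group R" "h \<in> H" for w h
  proof -
    have "reflection \<alpha> \<circ> (w \<circ> h) = (reflection \<alpha> \<circ> w) \<circ> h" by auto
    then show ?thesis unfolding \<Psi>_def using inv that sw[OF that(1) \<alpha>] by simp
  qed
  have "\<Psi> w v = \<Psi> (reflection \<beta> \<circ> w) v" if w: "w \<in> weyl_group R" and \<beta>: "\<beta> \<in> R" and v: "v \<bullet> \<beta> = 0" for w \<beta> v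
  proof (cases "\<alpha> = \<beta> \<or> \<alpha> = - \<beta>")
    case True
    then have s: "reflection \<beta> = reflection \<alpha>" using reflection_scale[of "-1" \<beta>] by auto
    have va: "v \<bullet> \<alpha> = 0" using True v by auto
    \<comment> \<open>The defining quotient is symmetric under simultaneously reflecting index and
      argument: numerator and denominator both change sign. On the hyperplane, where the reflection
      is the identity, this is the congruence.\<close>
    have "\<Psi> (reflection \<alpha> \<circ> w) u - \<Psi> w (reflection \<alpha> u) = 0" for u
    proof (rule cancel_linear_factor_UNIV[where f = "\<lambda>u. \<Psi> (reflection \<alpha> \<circ> w) u - \<Psi> w (reflection \<alpha> u)", OF _ root_nz[OF \<alpha>]])
      show "real_polynomial_function (\<lambda>u. \<Psi> (reflection \<alpha> \<circ> w) u - \<Psi> w (reflection \<alpha> u))"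
        by (intro real_polynomial_function_diff qpoly sw w \<alpha> polynomial_linear_comp linear_reflection)
      fix u
      have e: "reflection \<alpha> \<circ> (reflection \<alpha> \<circ> w) = w" by (auto simp: fun_eq_iff)
      show "(u \<bullet> \<alpha>) * (\<Psi> (reflection \<alpha> \<circ> w) u - \<Psi> w (reflection \<alpha> u)) = 0"
        using q(2)[OF sw[OF w \<alpha>], of u] q(2)[OF w, of "reflection \<alpha> u"] reflection_inner_self[OF root_nz[OF \<alpha>], of u]
        by (simp only: e reflection_reflection) (simp add: algebra_simps)
    qed
    from this[of v] show ?thesis using s va by (simp add: reflection_fix)
  next
    case False
    let ?\<gamma> = "reflection \<alpha> \<beta>"
    have \<gamma>: "?\<gamma> \<in> R" by (intro refl \<alpha> \<beta>)
    have "\<Psi> w v - \<Psi> (reflection \<beta> \<circ> w) v = 0"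
    proof (rule polynomial_zero_on_hyperplane[where f = "\<lambda>v. \<Psi> w v - \<Psi> (reflection \<beta> \<circ> w) v", OF _ \<alpha> \<beta> _ _ _ v])
      show "real_polynomial_function (\<lambda>v. \<Psi> w v - \<Psi> (reflection \<beta> \<circ> w) v)"
        by (intro real_polynomial_function_diff qpoly sw w \<beta>)
      fix u assume u: "u \<bullet> \<beta> = 0"
      \<comment> \<open>With this conjugation relation both terms of the numerator at
        \<open>w\<close> agree on the hyperplane of \<beta> with those at
        \<open>reflection \<beta> \<circ> w\<close>: the first by the congruence along \<beta>, the
        second by the one along \<open>?\<gamma>\<close>. The factor
        \<open>u \<bullet> \<alpha>\<close> is then cancelled on that hyperplane.\<close>
      have e: "reflection ?\<gamma> \<circ> (reflection \<alpha> \<circ> w) = reflection \<alpha> \<circ> (reflection \<beta> \<circ> w)"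
        using reflection_conj[OF orthogonal_reflection[of \<alpha>], of \<beta>] by (simp add: fun_eq_iff)
      have "\<Phi> w u = \<Phi> (reflection \<beta> \<circ> w) u" by (rule cong[OF w \<beta> u])
      moreover have "\<Phi> (reflection \<alpha> \<circ> w) (reflection \<alpha> u) = \<Phi> (reflection \<alpha> \<circ> (reflection \<beta> \<circ> w)) (reflection \<alpha> u)"
        using cong[OF sw[OF w \<alpha>] \<gamma>, of "reflection \<alpha> u"] u by (simp add: e)
      ultimately show "(u \<bullet> \<alpha>) * (\<Psi> w u - \<Psi> (reflection \<beta> \<circ> w) u) = 0"
        using q(2)[OF w, of u] q(2)[OF sw[OF w \<beta>], of u] unfolding right_diff_distrib by linarith
    qed (use False in auto)
    then show ?thesis by simp
  qed
  then have "gkm n H \<Psi>" using q(1) inv' unfolding gkm_def by blast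
  moreover have "\<forall>w\<in>weyl_group R. \<forall>v. \<Phi> w v - \<Phi> (reflection \<alpha> \<circ> w) (reflection \<alpha> v) = (v \<bullet> \<alpha>) * \<Psi> w v"
    by (intro ballI allI q(2))
  ultimately show ?thesis by (intro exI[of _ \<Psi>] conjI)
qed

lemma represented_shift:
  assumes "represented H \<Theta>" "g \<in> weyl_group R" shows "represented H (\<lambda>w y. \<Theta> (g \<circ> w) y)"
proof -
  obtain F where F: "F \<in> tens (invariant_polynomials H)" "\<And>w y. w \<in> weyl_group R \<Longrightarrow> F (w y) y = \<Theta> w y"
    using assms(1) by (auto simp: represented_def)
  have "(\<lambda>v y. F (g v) y) \<in> tens (invariant_polynomials H)"
    by (rule tens_left_comp[OF HOL.refl _ F(1)]) (rule polynomial_linear_comp[OF _ weyl_linear[OF assms(2)]])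
  moreover have "F (g (w y)) y = \<Theta> (g \<circ> w) y" if "w \<in> weyl_group R" for w y
    using F(2)[of "g \<circ> w" y] weyl_group.comp[OF assms(2) that] by simp
  ultimately show ?thesis unfolding represented_def by (intro bexI[of _ "\<lambda>v y. F (g v) y"]) auto
qed

lemma represented_diff:
  assumes "represented H \<Theta>" "represented H \<Theta>'" shows "represented H (\<lambda>w y. \<Theta> w y - \<Theta>' w y)"
  using assms tens_diff[OF HOL.refl] unfolding represented_def by (metis (no_types, lifting))

lemma represented_cmult:
  assumes "represented H \<Theta>" shows "represented H (\<lambda>w y. c * \<Theta> w y)"
  using assms tens_cmult[OF HOL.refl] unfolding represented_def by (metis (no_types, lifting))

lemma represented_add:
  assumes "represented H \<Theta>" "represented H \<Theta>'" shows "represented H (\<lambda>w y. \<Theta> w y + \<Theta>' w y)"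
  using represented_diff[OF assms(1) represented_cmult[OF assms(2), of "-1"]] by simp

lemma represented_sum:
  assumes "\<And>i. i \<in> A \<Longrightarrow> represented H (\<Theta> i)" shows "represented H (\<lambda>w y. \<Sum>i\<in>A. \<Theta> i w y)"
proof -
  have "\<forall>i\<in>A. \<exists>F\<in>tens (invariant_polynomials H). \<forall>w\<in>weyl_group R. \<forall>y. F (w y) y = \<Theta> i w y"
    using assms by (auto simp: represented_def)
  then obtain F where "\<And>i. i \<in> A \<Longrightarrow> F i \<in> tens (invariant_polynomials H)"
    "\<And>i w y. i \<in> A \<Longrightarrow> w \<in> weyl_group R \<Longrightarrow> F i (w y) y = \<Theta> i w y"
    by (metis (no_types, lifting))
  then show ?thesis unfolding represented_def
    by (intro bexI[of _ "\<lambda>v y. \<Sum>i\<in>A. F i v y"] tens_sum[OF HOL.refl]) auto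
qed

text \<open>
  Divided differences lower the degree, so by induction every translate of \<open>\<Phi>\<close> under the group agrees with \<open>\<Phi>\<close> up to
  represented functions. The average over the group is a function of \<open>y\<close> alone.
\<close>

theorem gkm_represented:
  assumes "gkm n H \<Phi>" "H \<subseteq> weyl_group R"
  shows "represented H (\<lambda>w y. \<Phi> w (w y))"
  using assms(1)
proof (induction n arbitrary: \<Phi>)
  case 0
  then have "\<Phi> w = (\<lambda>_. 0)" if "w \<in> weyl_group R" for w using that pdeg_0 by (auto simp: gkm_def)
  then show ?case unfolding represented_def
    by (intro bexI[of _ "\<lambda>v y. 0"] tens_left[OF HOL.refl]) (auto intro: real_polynomial_function.intros)
next
  case (Suc n)
  define \<Theta> where "\<Theta> = (\<lambda>w y. \<Phi> w (w y))"
  have deg: "pdeg (Suc n) (\<Phi> w)" if "w \<in> weyl_group R" for w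
    using Suc.prems that unfolding gkm_def by blast
  have inv\<Phi>: "\<Phi> (w \<circ> h) = \<Phi> w" if "w \<in> weyl_group R" "h \<in> H" for w h
    using Suc.prems that unfolding gkm_def by blast
  have step: "represented H (\<lambda>w y. \<Theta> w y - \<Theta> (g \<circ> w) y)" if "g \<in> weyl_group R" for g
    using that
  proof (induction rule: weyl_group.induct)
    case id
    have "represented H (\<lambda>w y. 0)" unfolding represented_def
      by (intro bexI[of _ "\<lambda>v y. 0"] tens_left[OF HOL.refl]) (auto intro: real_polynomial_function.intros)
    then show ?case by simp
  next
    case (refl \<alpha>)
    obtain \<Psi> where \<Psi>: "gkm n H \<Psi> \<and> (\<forall>w\<in>weyl_group R. \<forall>v.
        \<Phi> w v - \<Phi> (reflection \<alpha> \<circ> w) (reflection \<alpha> v) = (v \<bullet> \<alpha>) * \<Psi> w v)"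
      using gkm_divided_difference[OF Suc.prems assms(2) refl] by (rule exE)
    note dd = conjunct1[OF \<Psi>] bspec[OF conjunct2[OF \<Psi>], THEN spec]
    obtain F where F: "F \<in> tens (invariant_polynomials H)" "\<And>w y. w \<in> weyl_group R \<Longrightarrow> F (w y) y = \<Psi> w (w y)"
      using Suc.IH[OF dd(1)] by (auto simp: represented_def)
    have "(\<lambda>v y. (v \<bullet> \<alpha>) * F v y) \<in> tens (invariant_polynomials H)"
      by (intro tens_mult[OF HOL.refl] tens_left[OF HOL.refl] F polynomial_inner)
    moreover have "(w y \<bullet> \<alpha>) * F (w y) y = \<Theta> w y - \<Theta> (reflection \<alpha> \<circ> w) y" if "w \<in> weyl_group R" for w y
      using dd(2)[OF that, of "w y"] F(2)[OF that, of y] by (simp add: \<Theta>_def)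
    ultimately show ?case unfolding represented_def
      by (intro bexI[of _ "\<lambda>v y. (v \<bullet> \<alpha>) * F v y"]) auto
  next
    case (comp g h)
    then show ?case
      using represented_add[OF comp.IH(2) represented_shift[OF comp.IH(1) comp.hyps(2)]] by (simp add: o_assoc)
  next
    case (inv g)
    then show ?case
      using represented_cmult[OF represented_shift[OF inv.IH weyl_group.inv[OF inv.hyps]], of "-1"]
      by (simp add: o_assoc weyl_comp_inv)
  qed
  define \<psi> where "\<psi> = (\<lambda>y. \<Sum>g\<in>weyl_group R. \<Theta> g y)"
  have "real_polynomial_function (\<Theta> g)" if "g \<in> weyl_group R" for g unfolding \<Theta>_def
    by (rule polynomial_linear_comp[OF pdeg_imp_polynomial[OF deg[OF that]] weyl_linear[OF that]])
  then have "real_polynomial_function \<psi>" unfolding \<psi>_def by (rule polynomial_sum)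
  moreover have "\<psi> (h y) = \<psi> y" if "h \<in> H" for h y
  proof -
    have hW: "h \<in> weyl_group R" using that assms(2) by auto
    \<comment> \<open>Right translation by \<open>h\<close> permutes the summands, and \<Phi> does
      not notice it, being constant on cosets of \<open>H\<close>.\<close>
    have "\<psi> y = (\<Sum>g\<in>weyl_group R. \<Theta> (g \<circ> h) y)"
      unfolding \<psi>_def by (rule sum.reindex_bij_betw[OF bij_betw_weyl_right[OF hW], symmetric])
    also have "\<dots> = \<psi> (h y)" unfolding \<psi>_def \<Theta>_def
      by (rule sum.cong) (simp_all add: inv\<Phi> that)
    finally show ?thesis by simp
  qed
  ultimately have "\<psi> \<in> invariant_polynomials H" by (auto simp: invariant_polynomials_def)
  then have "(\<lambda>v. \<psi>) \<in> tens (invariant_polynomials H)" by (rule tens_right[OF HOL.refl])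
  then have rep\<psi>: "represented H (\<lambda>w. \<psi>)" unfolding represented_def by (rule bexI[rotated]) simp
  have "represented H (\<lambda>w y. \<Sum>g\<in>weyl_group R. \<Theta> w y - \<Theta> (g \<circ> w) y)"
    by (rule represented_sum) (rule step)
  note rep = represented_cmult[OF represented_add[OF this rep\<psi>], of "1 / card (weyl_group R)"]
  have "(1 / card (weyl_group R)) * ((\<Sum>g\<in>weyl_group R. \<Theta> w y - \<Theta> (g \<circ> w) y) + \<psi> y) = \<Theta> w y"
    if "w \<in> weyl_group R" for w y
  proof -
    have "(\<Sum>g\<in>weyl_group R. \<Theta> (g \<circ> w) y) = \<psi> y"
      unfolding \<psi>_def by (rule sum.reindex_bij_betw[OF bij_betw_weyl_right[OF that]])
    then show ?thesis using card_weyl_pos by (simp add: sum_subtractf)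
  qed
  with rep show ?case unfolding represented_def \<Theta>_def by simp
qed

end

section \<open>Stabilizers in Weyl groups and affine Weyl groups\<close>

context reflection_roots begin

text \<open>
  The product of the roots not vanishing at \<open>p\<close>, supported on the subgroup generated by the other roots, satisfies the
  congruences; its representing function separates that subgroup from the rest of the stabilizer.
\<close>

theorem stabilizer_reflections:
  assumes k: "k \<in> weyl_group R" "k p = p"
  shows "k \<in> weyl_group {\<alpha> \<in> R. p \<bullet> \<alpha> = 0}" (is "k \<in> weyl_group ?P")
proof -
  define D where "D = (\<lambda>v. \<Prod>\<alpha>\<in>R - ?P. v \<bullet> \<alpha>)"
  define \<Phi> where "\<Phi> = (\<lambda>w v. if w \<in> weyl_group ?P then D v else 0)"
  have "real_polynomial_function D" unfolding D_def by (intro polynomial_prod polynomial_inner)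
  then obtain n where n: "pdeg n D" using polynomial_imp_pdeg by blast
  have "gkm n {id} \<Phi>"
    unfolding gkm_def
  proof (intro conjI ballI allI impI)
    show "pdeg n (\<Phi> w)" for w using n pdeg.zero[of n] by (cases "w \<in> weyl_group ?P") (simp_all add: \<Phi>_def)
    show "\<Phi> (w \<circ> h) = \<Phi> w" if "h \<in> {id}" for w h using that by simp
    fix w \<alpha> and v :: 'a assume a: "\<alpha> \<in> R" "v \<bullet> \<alpha> = 0"
    show "\<Phi> w v = \<Phi> (reflection \<alpha> \<circ> w) v"
    proof (cases "\<alpha> \<in> ?P")
      case True
      then have s: "reflection \<alpha> \<in> weyl_group ?P" by (rule weyl_group.refl)
      have e: "reflection \<alpha> \<circ> (reflection \<alpha> \<circ> w) = w" by (auto simp: fun_eq_iff)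
      have "w \<in> weyl_group ?P \<longleftrightarrow> reflection \<alpha> \<circ> w \<in> weyl_group ?P"
        using weyl_group.comp[OF s, of w] weyl_group.comp[OF s, of "reflection \<alpha> \<circ> w", unfolded e] by blast
      then show ?thesis by (simp add: \<Phi>_def)
    next
      case False
      then have "D v = 0" unfolding D_def using a fin by (intro prod_zero) auto
      then show ?thesis by (simp add: \<Phi>_def)
    qed
  qed
  then have "represented {id} (\<lambda>w y. \<Phi> w (w y))"
    by (rule gkm_represented) (simp add: weyl_group.id)
  then obtain F where F: "\<And>w y. w \<in> weyl_group R \<Longrightarrow> F (w y) y = \<Phi> w (w y)"
    unfolding represented_def by blast
  \<comment> \<open>\<open>F\<close> sees only the pair \<open>(k p, p)\<close>, which is the pair
    \<open>(p, p)\<close>.\<close>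
  have "\<Phi> k p = \<Phi> id p" using F[OF k(1), of p] F[OF weyl_group.id, of p] k(2) by simp
  moreover have "\<Phi> id p \<noteq> 0"
    using fin by (simp add: \<Phi>_def D_def weyl_group.id prod_zero_iff)
  ultimately have "\<Phi> k p \<noteq> 0" by simp
  then show ?thesis unfolding \<Phi>_def by meson
qed

text \<open>The elements that keep \<open>p\<close> in its open chamber form a finite set
  \<open>S\<close> permuted by left multiplication with \<open>k\<close>. The sum \<open>c\<close>
  of the points \<open>g p\<close> over \<open>S\<close> is then fixed by \<open>k\<close> and still
  lies in the open chamber, where no root vanishes, so the stabilizer of \<open>c\<close> is
  trivial.\<close>

lemma chamber_preserving_id:
  assumes k: "k \<in> weyl_group R" and p: "\<And>\<alpha>. \<alpha> \<in> R \<Longrightarrow> p \<bullet> \<alpha> \<noteq> 0"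
    and kp: "\<And>\<alpha>. \<alpha> \<in> R \<Longrightarrow> p \<bullet> \<alpha> > 0 \<Longrightarrow> k p \<bullet> \<alpha> > 0"
  shows "k = id"
proof -
  define S where "S = {g \<in> weyl_group R. \<forall>\<alpha>\<in>R. p \<bullet> \<alpha> > 0 \<longrightarrow> g p \<bullet> \<alpha> > 0}"
  have finS: "finite S" unfolding S_def using finite_weyl by simp
  have "k \<circ> g \<in> S" if "g \<in> S" for g
  proof -
    have "k (g p) \<bullet> \<alpha> > 0" if "\<alpha> \<in> R" "p \<bullet> \<alpha> > 0" for \<alpha>
    proof -
      have i: "inv k \<alpha> \<in> R" using weyl_root[OF weyl_group.inv[OF k]] that by blast
      have "p \<bullet> inv k \<alpha> > 0" using kp[OF that] weyl_adjoint[OF k] by simp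
      then show ?thesis using \<open>g \<in> S\<close> i weyl_adjoint[OF k] by (simp add: S_def)
    qed
    then show ?thesis using that k by (auto simp: S_def intro: weyl_group.comp)
  qed
  then have im: "(\<lambda>g. k \<circ> g) ` S \<subseteq> S" by auto
  moreover have inj: "inj_on (\<lambda>g. k \<circ> g) S"
    using fun.inj_map[OF bij_is_inj[OF weyl_bij[OF k]]] by (rule inj_on_subset) simp
  ultimately have S: "(\<lambda>g. k \<circ> g) ` S = S" using finS by (metis card_image card_subset_eq)
  define c where "c = (\<Sum>g\<in>S. g p)"
  have "k c = (\<Sum>g\<in>S. (k \<circ> g) p)" unfolding c_def using weyl_linear[OF k] by (simp add: linear_sum)
  also have "\<dots> = c" unfolding c_def using sum.reindex[OF inj, of "\<lambda>g. g p"] S by simp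
  finally have stab: "k \<in> weyl_group {\<alpha> \<in> R. c \<bullet> \<alpha> = 0}" by (rule stabilizer_reflections[OF k])
  have pos: "c \<bullet> \<alpha> > 0" if "\<alpha> \<in> R" "p \<bullet> \<alpha> > 0" for \<alpha>
  proof -
    have "id \<in> S" using weyl_group.id by (auto simp: S_def)
    then show ?thesis unfolding c_def inner_sum_left using that finS
      by (intro sum_pos) (auto simp: S_def)
  qed
  have "c \<bullet> \<alpha> \<noteq> 0" if "\<alpha> \<in> R" for \<alpha>
    using pos[OF that] pos[OF minus[OF that]] p[OF that] by (cases "p \<bullet> \<alpha> > 0") auto
  then have "{\<alpha> \<in> R. c \<bullet> \<alpha> = 0} = {}" by auto
  then show ?thesis using stab by (simp only: weyl_empty singleton_iff)
qed

end

section \<open>Generic vectors by small perturbations\<close>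

lemma eventually_perturb_pos:
  fixes x y :: real
  assumes "x > 0 \<or> x = 0 \<and> y > 0"
  shows "\<forall>\<^sub>F t in at_right 0. x + t * y > 0"
proof (cases "x > 0")
  case True
  have "((\<lambda>t. x + t * y) \<longlongrightarrow> x + 0 * y) (at_right 0)" by (intro tendsto_intros)
  then show ?thesis using True by (auto dest: order_tendstoD(1)[of _ _ _ 0])
next
  case False
  then have "x = 0" "y > 0" using assms by auto
  then show ?thesis using eventually_mono[OF eventually_at_right_less[of "0::real"]] by (simp add: zero_less_mult_iff)
qed

lemma eventually_perturb_neg:
  fixes x y :: real
  assumes "x < 0 \<or> x = 0 \<and> y < 0"
  shows "\<forall>\<^sub>F t in at_right 0. x + t * y < 0"
  using eventually_perturb_pos[of "-x" "-y"] assms by (auto elim: eventually_mono)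

lemma eventually_perturb_nz:
  fixes x y :: real
  assumes "x \<noteq> 0 \<or> y \<noteq> 0"
  shows "\<forall>\<^sub>F t in at_right 0. x + t * y \<noteq> 0"
proof (cases "x > 0 \<or> x = 0 \<and> y > 0")
  case True
  show ?thesis by (rule eventually_mono[OF eventually_perturb_pos[OF True]]) simp
next
  case False
  then have "x < 0 \<or> x = 0 \<and> y < 0" using assms by auto
  from eventually_perturb_neg[OF this] show ?thesis by (rule eventually_mono) simp
qed

lemma generic_vector:
  fixes B :: "'a::euclidean_space set"
  assumes "finite B" "subspace S" "\<And>b. b \<in> B \<Longrightarrow> \<exists>s\<in>S. s \<bullet> b \<noteq> 0"
  shows "\<exists>g\<in>S. \<forall>b\<in>B. g \<bullet> b \<noteq> 0"
  using assms(1,3)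
proof (induction B rule: finite_induct)
  case empty
  then show ?case using subspace_0[OF assms(2)] by auto
next
  case (insert b B)
  obtain g where g: "g \<in> S" "\<forall>b\<in>B. g \<bullet> b \<noteq> 0" using insert by auto
  obtain s where s: "s \<in> S" "s \<bullet> b \<noteq> 0" using insert.prems by auto
  have "\<forall>\<^sub>F t in at_right 0. \<forall>b'\<in>insert b B. g \<bullet> b' + t * (s \<bullet> b') \<noteq> 0"
    using insert.hyps g s by (intro eventually_ball_finite ballI eventually_perturb_nz) auto
  then obtain t where "\<forall>b'\<in>insert b B. g \<bullet> b' + t * (s \<bullet> b') \<noteq> 0"
    using eventually_happens[of _ "at_right (0::real)"] trivial_limit_at_right_real by blast
  then show ?case using g s assms(2)
    by (intro bexI[of _ "g + t *\<^sub>R s"]) (auto simp: inner_add_left subspace_add subspace_scale)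
qed

lemma generic_vector_near:
  fixes B :: "'a::euclidean_space set"
  assumes "finite B" "0 \<notin> B"
  obtains \<rho> where "\<And>b. b \<in> B \<Longrightarrow> \<rho> \<bullet> b \<noteq> 0" "\<And>b. b \<in> B \<Longrightarrow> p \<bullet> b > 0 \<Longrightarrow> \<rho> \<bullet> b > 0"
proof -
  have "\<exists>g\<in>UNIV. \<forall>b\<in>B. g \<bullet> b \<noteq> 0"
  proof (rule generic_vector[OF assms(1)])
    fix b assume "b \<in> B"
    then have "b \<bullet> b \<noteq> 0" using assms(2) by auto
    then show "\<exists>s\<in>UNIV. s \<bullet> b \<noteq> 0" by blast
  qed simp
  then obtain g where g: "\<forall>b\<in>B. g \<bullet> b \<noteq> 0" by blast
  have "\<forall>\<^sub>F t in at_right 0. \<forall>b\<in>B. p \<bullet> b + t * (g \<bullet> b) \<noteq> 0 \<and> (p \<bullet> b > 0 \<longrightarrow> p \<bullet> b + t * (g \<bullet> b) > 0)"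
    using g by (intro eventually_ball_finite[OF assms(1)] ballI eventually_conj eventually_perturb_nz)
      (auto intro: eventually_mono[OF eventually_perturb_pos])
  then obtain t where "\<forall>b\<in>B. p \<bullet> b + t * (g \<bullet> b) \<noteq> 0 \<and> (p \<bullet> b > 0 \<longrightarrow> p \<bullet> b + t * (g \<bullet> b) > 0)"
    using eventually_happens[of _ "at_right (0::real)"] trivial_limit_at_right_real by blast
  then show ?thesis by (intro that[of "p + t *\<^sub>R g"]) (auto simp: inner_add_left)
qed

section \<open>Coroot lattice and alcoves of the affine Weyl group\<close>

definition coroot :: "'a::euclidean_space \<Rightarrow> 'a" where "coroot \<beta> = (2 / (\<beta> \<bullet> \<beta>)) *\<^sub>R \<beta>"

lemma reflection_coroot: "reflection \<beta> v = v - (v \<bullet> \<beta>) *\<^sub>R coroot \<beta>"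
  by (simp add: reflection_def coroot_def mult.commute)

lemma coroot_minus: "coroot (- \<beta>) = - coroot \<beta>" by (simp add: coroot_def)

locale crystallographic_roots = reflection_roots +
  assumes cryst: "\<alpha> \<in> R \<Longrightarrow> \<beta> \<in> R \<Longrightarrow> 2 * (\<beta> \<bullet> \<alpha>) / (\<alpha> \<bullet> \<alpha>) \<in> \<int>"
begin

text \<open>Lists allow induction on the number of coroots in a sum. They reach negative multiples
  as well, since the coroot of \<open>- \<beta>\<close> is the negative of that of \<beta>.\<close>

definition coroot_lattice where
  "coroot_lattice = {sum_list (map coroot bs) | bs. set bs \<subseteq> R}"

lemma coroot_lattice_0: "0 \<in> coroot_lattice"
  unfolding coroot_lattice_def by (rule CollectI, rule exI[of _ "[]"]) simp

lemma coroot_lattice_coroot: "\<beta> \<in> R \<Longrightarrow> coroot \<beta> \<in> coroot_lattice"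
  unfolding coroot_lattice_def by (rule CollectI, rule exI[of _ "[\<beta>]"]) simp

lemma coroot_lattice_add: assumes "p \<in> coroot_lattice" "q \<in> coroot_lattice" shows "p + q \<in> coroot_lattice"
proof -
  obtain bs cs where "p = sum_list (map coroot bs)" "q = sum_list (map coroot cs)" "set bs \<subseteq> R" "set cs \<subseteq> R"
    using assms by (auto simp: coroot_lattice_def)
  then show ?thesis unfolding coroot_lattice_def by (auto intro!: exI[of _ "bs @ cs"])
qed

lemma coroot_lattice_weyl: assumes "w \<in> weyl_group R" "q \<in> coroot_lattice" shows "w q \<in> coroot_lattice"
proof -
  obtain bs where bs: "q = sum_list (map coroot bs)" "set bs \<subseteq> R"
    using assms by (auto simp: coroot_lattice_def)
  have "w (sum_list (map coroot bs)) = sum_list (map coroot (map w bs))"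
    by (induction bs) (auto simp: weyl_add[OF assms(1)] weyl_0[OF assms(1)] coroot_def weyl_scale[OF assms(1)] weyl_norm[OF assms(1)])
  moreover have "set (map w bs) \<subseteq> R" using bs weyl_root[OF assms(1)] by auto
  ultimately show ?thesis unfolding coroot_lattice_def bs by blast
qed

lemma coroot_lattice_minus: assumes "q \<in> coroot_lattice" shows "- q \<in> coroot_lattice"
proof -
  obtain bs where bs: "q = sum_list (map coroot bs)" "set bs \<subseteq> R"
    using assms by (auto simp: coroot_lattice_def)
  have "- sum_list (map coroot bs) = sum_list (map coroot (map uminus bs))"
    by (induction bs) (auto simp: coroot_minus)
  moreover have "set (map uminus bs) \<subseteq> R" using bs minus by auto
  ultimately show ?thesis unfolding coroot_lattice_def bs by blast
qed

lemma coroot_lattice_int: assumes "q \<in> coroot_lattice" "\<alpha> \<in> R" shows "q \<bullet> \<alpha> \<in> \<int>"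
proof -
  obtain bs where bs: "q = sum_list (map coroot bs)" "set bs \<subseteq> R"
    using assms by (auto simp: coroot_lattice_def)
  have "coroot \<beta> \<bullet> \<alpha> \<in> \<int>" if "\<beta> \<in> R" for \<beta>
    using cryst[OF that assms(2)] by (simp add: coroot_def inner_commute)
  with bs(2) have "sum_list (map coroot bs) \<bullet> \<alpha> \<in> \<int>"
    by (induction bs) (auto simp: inner_add_left)
  then show ?thesis using bs by simp
qed

text \<open>If \<open>q\<close> is nonzero, \<open>q \<bullet> q > 0\<close> forces some coroot in
  the list to pair positively with \<open>q\<close>. Integrality and the bound make the pairing with
  its root equal to 1, so reflecting \<open>q\<close> removes this coroot from the sum. The
  reflected vector obeys the same bound and has a shorter list.\<close>

lemma coroot_lattice_small:
  assumes "q \<in> coroot_lattice" "\<And>\<alpha>. \<alpha> \<in> R \<Longrightarrow> \<bar>q \<bullet> \<alpha>\<bar> \<le> 1"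
  shows "q = 0"
proof -
  have "q = 0" if "set bs \<subseteq> R" "q = sum_list (map coroot bs)" "\<And>\<alpha>. \<alpha> \<in> R \<Longrightarrow> \<bar>q \<bullet> \<alpha>\<bar> \<le> 1" for bs q
    using that
  proof (induction "length bs" arbitrary: bs q rule: less_induct)
    case less
    show ?case
    proof (rule ccontr)
      assume "q \<noteq> 0"
      then have "q \<bullet> q > 0" by simp
      have e: "sum_list (map coroot cs) \<bullet> q = sum_list (map (\<lambda>\<beta>. coroot \<beta> \<bullet> q) cs)" for cs
        by (induction cs) (auto simp: inner_add_left)
      have "\<exists>\<beta>\<in>set bs. coroot \<beta> \<bullet> q > 0"
      proof (rule ccontr)
        assume "\<not> ?thesis"
        then have "sum_list (map (\<lambda>\<beta>. coroot \<beta> \<bullet> q) bs) \<le> 0" by (intro sum_list_nonpos) auto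
        then have "q \<bullet> q \<le> 0" using e[of bs] unfolding less.prems(2)[symmetric] by linarith
        then show False using \<open>q \<bullet> q > 0\<close> by linarith
      qed
      then obtain \<beta> where \<beta>: "\<beta> \<in> set bs" "coroot \<beta> \<bullet> q > 0" by blast
      then have \<beta>R: "\<beta> \<in> R" using less.prems by auto
      have "q \<bullet> \<beta> > 0" using \<beta>(2) inner_ge_zero[of \<beta>] by (simp add: coroot_def inner_commute zero_less_divide_iff)
      moreover have "q \<bullet> \<beta> \<in> \<int>" using less.prems(1,2) coroot_lattice_int[OF _ \<beta>R, of q] unfolding coroot_lattice_def by blast
      ultimately have "q \<bullet> \<beta> = 1" using less.prems(3)[OF \<beta>R] by (auto elim!: Ints_cases)
      then have r: "reflection \<beta> q = q - coroot \<beta>" by (simp add: reflection_coroot)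
      have "reflection \<beta> q = 0"
      proof (rule less.hyps[of "remove1 \<beta> bs"])
        show "length (remove1 \<beta> bs) < length bs" using \<beta>(1) by (cases bs) (auto simp: length_remove1 dest: length_pos_if_in_set)
        show "set (remove1 \<beta> bs) \<subseteq> R" using less.prems(1) set_remove1_subset[of \<beta> bs] by blast
        show "reflection \<beta> q = sum_list (map coroot (remove1 \<beta> bs))"
          using r less.prems(2) sum_list_map_remove1[OF \<beta>(1), of coroot] by simp
        show "\<bar>reflection \<beta> q \<bullet> \<alpha>\<bar> \<le> 1" if "\<alpha> \<in> R" for \<alpha>
          using less.prems(3)[OF refl[OF \<beta>R that]] by (simp add: reflection_adjoint)
      qed
      then have "q = 0" using reflection_reflection[of \<beta> q] by (simp add: reflection_def)
      then show False using \<open>q \<noteq> 0\<close> by simp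
    qed
  qed
  then show ?thesis using assms by (auto simp: coroot_lattice_def)
qed

text \<open>A partial equivalence relation: by strictness, \<open>same_alcove c c\<close> expresses
  that \<open>c\<close> lies on no wall of the affine arrangement, that is, in some open
  alcove.\<close>

definition same_alcove where
  "same_alcove c c' \<longleftrightarrow> (\<forall>\<alpha>\<in>R. \<exists>j::int. j < c \<bullet> \<alpha> \<and> c \<bullet> \<alpha> < j + 1 \<and> j < c' \<bullet> \<alpha> \<and> c' \<bullet> \<alpha> < j + 1)"

lemma same_alcove_affine:
  assumes "same_alcove c c'" "w \<in> weyl_group R" "q \<in> coroot_lattice"
  shows "same_alcove (w c + q) (w c' + q)"
  unfolding same_alcove_def
proof
  fix \<alpha> assume \<alpha>: "\<alpha> \<in> R"
  obtain m :: int where m: "q \<bullet> \<alpha> = m" using coroot_lattice_int[OF assms(3) \<alpha>] by (auto elim: Ints_cases)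
  have "inv w \<alpha> \<in> R" using weyl_root[OF weyl_group.inv[OF assms(2)] \<alpha>] .
  then obtain j :: int where "j < c \<bullet> inv w \<alpha>" "c \<bullet> inv w \<alpha> < j + 1" "j < c' \<bullet> inv w \<alpha>" "c' \<bullet> inv w \<alpha> < j + 1"
    using assms(1) by (auto simp: same_alcove_def)
  then show "\<exists>j::int. j < (w c + q) \<bullet> \<alpha> \<and> (w c + q) \<bullet> \<alpha> < j + 1 \<and> j < (w c' + q) \<bullet> \<alpha> \<and> (w c' + q) \<bullet> \<alpha> < j + 1"
    by (intro exI[of _ "j + m"]) (simp add: inner_add_left m weyl_adjoint[OF assms(2)])
qed

text \<open>A root that is not integral at \<open>x\<close> keeps its floor under small
  perturbations. For an integral root the sign on \<rho> decides whether the perturbed points lie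
  just above or just below the wall; below it, the relevant integer is \<open>m - 1\<close>, and the
  hypothesis is applied to the negative root.\<close>

lemma same_alcove_perturb:
  assumes "\<And>\<alpha>. \<alpha> \<in> R \<Longrightarrow> x \<bullet> \<alpha> \<in> \<int> \<Longrightarrow> \<rho> \<bullet> \<alpha> \<noteq> 0 \<and> (\<rho> \<bullet> \<alpha> > 0 \<longrightarrow> \<rho>' \<bullet> \<alpha> > 0)"
  obtains t :: real where "same_alcove (x + t *\<^sub>R \<rho>) (x + t *\<^sub>R \<rho>')"
proof -
  have between: "\<forall>\<^sub>F t in at_right 0. \<exists>i::int. i < X + t * Y \<and> X + t * Y < i + 1 \<and> i < X + t * Y' \<and> X + t * Y' < i + 1"
    if h: "real_of_int j < X \<or> real_of_int j = X \<and> Y > 0 \<and> Y' > 0"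
      "X < real_of_int j + 1 \<or> X = real_of_int j + 1 \<and> Y < 0 \<and> Y' < 0" for j :: int and X Y Y' :: real
  proof -
    have l: "\<forall>\<^sub>F t in at_right 0. (X - j) + t * Y > 0" "\<forall>\<^sub>F t in at_right 0. (X - j) + t * Y' > 0"
      using h(1) by (auto intro!: eventually_perturb_pos)
    have u: "\<forall>\<^sub>F t in at_right 0. (X - (real_of_int j + 1)) + t * Y < 0" "\<forall>\<^sub>F t in at_right 0. (X - (real_of_int j + 1)) + t * Y' < 0"
      using h(2) by (auto intro!: eventually_perturb_neg)
    show ?thesis using l(1) l(2) u(1) u(2)
    proof eventually_elim
      case (elim t)
      then show ?case by (intro exI[of _ j]) linarith
    qed
  qed
  have "\<forall>\<^sub>F t in at_right 0. \<exists>i::int. i < x \<bullet> \<alpha> + t * (\<rho> \<bullet> \<alpha>) \<and> x \<bullet> \<alpha> + t * (\<rho> \<bullet> \<alpha>) < i + 1 \<and>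
      i < x \<bullet> \<alpha> + t * (\<rho>' \<bullet> \<alpha>) \<and> x \<bullet> \<alpha> + t * (\<rho>' \<bullet> \<alpha>) < i + 1" if \<alpha>: "\<alpha> \<in> R" for \<alpha>
  proof (cases "x \<bullet> \<alpha> \<in> \<int>")
    case False
    then have "real_of_int \<lfloor>x \<bullet> \<alpha>\<rfloor> \<noteq> x \<bullet> \<alpha>" by (metis Ints_of_int)
    then have "real_of_int \<lfloor>x \<bullet> \<alpha>\<rfloor> < x \<bullet> \<alpha>" "x \<bullet> \<alpha> < real_of_int \<lfloor>x \<bullet> \<alpha>\<rfloor> + 1"
      using of_int_floor_le[of "x \<bullet> \<alpha>"] by (linarith, simp)
    then show ?thesis by (intro between) auto
  next
    case True
    then obtain m :: int where m: "x \<bullet> \<alpha> = m" by (auto elim: Ints_cases)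
    show ?thesis
    proof (cases "\<rho> \<bullet> \<alpha> > 0")
      case True
      then show ?thesis using assms[OF \<alpha>] m by (intro between[of m]) auto
    next
      case False
      have "x \<bullet> (-\<alpha>) \<in> \<int>" using m by simp
      then show ?thesis using assms[OF minus[OF \<alpha>]] assms[OF \<alpha>] False m by (intro between[of "m - 1"]) auto
    qed
  qed
  then have "\<forall>\<^sub>F t in at_right 0. \<forall>\<alpha>\<in>R. \<exists>i::int. i < x \<bullet> \<alpha> + t * (\<rho> \<bullet> \<alpha>) \<and> x \<bullet> \<alpha> + t * (\<rho> \<bullet> \<alpha>) < i + 1 \<and>
      i < x \<bullet> \<alpha> + t * (\<rho>' \<bullet> \<alpha>) \<and> x \<bullet> \<alpha> + t * (\<rho>' \<bullet> \<alpha>) < i + 1"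
    by (intro eventually_ball_finite fin) auto
  then obtain t :: real where "\<forall>\<alpha>\<in>R. \<exists>i::int. i < x \<bullet> \<alpha> + t * (\<rho> \<bullet> \<alpha>) \<and> x \<bullet> \<alpha> + t * (\<rho> \<bullet> \<alpha>) < i + 1 \<and>
      i < x \<bullet> \<alpha> + t * (\<rho>' \<bullet> \<alpha>) \<and> x \<bullet> \<alpha> + t * (\<rho>' \<bullet> \<alpha>) < i + 1"
    using eventually_happens[of _ "at_right (0::real)"] trivial_limit_at_right_real by blast
  then show ?thesis by (intro that[of t]) (simp add: same_alcove_def inner_add_left)
qed

lemma coroot_norm: "\<alpha> \<noteq> 0 \<Longrightarrow> coroot \<alpha> \<bullet> coroot \<alpha> = 4 / (\<alpha> \<bullet> \<alpha>)"
  by (simp add: coroot_def field_simps)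

text \<open>If (\<alpha>, p) > 1, the affine reflection in the wall (\<alpha>, p) = 1 shortens
  \<open>p\<close>, and the squared length drops by at least a fixed \<kappa> > 0 along the whole
  orbit. Hence a point whose squared length is within \<kappa> of the infimum does the work of a
  minimizer.\<close>

lemma almost_shortest_representative:
  assumes c: "same_alcove c c"
  obtains w q where "w \<in> weyl_group R" "q \<in> coroot_lattice" "\<And>\<alpha>. \<alpha> \<in> R \<Longrightarrow> (w c + q) \<bullet> \<alpha> \<le> 1"
proof -
  define S where "S = {w c + q | w q. w \<in> weyl_group R \<and> q \<in> coroot_lattice}"
  \<comment> \<open>\<delta> bounds from below the distance by which an orbit point exceeds an
    integral wall, \<open>M\<close> bounds the squared root lengths from above. The inserted 1
    covers an empty \<open>R\<close>.\<close>
  define \<delta> where "\<delta> = Min (insert 1 ((\<lambda>\<alpha>. frac (c \<bullet> \<alpha>)) ` R))"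
  define M where "M = Max (insert 1 ((\<lambda>\<alpha>. \<alpha> \<bullet> \<alpha>) ` R))"
  have "frac (c \<bullet> \<alpha>) > 0" if \<alpha>: "\<alpha> \<in> R" for \<alpha>
  proof -
    obtain j :: int where "j < c \<bullet> \<alpha>" "c \<bullet> \<alpha> < j + 1" using c \<alpha> by (auto simp: same_alcove_def)
    then have "c \<bullet> \<alpha> \<notin> \<int>" by (auto elim!: Ints_cases)
    then show ?thesis by (simp add: frac_gt_0_iff)
  qed
  then have \<delta>: "\<delta> > 0" "\<And>\<alpha>. \<alpha> \<in> R \<Longrightarrow> \<delta> \<le> frac (c \<bullet> \<alpha>)" unfolding \<delta>_def using fin by auto
  have M: "M > 0" "\<And>\<alpha>. \<alpha> \<in> R \<Longrightarrow> \<alpha> \<bullet> \<alpha> \<le> M" unfolding M_def using fin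
    by (auto intro: Max_ge less_le_trans[OF _ Max_ge, of 0 1])
  define \<kappa> where "\<kappa> = 4 * \<delta> / M"
  have \<kappa>: "\<kappa> > 0" using \<delta> M by (simp add: \<kappa>_def)
  have red: "\<exists>p'\<in>S. p' \<bullet> p' \<le> p \<bullet> p - \<kappa>" if p: "p \<in> S" and \<alpha>: "\<alpha> \<in> R" "p \<bullet> \<alpha> > 1" for p \<alpha>
  proof -
    obtain w q where w: "w \<in> weyl_group R" "q \<in> coroot_lattice" "p = w c + q" using p by (auto simp: S_def)
    obtain m :: int where m: "q \<bullet> \<alpha> = m" using coroot_lattice_int[OF w(2) \<alpha>(1)] by (auto elim: Ints_cases)
    have "inv w \<alpha> \<in> R" using weyl_root[OF weyl_group.inv[OF w(1)] \<alpha>(1)] .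
    \<comment> \<open>Fractional parts at the roots are only permuted along the orbit:
      \<open>w\<close> permutes roots and \<open>q\<close> pairs integrally with them.\<close>
    then have "\<delta> \<le> frac (p \<bullet> \<alpha>)"
      using \<delta>(2) w m by (simp add: inner_add_left weyl_adjoint[OF w(1)] frac_def)
    moreover have "1 \<le> \<lfloor>p \<bullet> \<alpha>\<rfloor>" using \<alpha>(2) by (simp add: le_floor_iff)
    ultimately have d: "p \<bullet> \<alpha> - 1 \<ge> \<delta>" unfolding frac_def by linarith
    \<comment> \<open>The mirror image of \<open>p\<close> in the affine hyperplane where \<alpha>
      takes the value 1.\<close>
    define p' where "p' = reflection \<alpha> p + coroot \<alpha>"
    have s: "reflection \<alpha> \<in> weyl_group R" by (rule weyl_group.refl[OF \<alpha>(1)])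
    have "p' = (reflection \<alpha> \<circ> w) c + (reflection \<alpha> q + coroot \<alpha>)"
      unfolding p'_def w(3) using weyl_add[OF s] by simp
    then have "p' \<in> S" unfolding S_def
      using s w coroot_lattice_add[OF coroot_lattice_weyl[OF s w(2)] coroot_lattice_coroot[OF \<alpha>(1)]] weyl_group.comp by blast
    moreover have "p' \<bullet> p' = p \<bullet> p - 4 * (p \<bullet> \<alpha> - 1) / (\<alpha> \<bullet> \<alpha>)"
    proof -
      have e: "p' = p - (p \<bullet> \<alpha> - 1) *\<^sub>R coroot \<alpha>" by (simp add: p'_def reflection_coroot scaleR_diff_left)
      have f: "p \<bullet> coroot \<alpha> = 2 * (p \<bullet> \<alpha>) / (\<alpha> \<bullet> \<alpha>)" by (simp add: coroot_def)
      have "p' \<bullet> p' = p \<bullet> p - 2 * (p \<bullet> \<alpha> - 1) * (p \<bullet> coroot \<alpha>) + (p \<bullet> \<alpha> - 1)^2 * (coroot \<alpha> \<bullet> coroot \<alpha>)"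
        unfolding e by (simp add: inner_diff_left inner_diff_right inner_commute power2_eq_square algebra_simps)
      moreover have "A - 2 * (X - 1) * (2 * X / N) + (X - 1)^2 * (4 / N) = A - 4 * (X - 1) / N"
        if "N \<noteq> 0" for A X N :: real using that by (simp add: field_simps power2_eq_square)
      ultimately show ?thesis unfolding f coroot_norm[OF root_nz[OF \<alpha>(1)]]
        using root_nz[OF \<alpha>(1)] by simp
    qed
    moreover have "\<kappa> \<le> 4 * (p \<bullet> \<alpha> - 1) / (\<alpha> \<bullet> \<alpha>)"
      unfolding \<kappa>_def using d \<delta>(1) M(2)[OF \<alpha>(1)] root_nz[OF \<alpha>(1)] by (intro frac_le) auto
    ultimately show ?thesis by (intro bexI[of _ p']) auto
  qed
  have ne: "(\<lambda>p. p \<bullet> p) ` S \<noteq> {}" using weyl_group.id coroot_lattice_0 by (auto simp: S_def)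
  have bd: "bdd_below ((\<lambda>p. p \<bullet> p) ` S)" by (auto intro: bdd_belowI[of _ 0])
  have "\<exists>y\<in>(\<lambda>p. p \<bullet> p) ` S. y < Inf ((\<lambda>p. p \<bullet> p) ` S) + \<kappa>"
    using ne \<kappa> by (intro cInf_lessD) auto
  then obtain p where p: "p \<in> S" "p \<bullet> p < Inf ((\<lambda>p. p \<bullet> p) ` S) + \<kappa>" by auto
  have "p \<bullet> \<alpha> \<le> 1" if \<alpha>: "\<alpha> \<in> R" for \<alpha>
  proof (rule ccontr)
    assume "\<not> p \<bullet> \<alpha> \<le> 1"
    then obtain p' where "p' \<in> S" "p' \<bullet> p' \<le> p \<bullet> p - \<kappa>" using red[OF p(1) \<alpha>] by auto
    moreover have "Inf ((\<lambda>p. p \<bullet> p) ` S) \<le> p' \<bullet> p'" using \<open>p' \<in> S\<close> bd by (intro cInf_lower) auto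
    ultimately show False using p(2) by linarith
  qed
  then show ?thesis using p(1) that by (auto simp: S_def)
qed

text \<open>
  An almost shortest representative of the alcove under the affine Weyl group lies in an alcove at the origin, and there the
  translation part of the conjugated map pairs with every root to at most 1 in absolute value.
\<close>

lemma affine_alcove_preserving_id:
  assumes k: "k \<in> weyl_group R" "q \<in> coroot_lattice" "k x + q = x"
    and \<rho>: "\<And>\<alpha>. \<alpha> \<in> R \<Longrightarrow> x \<bullet> \<alpha> \<in> \<int> \<Longrightarrow> \<rho> \<bullet> \<alpha> \<noteq> 0 \<and> (\<rho> \<bullet> \<alpha> > 0 \<longrightarrow> k \<rho> \<bullet> \<alpha> > 0)"
  shows "k = id"
proof -
  obtain t where t: "same_alcove (x + t *\<^sub>R \<rho>) (x + t *\<^sub>R k \<rho>)" using same_alcove_perturb[OF \<rho>] by blast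
  define c where "c = x + t *\<^sub>R \<rho>"
  have kc: "k c + q = x + t *\<^sub>R k \<rho>"
    using k(3) by (simp add: c_def weyl_add[OF k(1)] weyl_scale[OF k(1)] add.commute add.left_commute)
  have cell: "same_alcove c (k c + q)" using t kc c_def by simp
  then have "same_alcove c c" unfolding same_alcove_def by blast
  then obtain u r where u: "u \<in> weyl_group R" "r \<in> coroot_lattice" and le: "\<And>\<alpha>. \<alpha> \<in> R \<Longrightarrow> (u c + r) \<bullet> \<alpha> \<le> 1"
    using almost_shortest_representative by blast
  define p where "p = u c + r"
  define k' where "k' = u \<circ> k \<circ> inv u"
  have k': "k' \<in> weyl_group R" unfolding k'_def using u k by (intro weyl_group.intros)
  \<comment> \<open>The translation part of the map sending \<open>y\<close> to
    \<open>k y + q\<close> after conjugation by the map sending \<open>y\<close> to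
    \<open>u y + r\<close>; its linear part is \<open>k'\<close>.\<close>
  define q' where "q' = u q + r - k' r"
  have q': "q' \<in> coroot_lattice" unfolding q'_def
    using coroot_lattice_add[OF coroot_lattice_add[OF coroot_lattice_weyl[OF u(1) k(2)] u(2)]
      coroot_lattice_minus[OF coroot_lattice_weyl[OF k' u(2)]]] by simp
  have "c = inv u (p - r)" using u by (simp add: p_def)
  then have "u (k c + q) + r = k' p + q'"
    using weyl_add[OF u(1)] weyl_diff[OF k'] by (simp add: k'_def q'_def)
  then have cell': "same_alcove p (k' p + q')"
    using same_alcove_affine[OF cell u] by (simp add: p_def)
  have small: "\<bar>p \<bullet> \<alpha>\<bar> < 1" if \<alpha>: "\<alpha> \<in> R" for \<alpha>
  proof -
    obtain j :: int where "j < p \<bullet> \<alpha>" "p \<bullet> \<alpha> < j + 1" using cell' \<alpha> by (auto simp: same_alcove_def)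
    moreover have "p \<bullet> \<alpha> \<le> 1" "- (p \<bullet> \<alpha>) \<le> 1" using le[OF \<alpha>] le[OF minus[OF \<alpha>]] by (auto simp: p_def)
    moreover from calculation have "real_of_int j < real_of_int 1" "real_of_int (-2) < real_of_int j" by auto
    then have "j = 0 \<or> j = -1" unfolding of_int_less_iff by linarith
    ultimately show ?thesis by auto
  qed
  have same: "\<bar>(k' p + q') \<bullet> \<alpha>\<bar> < 1" "p \<bullet> \<alpha> \<noteq> 0" "p \<bullet> \<alpha> > 0 \<Longrightarrow> (k' p + q') \<bullet> \<alpha> > 0" if \<alpha>: "\<alpha> \<in> R" for \<alpha>
  proof -
    obtain j :: int where j: "j < p \<bullet> \<alpha>" "p \<bullet> \<alpha> < j + 1" "j < (k' p + q') \<bullet> \<alpha>" "(k' p + q') \<bullet> \<alpha> < j + 1"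
      using cell' \<alpha> by (auto simp: same_alcove_def)
    then have "j = 0 \<or> j = -1" using small[OF \<alpha>] by linarith
    then show "\<bar>(k' p + q') \<bullet> \<alpha>\<bar> < 1" "p \<bullet> \<alpha> \<noteq> 0" "p \<bullet> \<alpha> > 0 \<Longrightarrow> (k' p + q') \<bullet> \<alpha> > 0" using j by auto
  qed
  have "q' = 0"
  proof (rule coroot_lattice_small[OF q'])
    fix \<alpha> assume \<alpha>: "\<alpha> \<in> R"
    have "inv k' \<alpha> \<in> R" using weyl_root[OF weyl_group.inv[OF k'] \<alpha>] .
    then have "\<bar>k' p \<bullet> \<alpha>\<bar> < 1" using small weyl_adjoint[OF k'] by simp
    then have "\<bar>q' \<bullet> \<alpha>\<bar> < 2" using same(1)[OF \<alpha>] by (simp add: inner_add_left)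
    moreover obtain m :: int where m: "q' \<bullet> \<alpha> = m" using coroot_lattice_int[OF q' \<alpha>] by (auto elim: Ints_cases)
    ultimately have "\<bar>m\<bar> < 2" by linarith
    then show "\<bar>q' \<bullet> \<alpha>\<bar> \<le> 1" using m by linarith
  qed
  then have "k' = id" using same by (intro chamber_preserving_id[OF k', of p]) auto
  then have "inv u \<circ> k' \<circ> u = id" using weyl_comp_inv[OF u(1)] by simp
  moreover have "inv u \<circ> k' \<circ> u = k" using u by (simp add: k'_def fun_eq_iff)
  ultimately show ?thesis by simp
qed

end

section \<open>Schubert classes\<close>

lemma inner_reflection: "\<rho> \<bullet> reflection \<alpha> v = \<rho> \<bullet> v - 2 * (v \<bullet> \<alpha>) / (\<alpha> \<bullet> \<alpha>) * (\<rho> \<bullet> \<alpha>)"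
  by (simp add: reflection_def inner_diff_right)

lemma inner_reflection_less:
  assumes "\<rho> \<bullet> \<alpha> > 0" "v \<bullet> \<alpha> > 0" shows "\<rho> \<bullet> reflection \<alpha> v < \<rho> \<bullet> v"
proof -
  have "\<alpha> \<noteq> 0" using assms by auto
  then have "2 * (v \<bullet> \<alpha>) / (\<alpha> \<bullet> \<alpha>) * (\<rho> \<bullet> \<alpha>) > 0" using assms by simp
  then show ?thesis by (simp add: inner_reflection)
qed

lemma inner_reflection_greater:
  assumes "\<rho> \<bullet> \<alpha> > 0" "v \<bullet> \<alpha> < 0" shows "\<rho> \<bullet> v < \<rho> \<bullet> reflection \<alpha> v"
  using inner_reflection_less[OF assms(1), of "- v"] assms(2) by (simp add: linear_neg[OF linear_reflection])

context reflection_roots begin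

text \<open>A maximizer of the pairing with \<rho> on the orbit is dominant: reflecting in a
  violating root would raise the pairing.\<close>

lemma weyl_maximizer:
  obtains u where "u \<in> weyl_group R" "\<And>\<alpha>. \<alpha> \<in> R \<Longrightarrow> \<rho> \<bullet> \<alpha> > 0 \<Longrightarrow> u y \<bullet> \<alpha> \<ge> 0"
proof -
  have ne: "(\<lambda>u. \<rho> \<bullet> u y) ` weyl_group R \<noteq> {}" (is "?M \<noteq> {}") using weyl_group.id by blast
  have finM: "finite ?M" by (rule finite_imageI[OF finite_weyl])
  obtain u where u1: "u \<in> weyl_group R" "Max ?M = \<rho> \<bullet> u y"
    using Max_in[OF finM ne] by blast
  have u: "u \<in> weyl_group R" "\<And>w. w \<in> weyl_group R \<Longrightarrow> \<rho> \<bullet> w y \<le> \<rho> \<bullet> u y"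
    using u1 Max_ge[OF finM imageI] by simp_all
  have "u y \<bullet> \<alpha> \<ge> 0" if "\<alpha> \<in> R" "\<rho> \<bullet> \<alpha> > 0" for \<alpha>
  proof (rule ccontr)
    assume "\<not> ?thesis"
    then have "\<rho> \<bullet> u y < \<rho> \<bullet> reflection \<alpha> (u y)" using that by (intro inner_reflection_greater) auto
    moreover have "\<rho> \<bullet> (reflection \<alpha> \<circ> u) y \<le> \<rho> \<bullet> u y"
      using u that by (intro u(2) weyl_group.intros)
    ultimately show False by simp
  qed
  then show ?thesis using u that by blast
qed

text \<open>The second condition keeps the ratios (\<rho>, \<alpha>) / (w z, \<alpha>) of
  non-proportional roots apart wherever they are defined. It lets a ray from \<rho> in direction
  \<open>- w z\<close> cross the root hyperplanes one at a time.\<close>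

definition generic where
  "generic z \<rho> \<longleftrightarrow> (\<forall>\<alpha>\<in>R. \<rho> \<bullet> \<alpha> \<noteq> 0) \<and>
     (\<forall>w\<in>weyl_group R. \<forall>\<alpha>\<in>R. \<forall>\<beta>\<in>R. (w z \<bullet> \<beta>) *\<^sub>R \<alpha> - (w z \<bullet> \<alpha>) *\<^sub>R \<beta> \<noteq> 0 \<longrightarrow>
        \<rho> \<bullet> ((w z \<bullet> \<beta>) *\<^sub>R \<alpha> - (w z \<bullet> \<alpha>) *\<^sub>R \<beta>) \<noteq> 0)"

lemma generic_exists:
  obtains \<rho> where "generic z \<rho>" "\<And>\<alpha>. \<alpha> \<in> R \<Longrightarrow> p \<bullet> \<alpha> > 0 \<Longrightarrow> \<rho> \<bullet> \<alpha> > 0"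
proof -
  define B where "B = (R \<union> (\<lambda>(w, \<alpha>, \<beta>). (w z \<bullet> \<beta>) *\<^sub>R \<alpha> - (w z \<bullet> \<alpha>) *\<^sub>R \<beta>) ` (weyl_group R \<times> R \<times> R)) - {0}"
  have B: "finite B" "0 \<notin> B" unfolding B_def using fin finite_weyl by auto
  obtain \<rho> where \<rho>: "\<And>b. b \<in> B \<Longrightarrow> \<rho> \<bullet> b \<noteq> 0" "\<And>b. b \<in> B \<Longrightarrow> p \<bullet> b > 0 \<Longrightarrow> \<rho> \<bullet> b > 0"
    using generic_vector_near[OF B] by blast
  have RB: "\<alpha> \<in> B" if "\<alpha> \<in> R" for \<alpha> using that nz by (auto simp: B_def)
  have vB: "(w z \<bullet> \<beta>) *\<^sub>R \<alpha> - (w z \<bullet> \<alpha>) *\<^sub>R \<beta> \<in> B"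
    if "w \<in> weyl_group R" "\<alpha> \<in> R" "\<beta> \<in> R" "(w z \<bullet> \<beta>) *\<^sub>R \<alpha> - (w z \<bullet> \<alpha>) *\<^sub>R \<beta> \<noteq> 0" for w \<alpha> \<beta>
    unfolding B_def using that by (intro DiffI UnI2 image_eqI[of _ _ "(w, \<alpha>, \<beta>)"]) auto
  show ?thesis
  proof (rule that)
    show "generic z \<rho>" unfolding generic_def using \<rho>(1) RB vB by blast
  qed (use \<rho>(2) RB in blast)
qed

text \<open>The ray from \<rho> in direction \<open>- w z\<close> leaves the chamber of \<rho> at
  the root with the smallest ratio \<open>r\<close>. By genericity the exit point \<open>q\<close>
  lies on no other wall, so all other positive roots are positive at \<open>q\<close>. Since
  \<open>q\<close> is fixed by the reflection in \<alpha>, that reflection keeps those roots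
  positive.\<close>

lemma simple_root_exists:
  assumes g: "generic z \<rho>" and w: "w \<in> weyl_group R" and \<beta>0: "\<beta>0 \<in> R" "\<rho> \<bullet> \<beta>0 > 0" "w z \<bullet> \<beta>0 > 0"
  obtains \<alpha> where "\<alpha> \<in> R" "\<rho> \<bullet> \<alpha> > 0" "w z \<bullet> \<alpha> > 0"
    "\<And>\<beta>. \<beta> \<in> R \<Longrightarrow> \<rho> \<bullet> \<beta> > 0 \<Longrightarrow> \<beta> \<noteq> \<alpha> \<Longrightarrow> \<rho> \<bullet> reflection \<alpha> \<beta> > 0"
proof -
  define A where "A = {\<alpha> \<in> R. \<rho> \<bullet> \<alpha> > 0 \<and> w z \<bullet> \<alpha> > 0}"
  define r where "r = (\<lambda>\<alpha>. (\<rho> \<bullet> \<alpha>) / (w z \<bullet> \<alpha>))"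
  have A: "finite (r ` A)" "r ` A \<noteq> {}" using fin \<beta>0 by (auto simp: A_def)
  obtain \<alpha> where \<alpha>: "\<alpha> \<in> A" "r \<alpha> = Min (r ` A)" using Min_in[OF A] by (metis imageE)
  have min: "r \<alpha> \<le> r \<beta>" if "\<beta> \<in> A" for \<beta> using \<alpha>(2) that Min_le[OF A(1)] by simp
  have \<alpha>R: "\<alpha> \<in> R" "\<rho> \<bullet> \<alpha> > 0" "w z \<bullet> \<alpha> > 0" using \<alpha>(1) by (auto simp: A_def)
  have strict: "r \<alpha> < r \<beta>" if \<beta>: "\<beta> \<in> A" "\<beta> \<noteq> \<alpha>" for \<beta>
  proof (rule ccontr)
    assume "\<not> ?thesis"
    then have e: "r \<alpha> = r \<beta>" using min[OF \<beta>(1)] by simp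
    have \<beta>R: "\<beta> \<in> R" "w z \<bullet> \<beta> > 0" using \<beta> by (auto simp: A_def)
    have "\<rho> \<bullet> ((w z \<bullet> \<beta>) *\<^sub>R \<alpha> - (w z \<bullet> \<alpha>) *\<^sub>R \<beta>) = 0"
      using e \<alpha>R \<beta>R by (simp add: r_def inner_diff_right field_simps)
    then have "(w z \<bullet> \<beta>) *\<^sub>R \<alpha> = (w z \<bullet> \<alpha>) *\<^sub>R \<beta>" using g w \<alpha>R \<beta>R by (auto simp: generic_def)
    then have "(1 / (w z \<bullet> \<alpha>)) *\<^sub>R (w z \<bullet> \<beta>) *\<^sub>R \<alpha> = \<beta>" using \<alpha>R(3) by simp
    then have "((w z \<bullet> \<beta>) / (w z \<bullet> \<alpha>)) *\<^sub>R \<alpha> = \<beta>" by simp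
    moreover from this have "(w z \<bullet> \<beta>) / (w z \<bullet> \<alpha>) = 1 \<or> (w z \<bullet> \<beta>) / (w z \<bullet> \<alpha>) = -1"
      using red[OF \<alpha>R(1)] \<beta>R(1) by metis
    moreover have "(w z \<bullet> \<beta>) / (w z \<bullet> \<alpha>) > 0" using \<alpha>R(3) \<beta>R(2) by simp
    ultimately show False using \<beta>(2) by auto
  qed
  define q where "q = \<rho> - r \<alpha> *\<^sub>R w z"
  have q\<alpha>: "q \<bullet> \<alpha> = 0" using \<alpha>R by (simp add: q_def r_def inner_diff_left)
  have q\<beta>: "q \<bullet> \<beta> > 0" if \<beta>: "\<beta> \<in> R" "\<rho> \<bullet> \<beta> > 0" "\<beta> \<noteq> \<alpha>" for \<beta>
  proof (cases "w z \<bullet> \<beta> > 0")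
    case True
    then have "\<beta> \<in> A" using \<beta> by (simp add: A_def)
    then show ?thesis using strict[of \<beta>] \<beta> True by (simp add: q_def inner_diff_left r_def field_simps)
  next
    case False
    have "r \<alpha> > 0" using \<alpha>R by (simp add: r_def)
    then have "r \<alpha> * (w z \<bullet> \<beta>) \<le> 0" using False by (simp add: mult_le_0_iff)
    then show ?thesis using \<beta>(2) unfolding q_def inner_diff_left inner_scaleR_left by linarith
  qed
  show ?thesis
  proof (rule that[OF \<alpha>R])
    fix \<beta> assume \<beta>: "\<beta> \<in> R" "\<rho> \<bullet> \<beta> > 0" "\<beta> \<noteq> \<alpha>"
    have \<gamma>: "reflection \<alpha> \<beta> \<in> R" using refl \<alpha>R \<beta> by blast
    have pos: "q \<bullet> reflection \<alpha> \<beta> > 0"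
      using q\<beta>[OF \<beta>] reflection_adjoint[of \<alpha> q \<beta>] reflection_fix[OF q\<alpha>] by simp
    show "\<rho> \<bullet> reflection \<alpha> \<beta> > 0"
    proof (rule ccontr)
      assume "\<not> ?thesis"
      moreover have "\<rho> \<bullet> reflection \<alpha> \<beta> \<noteq> 0" using g \<gamma> by (auto simp: generic_def)
      ultimately have n: "\<rho> \<bullet> (- reflection \<alpha> \<beta>) > 0" by simp
      have "- reflection \<alpha> \<beta> \<noteq> \<alpha>" using q\<alpha> pos by (metis inner_minus_right less_irrefl neg_0_equal_iff_equal)
      then have "q \<bullet> (- reflection \<alpha> \<beta>) > 0" using q\<beta>[OF minus[OF \<gamma>] n] by blast
      then show False using pos by simp
    qed
  qed
qed

text \<open>The reflexive transitive closure is the Bruhat order on an orbit, with the point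
  dominant for \<rho> at the top.\<close>

definition up_step where
  "up_step \<rho> \<zeta> \<eta> \<longleftrightarrow> (\<exists>\<beta>\<in>R. \<rho> \<bullet> \<beta> > 0 \<and> \<zeta> \<bullet> \<beta> < 0 \<and> \<eta> = reflection \<beta> \<zeta>)"

lemma bruhat_increasing: "(up_step \<rho>)\<^sup>*\<^sup>* \<zeta> \<eta> \<Longrightarrow> \<zeta> = \<eta> \<or> \<rho> \<bullet> \<zeta> < \<rho> \<bullet> \<eta>"
proof (induction rule: rtranclp_induct)
  case (step y z)
  then have "\<rho> \<bullet> y < \<rho> \<bullet> z" by (auto simp: up_step_def intro: inner_reflection_greater)
  then show ?case using step.IH by auto
qed simp

text \<open>The reflection in \<alpha> is applied to a chain from \<eta> to \<zeta>. A step along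
  \<beta> other than \<alpha> becomes a step along the reflected root, positive because \<alpha> is
  simple. At a step along \<alpha> the reflected lower point is the upper one, and the chain is
  finished by the step from \<zeta> to its reflection.\<close>

lemma bruhat_lift:
  assumes \<alpha>: "\<alpha> \<in> R" "\<rho> \<bullet> \<alpha> > 0"
    and simple: "\<And>\<beta>. \<beta> \<in> R \<Longrightarrow> \<rho> \<bullet> \<beta> > 0 \<Longrightarrow> \<beta> \<noteq> \<alpha> \<Longrightarrow> \<rho> \<bullet> reflection \<alpha> \<beta> > 0"
    and "\<zeta> \<bullet> \<alpha> < 0" "(up_step \<rho>)\<^sup>*\<^sup>* \<eta> \<zeta>"
  shows "(up_step \<rho>)\<^sup>*\<^sup>* (reflection \<alpha> \<eta>) (reflection \<alpha> \<zeta>)"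
  using assms(5)
proof (induction rule: converse_rtranclp_induct)
  case base
  then show ?case by simp
next
  case (step y z)
  have up: "up_step \<rho> \<zeta> (reflection \<alpha> \<zeta>)" using assms by (auto simp: up_step_def)
  obtain \<beta> where \<beta>: "\<beta> \<in> R" "\<rho> \<bullet> \<beta> > 0" "y \<bullet> \<beta> < 0" "z = reflection \<beta> y"
    using step.hyps by (auto simp: up_step_def)
  show ?case
  proof (cases "\<beta> = \<alpha>")
    case True
    then show ?thesis using \<beta> step.hyps up by (simp add: rtranclp.rtrancl_into_rtrancl)
  next
    case False
    have "reflection \<alpha> y \<bullet> reflection \<alpha> \<beta> < 0" using \<beta> by simp
    moreover have "reflection \<alpha> z = reflection (reflection \<alpha> \<beta>) (reflection \<alpha> y)"
      using reflection_conj[OF orthogonal_reflection] \<beta>(4) by simp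
    ultimately have "up_step \<rho> (reflection \<alpha> y) (reflection \<alpha> z)"
      using simple[OF \<beta>(1,2) False] refl[OF \<alpha>(1) \<beta>(1)] by (auto simp: up_step_def)
    then show ?thesis using step.IH by (simp add: converse_rtranclp_into_rtranclp)
  qed
qed

definition inversions where "inversions \<rho> \<zeta> = {\<beta> \<in> R. \<rho> \<bullet> \<beta> > 0 \<and> \<zeta> \<bullet> \<beta> < 0}"

lemma finite_inversions: "finite (inversions \<rho> \<zeta>)" using fin by (simp add: inversions_def)

text \<open>The classes are built upwards from the antidominant point by left divided differences
  along simple roots; the induction counts the group elements sending \<open>z\<close> to a point
  lower for \<rho>. A simple reflection matches the inversions of \<zeta> with those of the lower
  point other than \<alpha>, and the lifting property of the Bruhat order bounds the
  support.\<close>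

theorem schubert_class:
  assumes gen: "generic z \<rho>" and "g \<in> weyl_group R" "g z = \<zeta>"
  shows "\<exists>n \<Phi>. gkm n {h \<in> weyl_group R. h z = z} \<Phi> \<and>
    (\<forall>w\<in>weyl_group R. w z = \<zeta> \<longrightarrow> (\<forall>v. \<Phi> w v = (\<Prod>\<beta>\<in>inversions \<rho> \<zeta>. v \<bullet> \<beta>))) \<and>
    (\<forall>w\<in>weyl_group R. \<forall>v. \<Phi> w v \<noteq> 0 \<longrightarrow> (up_step \<rho>)\<^sup>*\<^sup>* (w z) \<zeta>)"
  using assms(2,3)
proof (induction "card {w \<in> weyl_group R. \<rho> \<bullet> w z < \<rho> \<bullet> \<zeta>}" arbitrary: g \<zeta> rule: less_induct)
  case less
  define H where "H = {h \<in> weyl_group R. h z = z}"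
  show ?case
  proof (cases "\<exists>\<beta>\<in>R. \<rho> \<bullet> \<beta> > 0 \<and> \<zeta> \<bullet> \<beta> > 0")
    case False
    \<comment> \<open>For antidominant \<zeta>, the inversions contain up to sign every root not
      orthogonal to \<zeta>. So \<open>D\<close> vanishes on each hyperplane whose reflection moves
      \<zeta>, and a class supported at \<zeta> alone satisfies the congruences.\<close>
    define D where "D = (\<lambda>v. \<Prod>\<beta>\<in>inversions \<rho> \<zeta>. v \<bullet> \<beta>)"
    define \<Phi> where "\<Phi> = (\<lambda>(w::'a \<Rightarrow> 'a) v. if w z = \<zeta> then D v else 0)"
    have "real_polynomial_function D" unfolding D_def by (intro polynomial_prod polynomial_inner)
    then obtain n where n: "pdeg n D" using polynomial_imp_pdeg by blast
    have "gkm n H \<Phi>"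
      unfolding gkm_def
    proof (intro conjI ballI allI impI)
      show "pdeg n (\<Phi> w)" for w using n pdeg.zero[of n] by (cases "w z = \<zeta>") (simp_all add: \<Phi>_def)
      show "\<Phi> (w \<circ> h) = \<Phi> w" if "h \<in> H" for w h using that by (simp add: \<Phi>_def H_def)
      fix w \<alpha> and v :: 'a assume a: "\<alpha> \<in> R" "v \<bullet> \<alpha> = 0"
      show "\<Phi> w v = \<Phi> (reflection \<alpha> \<circ> w) v"
      proof (cases "\<zeta> \<bullet> \<alpha> = 0")
        case True
        then have "reflection \<alpha> (w z) = \<zeta> \<longleftrightarrow> w z = \<zeta>" by (metis reflection_fix reflection_reflection)
        then show ?thesis by (simp add: \<Phi>_def)
      next
        case False
        have "\<exists>\<beta>\<in>inversions \<rho> \<zeta>. v \<bullet> \<beta> = 0"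
        proof (cases "\<rho> \<bullet> \<alpha> > 0")
          case True
          then have "\<alpha> \<in> inversions \<rho> \<zeta>"
            using \<open>\<zeta> \<bullet> \<alpha> \<noteq> 0\<close> \<open>\<not> (\<exists>\<beta>\<in>R. _ \<beta>)\<close> a by (force simp: inversions_def)
          then show ?thesis using a by blast
        next
          case F: False
          have "\<rho> \<bullet> \<alpha> \<noteq> 0" using gen a by (auto simp: generic_def)
          then have "\<rho> \<bullet> (- \<alpha>) > 0" using F by simp
          then have "- \<alpha> \<in> inversions \<rho> \<zeta>"
            using \<open>\<zeta> \<bullet> \<alpha> \<noteq> 0\<close> \<open>\<not> (\<exists>\<beta>\<in>R. _ \<beta>)\<close> minus[OF a(1)] by (force simp: inversions_def)
          then show ?thesis using a by (intro bexI[of _ "-\<alpha>"]) auto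
        qed
        then have "D v = 0" unfolding D_def using finite_inversions by (auto intro: prod_zero)
        then show ?thesis by (simp add: \<Phi>_def)
      qed
    qed
    moreover have "\<forall>w\<in>weyl_group R. w z = \<zeta> \<longrightarrow> (\<forall>v. \<Phi> w v = D v)" by (simp add: \<Phi>_def)
    moreover have "\<forall>w\<in>weyl_group R. \<forall>v. \<Phi> w v \<noteq> 0 \<longrightarrow> (up_step \<rho>)\<^sup>*\<^sup>* (w z) \<zeta>" by (simp add: \<Phi>_def)
    ultimately show ?thesis unfolding H_def D_def by blast
  next
    case True
    then obtain \<alpha> where \<alpha>: "\<alpha> \<in> R" "\<rho> \<bullet> \<alpha> > 0" "\<zeta> \<bullet> \<alpha> > 0"
      and simple: "\<And>\<beta>. \<beta> \<in> R \<Longrightarrow> \<rho> \<bullet> \<beta> > 0 \<Longrightarrow> \<beta> \<noteq> \<alpha> \<Longrightarrow> \<rho> \<bullet> reflection \<alpha> \<beta> > 0"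
      using simple_root_exists[OF gen less.prems(1)] less.prems(2) by metis
    define s where "s = reflection \<alpha>"
    have s: "s \<in> weyl_group R" unfolding s_def by (rule weyl_group.refl[OF \<alpha>(1)])
    have ss [simp]: "s (s y) = y" for y by (simp add: s_def)
    define \<zeta>' where "\<zeta>' = s \<zeta>"
    have \<zeta>': "(s \<circ> g) z = \<zeta>'" "s \<circ> g \<in> weyl_group R" "s \<zeta>' = \<zeta>" "\<zeta>' \<bullet> \<alpha> < 0"
      using less.prems s \<alpha> root_nz[OF \<alpha>(1)] by (auto simp: \<zeta>'_def s_def reflection_inner_self intro: weyl_group.comp)
    have lt: "\<rho> \<bullet> \<zeta>' < \<rho> \<bullet> \<zeta>" unfolding \<zeta>'_def s_def by (rule inner_reflection_less[OF \<alpha>(2,3)])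
    have "card {w \<in> weyl_group R. \<rho> \<bullet> w z < \<rho> \<bullet> \<zeta>'} < card {w \<in> weyl_group R. \<rho> \<bullet> w z < \<rho> \<bullet> \<zeta>}"
    proof (rule psubset_card_mono)
      have "s \<circ> g \<in> {w \<in> weyl_group R. \<rho> \<bullet> w z < \<rho> \<bullet> \<zeta>}" "s \<circ> g \<notin> {w \<in> weyl_group R. \<rho> \<bullet> w z < \<rho> \<bullet> \<zeta>'}"
        using \<zeta>' lt by auto
      then show "{w \<in> weyl_group R. \<rho> \<bullet> w z < \<rho> \<bullet> \<zeta>'} \<subset> {w \<in> weyl_group R. \<rho> \<bullet> w z < \<rho> \<bullet> \<zeta>}"
        using lt by fastforce
    qed (use finite_weyl in auto)
    from less.hyps[OF this \<zeta>'(2,1)] obtain n \<Phi> where gk: "gkm n H \<Phi>"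
      and val: "\<forall>w\<in>weyl_group R. w z = \<zeta>' \<longrightarrow> (\<forall>v. \<Phi> w v = (\<Prod>\<beta>\<in>inversions \<rho> \<zeta>'. v \<bullet> \<beta>))"
      and supp: "\<forall>w\<in>weyl_group R. \<forall>v. \<Phi> w v \<noteq> 0 \<longrightarrow> (up_step \<rho>)\<^sup>*\<^sup>* (w z) \<zeta>'"
      unfolding H_def by blast
    have "gkm (Suc n) H \<Phi>" using gk pdeg_Suc unfolding gkm_def by blast
    moreover have "H \<subseteq> weyl_group R" by (auto simp: H_def)
    ultimately obtain \<Psi> where \<Psi>: "gkm n H \<Psi> \<and> (\<forall>w\<in>weyl_group R. \<forall>v.
        \<Phi> w v - \<Phi> (s \<circ> w) (s v) = (v \<bullet> \<alpha>) * \<Psi> w v)"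
      using gkm_divided_difference[of n H \<Phi>, OF _ _ \<alpha>(1)] unfolding s_def by blast
    have eq: "\<Phi> w v - \<Phi> (s \<circ> w) (s v) = (v \<bullet> \<alpha>) * \<Psi> w v" if "w \<in> weyl_group R" for w v
      using \<Psi> that by blast
    have poly: "real_polynomial_function (\<Psi> w)" if "w \<in> weyl_group R" for w
      using \<Psi> that pdeg_imp_polynomial unfolding gkm_def by blast
    have sw: "s \<circ> w \<in> weyl_group R" if "w \<in> weyl_group R" for w using s that weyl_group.comp by blast
    have up: "up_step \<rho> \<zeta>' \<zeta>" using \<alpha> \<zeta>' unfolding up_step_def s_def by metis
    have "\<Psi> w v = (\<Prod>\<beta>\<in>inversions \<rho> \<zeta>. v \<bullet> \<beta>)" if w: "w \<in> weyl_group R" "w z = \<zeta>" for w v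
    proof -
      define E where "E = (\<lambda>v. \<Prod>\<beta>\<in>inversions \<rho> \<zeta>. v \<bullet> \<beta>)"
      \<comment> \<open>\<zeta> lies strictly above \<open>\<zeta>'\<close> and so outside the
        support of \<Phi>; only the reflected term of the divided difference contributes.\<close>
      have "\<not> (up_step \<rho>)\<^sup>*\<^sup>* \<zeta> \<zeta>'" using bruhat_increasing[of \<rho> \<zeta> \<zeta>'] lt by auto
      then have 0: "\<Phi> w v = 0" for v using supp w by blast
      have \<alpha>inv: "\<alpha> \<in> inversions \<rho> \<zeta>'" using \<alpha> \<zeta>' by (simp add: inversions_def)
      have bij: "bij_betw s (inversions \<rho> \<zeta>' - {\<alpha>}) (inversions \<rho> \<zeta>)"
      proof (rule bij_betw_byWitness[of _ s])
        show "s ` (inversions \<rho> \<zeta>' - {\<alpha>}) \<subseteq> inversions \<rho> \<zeta>"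
        proof
          fix \<gamma> assume "\<gamma> \<in> s ` (inversions \<rho> \<zeta>' - {\<alpha>})"
          then obtain \<beta> where \<beta>: "\<beta> \<in> R" "\<rho> \<bullet> \<beta> > 0" "\<zeta>' \<bullet> \<beta> < 0" "\<beta> \<noteq> \<alpha>" "\<gamma> = s \<beta>"
            by (auto simp: inversions_def)
          have "\<zeta> \<bullet> s \<beta> = \<zeta>' \<bullet> \<beta>" by (simp add: \<zeta>'_def s_def reflection_adjoint)
          then show "\<gamma> \<in> inversions \<rho> \<zeta>" using \<beta> simple refl[OF \<alpha>(1)] by (simp add: inversions_def s_def)
        qed
        show "s ` inversions \<rho> \<zeta> \<subseteq> inversions \<rho> \<zeta>' - {\<alpha>}"
        proof
          fix \<gamma> assume "\<gamma> \<in> s ` inversions \<rho> \<zeta>"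
          then obtain \<beta> where \<beta>: "\<beta> \<in> R" "\<rho> \<bullet> \<beta> > 0" "\<zeta> \<bullet> \<beta> < 0" "\<gamma> = s \<beta>"
            by (auto simp: inversions_def)
          have "\<beta> \<noteq> \<alpha>" using \<alpha> \<beta> by auto
          have "s \<beta> \<noteq> \<alpha>"
          proof
            assume "s \<beta> = \<alpha>"
            then have "\<beta> = s \<alpha>" by (metis ss)
            then have "\<beta> = - \<alpha>" using reflection_self[OF root_nz[OF \<alpha>(1)]] by (simp add: s_def)
            then show False using \<alpha> \<beta> by simp
          qed
          moreover have "\<zeta>' \<bullet> s \<beta> = \<zeta> \<bullet> \<beta>" by (simp add: \<zeta>'_def s_def)
          ultimately show "\<gamma> \<in> inversions \<rho> \<zeta>' - {\<alpha>}"
            using \<beta> simple[OF \<beta>(1,2) \<open>\<beta> \<noteq> \<alpha>\<close>] refl[OF \<alpha>(1)] by (simp add: inversions_def s_def)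
        qed
      qed auto
      have "(v \<bullet> \<alpha>) * \<Psi> w v = (v \<bullet> \<alpha>) * E v" for v
      proof -
        have "(v \<bullet> \<alpha>) * \<Psi> w v = - \<Phi> (s \<circ> w) (s v)" using eq[OF w(1), of v] 0 by simp
        also have "\<Phi> (s \<circ> w) (s v) = (\<Prod>\<beta>\<in>inversions \<rho> \<zeta>'. s v \<bullet> \<beta>)"
          using val sw[OF w(1)] w(2) by (simp add: \<zeta>'_def)
        also have "\<dots> = (\<Prod>\<beta>\<in>inversions \<rho> \<zeta>'. v \<bullet> s \<beta>)" by (simp add: s_def reflection_adjoint)
        also have "\<dots> = (v \<bullet> s \<alpha>) * (\<Prod>\<beta>\<in>inversions \<rho> \<zeta>' - {\<alpha>}. v \<bullet> s \<beta>)"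
          by (rule prod.remove[OF finite_inversions \<alpha>inv])
        also have "(\<Prod>\<beta>\<in>inversions \<rho> \<zeta>' - {\<alpha>}. v \<bullet> s \<beta>) = E v"
          unfolding E_def by (rule prod.reindex_bij_betw[OF bij])
        finally show ?thesis using reflection_self[OF root_nz[OF \<alpha>(1)]] by (simp add: s_def)
      qed
      then have "\<Psi> w v - E v = 0" for v
        by (intro cancel_linear_factor_UNIV[where f = "\<lambda>v. \<Psi> w v - E v", OF _ root_nz[OF \<alpha>(1)]])
          (auto intro!: real_polynomial_function_diff poly w polynomial_prod simp: E_def right_diff_distrib)
      then show ?thesis by (simp add: E_def)
    qed
    moreover have "(up_step \<rho>)\<^sup>*\<^sup>* (w z) \<zeta>" if w: "w \<in> weyl_group R" "\<Psi> w v \<noteq> 0" for w v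
    proof (rule ccontr)
      assume neg: "\<not> ?thesis"
      have "\<Phi> w u = 0" for u
      proof (rule ccontr)
        assume "\<Phi> w u \<noteq> 0"
        then have "(up_step \<rho>)\<^sup>*\<^sup>* (w z) \<zeta>'" using supp w by blast
        then show False using neg up by (metis rtranclp.rtrancl_into_rtrancl)
      qed
      moreover have "\<Phi> (s \<circ> w) u = 0" for u
      proof (rule ccontr)
        assume "\<Phi> (s \<circ> w) u \<noteq> 0"
        then have "(up_step \<rho>)\<^sup>*\<^sup>* (s (w z)) \<zeta>'" using supp sw[OF w(1)] by fastforce
        then have "(up_step \<rho>)\<^sup>*\<^sup>* (s (s (w z))) (s \<zeta>')"
          unfolding s_def using bruhat_lift[OF \<alpha>(1,2) simple \<zeta>'(4)] by blast
        then show False using neg \<zeta>' by simp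
      qed
      ultimately have "(u \<bullet> \<alpha>) * \<Psi> w u = 0" for u using eq[OF w(1), of u] by simp
      then have "\<Psi> w v = 0" by (rule cancel_linear_factor_UNIV[OF poly[OF w(1)] root_nz[OF \<alpha>(1)]])
      then show False using w by simp
    qed
    ultimately show ?thesis using \<Psi> unfolding H_def by blast
  qed
qed

text \<open>\<open>u0 z\<close> is lowest for \<rho> in the orbit of \<open>z\<close> under the
  group of \<open>J\<close>, so a class supported below it meets that orbit in this point alone.
  Translation by \<open>u0\<close> moves it to \<open>z\<close>. By the chamber hypothesis and the
  choice of \<rho>, only roots in \<open>J\<close> enter its value.\<close>

theorem parabolic_point_class:
  assumes dom: "\<And>\<alpha>. \<alpha> \<in> R \<Longrightarrow> x \<bullet> \<alpha> > 0 \<Longrightarrow> z \<bullet> \<alpha> \<ge> 0"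
  defines "H \<equiv> {h \<in> weyl_group R. h z = z}" and "J \<equiv> {\<alpha> \<in> R. x \<bullet> \<alpha> = 0}"
  shows "\<exists>F\<in>tens (invariant_polynomials H). (\<forall>y. F y y = (\<Prod>\<beta>\<in>{\<beta> \<in> J. z \<bullet> \<beta> < 0}. y \<bullet> \<beta>)) \<and>
    (\<forall>u\<in>weyl_group J. u z \<noteq> z \<longrightarrow> (\<forall>y. F (u y) y = 0))"
proof -
  obtain \<rho> where gen: "generic z \<rho>" and \<rho>: "\<And>\<alpha>. \<alpha> \<in> R \<Longrightarrow> (x + z) \<bullet> \<alpha> > 0 \<Longrightarrow> \<rho> \<bullet> \<alpha> > 0"
    using generic_exists by blast
  have JR: "J \<subseteq> R" by (auto simp: J_def)
  have Jrefl: "reflection \<alpha> \<beta> \<in> J" if "\<alpha> \<in> J" "\<beta> \<in> J" for \<alpha> \<beta>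
    using that refl by (auto simp: J_def reflection_adjoint[symmetric] reflection_fix)
  interpret J: reflection_roots J using roots_subset[OF JR Jrefl] .
  have xfix: "u x = x" if "u \<in> weyl_group J" for u
    using weyl_fix_orthogonal[OF that, of x] by (auto simp: J_def)
  have JW: "weyl_group J \<subseteq> weyl_group R" by (rule weyl_mono[OF JR])
  obtain u0 where u0: "u0 \<in> weyl_group J" "\<And>w. w \<in> weyl_group J \<Longrightarrow> \<rho> \<bullet> u0 z \<le> \<rho> \<bullet> w z"
  proof -
    have ne: "(\<lambda>u. \<rho> \<bullet> u z) ` weyl_group J \<noteq> {}" (is "?M \<noteq> {}") using weyl_group.id by blast
    have finM: "finite ?M" by (rule finite_imageI[OF J.finite_weyl])
    obtain u0 where u0: "u0 \<in> weyl_group J" "Min ?M = \<rho> \<bullet> u0 z"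
      using Min_in[OF finM ne] by blast
    then show ?thesis using that[of u0] Min_le[OF finM imageI] by simp
  qed
  have u0W: "u0 \<in> weyl_group R" using u0 JW by blast
  have anti: "u0 z \<bullet> \<delta> \<le> 0" if \<delta>: "\<delta> \<in> J" "\<rho> \<bullet> \<delta> > 0" for \<delta>
  proof (rule ccontr)
    assume "\<not> ?thesis"
    then have "\<rho> \<bullet> reflection \<delta> (u0 z) < \<rho> \<bullet> u0 z" using \<delta> by (intro inner_reflection_less) auto
    moreover have "\<rho> \<bullet> u0 z \<le> \<rho> \<bullet> (reflection \<delta> \<circ> u0) z" using u0 \<delta> by (intro u0(2) weyl_group.intros)
    ultimately show False by simp
  qed
  obtain n \<Phi> where \<Phi>: "gkm n H \<Phi>"
    "\<And>v. \<Phi> u0 v = (\<Prod>\<beta>\<in>inversions \<rho> (u0 z). v \<bullet> \<beta>)"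
    "\<And>w v. w \<in> weyl_group R \<Longrightarrow> \<Phi> w v \<noteq> 0 \<Longrightarrow> (up_step \<rho>)\<^sup>*\<^sup>* (w z) (u0 z)"
    using schubert_class[OF gen u0W HOL.refl] u0W unfolding H_def by blast
  have "represented H (\<lambda>w y. \<Phi> w (w y))" by (rule gkm_represented[OF \<Phi>(1)]) (auto simp: H_def)
  then have "represented H (\<lambda>w y. \<Phi> (u0 \<circ> w) ((u0 \<circ> w) y))" by (rule represented_shift[OF _ u0W])
  then obtain F where F: "F \<in> tens (invariant_polynomials H)"
    "\<And>w y. w \<in> weyl_group R \<Longrightarrow> F (w y) y = \<Phi> (u0 \<circ> w) ((u0 \<circ> w) y)"
    unfolding represented_def by blast
  have img: "u0 ` {\<beta> \<in> J. z \<bullet> \<beta> < 0} = inversions \<rho> (u0 z)"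
  proof (intro equalityI subsetI)
    fix \<beta> assume "\<beta> \<in> u0 ` {\<beta> \<in> J. z \<bullet> \<beta> < 0}"
    then obtain \<gamma> where \<gamma>: "\<gamma> \<in> J" "z \<bullet> \<gamma> < 0" "\<beta> = u0 \<gamma>" by blast
    have \<beta>J: "\<beta> \<in> J" using J.weyl_root[OF u0(1) \<gamma>(1)] \<gamma>(3) by simp
    then have "\<rho> \<bullet> \<beta> \<noteq> 0" using gen JR by (auto simp: generic_def)
    have neg: "u0 z \<bullet> \<beta> < 0" using \<gamma> weyl_inner[OF u0W] by simp
    have "\<rho> \<bullet> \<beta> > 0"
    proof (rule ccontr)
      assume "\<not> ?thesis"
      then have "u0 z \<bullet> (- \<beta>) \<le> 0" using \<open>\<rho> \<bullet> \<beta> \<noteq> 0\<close> by (intro anti J.minus \<beta>J) simp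
      then show False using neg by simp
    qed
    then show "\<beta> \<in> inversions \<rho> (u0 z)" using neg \<beta>J JR by (auto simp: inversions_def)
  next
    fix \<beta> assume "\<beta> \<in> inversions \<rho> (u0 z)"
    then have \<beta>: "\<beta> \<in> R" "\<rho> \<bullet> \<beta> > 0" "u0 z \<bullet> \<beta> < 0" by (auto simp: inversions_def)
    define \<gamma> where "\<gamma> = inv u0 \<beta>"
    have \<gamma>: "\<gamma> \<in> R" "z \<bullet> \<gamma> < 0" "x \<bullet> \<gamma> = x \<bullet> \<beta>"
    proof -
      show "\<gamma> \<in> R" unfolding \<gamma>_def by (rule weyl_root[OF weyl_group.inv[OF u0W] \<beta>(1)])
      show "z \<bullet> \<gamma> < 0" using \<beta>(3) weyl_adjoint[OF u0W, of z \<beta>] by (simp add: \<gamma>_def)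
      show "x \<bullet> \<gamma> = x \<bullet> \<beta>" using weyl_adjoint[OF u0W, of x \<beta>] xfix[OF u0(1)] by (simp add: \<gamma>_def)
    qed
    \<comment> \<open>Both signs of (\<beta>, x) are excluded: a positive one would make
      \<open>z\<close> nonnegative on \<gamma>, a negative one would make \<open>x + z\<close>,
      hence \<rho>, positive on \<open>- \<beta>\<close>.\<close>
    have "\<not> x \<bullet> \<beta> > 0" using dom[OF \<gamma>(1)] \<gamma> by auto
    moreover have "\<not> x \<bullet> (-\<beta>) > 0"
    proof
      assume "x \<bullet> (-\<beta>) > 0"
      then have "(x + z) \<bullet> (-\<beta>) > 0" using dom[OF minus[OF \<beta>(1)]] by (simp add: inner_add_left)
      then have "\<rho> \<bullet> (-\<beta>) > 0" using \<rho> minus[OF \<beta>(1)] by blast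
      then show False using \<beta> by simp
    qed
    ultimately have "\<gamma> \<in> J" using \<gamma> by (auto simp: J_def)
    moreover have "\<beta> = u0 \<gamma>" using weyl_inv_right[OF u0W] by (simp add: \<gamma>_def)
    ultimately show "\<beta> \<in> u0 ` {\<beta> \<in> J. z \<bullet> \<beta> < 0}" using \<gamma> by blast
  qed
  have "F y y = (\<Prod>\<beta>\<in>{\<beta> \<in> J. z \<bullet> \<beta> < 0}. y \<bullet> \<beta>)" for y
  proof -
    have "F y y = (\<Prod>\<beta>\<in>inversions \<rho> (u0 z). u0 y \<bullet> \<beta>)" using F(2)[OF weyl_group.id, of y] \<Phi>(2) by simp
    also have "\<dots> = (\<Prod>\<beta>\<in>{\<beta> \<in> J. z \<bullet> \<beta> < 0}. u0 y \<bullet> u0 \<beta>)"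
      unfolding img[symmetric]
      using prod.reindex[OF inj_on_subset[OF bij_is_inj[OF weyl_bij[OF u0W]] subset_UNIV], of "\<lambda>\<beta>. u0 y \<bullet> \<beta>"]
      by (simp add: o_def)
    finally show ?thesis using weyl_inner[OF u0W] by simp
  qed
  moreover have "F (u y) y = 0" if u: "u \<in> weyl_group J" "u z \<noteq> z" for u y
  proof (rule ccontr)
    assume "F (u y) y \<noteq> 0"
    moreover have uW: "u \<in> weyl_group R" using u JW by blast
    ultimately have "\<Phi> (u0 \<circ> u) ((u0 \<circ> u) y) \<noteq> 0" using F(2) by simp
    then have "(up_step \<rho>)\<^sup>*\<^sup>* ((u0 \<circ> u) z) (u0 z)" using \<Phi>(3) weyl_group.comp[OF u0W uW] by blast
    then have "(u0 \<circ> u) z = u0 z \<or> \<rho> \<bullet> (u0 \<circ> u) z < \<rho> \<bullet> u0 z" by (rule bruhat_increasing)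
    moreover have "\<rho> \<bullet> u0 z \<le> \<rho> \<bullet> (u0 \<circ> u) z" using u0 u weyl_group.comp by blast
    ultimately have "u0 (u z) = u0 z" by simp
    then have "u z = z" using injD[OF bij_is_inj[OF weyl_bij[OF u0W]]] by blast
    then show False using u by simp
  qed
  ultimately show ?thesis using F(1) by blast
qed

end

section \<open>Prime ideals and conjugate translates\<close>

definition poly_ideal :: "('a::euclidean_space \<Rightarrow> real) set \<Rightarrow> bool" where
  "poly_ideal I \<longleftrightarrow> (\<forall>f\<in>I. real_polynomial_function f) \<and> (\<lambda>_. 0) \<in> I \<and>
     (\<forall>f\<in>I. \<forall>g\<in>I. (\<lambda>v. f v + g v) \<in> I) \<and>
     (\<forall>f\<in>I. \<forall>p. real_polynomial_function p \<longrightarrow> (\<lambda>v. p v * f v) \<in> I)"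

context
  fixes I :: "('a::euclidean_space \<Rightarrow> real) set" assumes I: "poly_ideal I"
begin

lemma ideal_poly: "f \<in> I \<Longrightarrow> real_polynomial_function f" using I by (simp add: poly_ideal_def)
lemma ideal_0: "(\<lambda>_. 0) \<in> I" using I by (simp add: poly_ideal_def)
lemma ideal_add: "f \<in> I \<Longrightarrow> g \<in> I \<Longrightarrow> (\<lambda>v. f v + g v) \<in> I" using I by (simp add: poly_ideal_def)
lemma ideal_mult: "real_polynomial_function p \<Longrightarrow> f \<in> I \<Longrightarrow> (\<lambda>v. p v * f v) \<in> I"
  using I by (simp add: poly_ideal_def)
lemma ideal_cmult: "f \<in> I \<Longrightarrow> (\<lambda>v. c * f v) \<in> I"
  by (rule ideal_mult) (rule real_polynomial_function.intros(2))
lemma ideal_diff: "f \<in> I \<Longrightarrow> g \<in> I \<Longrightarrow> (\<lambda>v. f v - g v) \<in> I"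
  using ideal_add[of f "\<lambda>v. (-1) * g v"] ideal_cmult[of g "-1"] by simp
lemma ideal_sum: "(\<And>i. i \<in> A \<Longrightarrow> f i \<in> I) \<Longrightarrow> (\<lambda>v. \<Sum>i\<in>A. f i v) \<in> I"
  by (induction A rule: infinite_finite_induct) (auto intro: ideal_0 ideal_add)

lemma ideal_prod_cong:
  assumes "\<And>i. i \<in> A \<Longrightarrow> real_polynomial_function (f i)" "\<And>i. i \<in> A \<Longrightarrow> real_polynomial_function (g i)"
    "\<And>i. i \<in> A \<Longrightarrow> (\<lambda>v. f i v - g i v) \<in> I"
  shows "(\<lambda>v. (\<Prod>i\<in>A. f i v) - (\<Prod>i\<in>A. g i v)) \<in> I"
  using assms
proof (induction A rule: infinite_finite_induct)
  case (insert i A)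
  have 1: "(\<lambda>v. f i v * ((\<Prod>i\<in>A. f i v) - (\<Prod>i\<in>A. g i v))) \<in> I"
    using insert by (intro ideal_mult insert.IH) auto
  have 2: "(\<lambda>v. (\<Prod>i\<in>A. g i v) * (f i v - g i v)) \<in> I"
    using insert by (intro ideal_mult polynomial_prod) auto
  show ?case using ideal_add[OF 1 2] insert.hyps by (simp add: algebra_simps)
qed (simp_all add: ideal_0)

end

text \<open>Zorn's lemma gives a maximal ideal. If \<open>f\<close> is outside it, then 1 is a
  member plus a multiple of \<open>f\<close>; multiplying by \<open>g\<close> puts \<open>g\<close>
  into the ideal.\<close>

lemma prime_ideal_exists:
  fixes I :: "('a::euclidean_space \<Rightarrow> real) set"
  assumes I: "poly_ideal I" "(\<lambda>_. 1) \<notin> I"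
  obtains M where "poly_ideal M" "I \<subseteq> M" "(\<lambda>_. 1) \<notin> M"
    "\<And>f g. real_polynomial_function f \<Longrightarrow> real_polynomial_function g \<Longrightarrow> (\<lambda>v. f v * g v) \<in> M \<Longrightarrow> f \<in> M \<or> g \<in> M"
proof -
  define \<A> where "\<A> = {J. poly_ideal J \<and> I \<subseteq> J \<and> (\<lambda>_. 1) \<notin> J}"
  have "\<exists>M\<in>\<A>. \<forall>X\<in>\<A>. M \<subseteq> X \<longrightarrow> X = M"
  proof (rule subset_Zorn_nonempty)
    show "\<A> \<noteq> {}" using I by (auto simp: \<A>_def)
    fix \<C> assume C: "\<C> \<noteq> {}" "subset.chain \<A> \<C>"
    then have CA: "\<And>J. J \<in> \<C> \<Longrightarrow> poly_ideal J \<and> I \<subseteq> J \<and> (\<lambda>_. 1) \<notin> J"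
      by (auto simp: subset.chain_def \<A>_def)
    have "poly_ideal (\<Union>\<C>)"
      unfolding poly_ideal_def
    proof (intro conjI ballI allI impI)
      show "real_polynomial_function f" if "f \<in> \<Union>\<C>" for f using that CA ideal_poly by blast
      show "(\<lambda>_. 0) \<in> \<Union>\<C>" using C(1) CA ideal_0 by blast
      show "(\<lambda>v. f v + g v) \<in> \<Union>\<C>" if fg: "f \<in> \<Union>\<C>" "g \<in> \<Union>\<C>" for f g
      proof -
        obtain J K where JK: "J \<in> \<C>" "K \<in> \<C>" "f \<in> J" "g \<in> K" using fg by blast
        then have "J \<subseteq> K \<or> K \<subseteq> J" using C(2) by (auto simp: subset.chain_def)
        then show ?thesis using JK CA ideal_add by blast
      qed
      show "(\<lambda>v. p v * f v) \<in> \<Union>\<C>" if "f \<in> \<Union>\<C>" "real_polynomial_function p" for f p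
        using that CA ideal_mult by blast
    qed
    then show "\<Union>\<C> \<in> \<A>" using C(1) CA by (auto simp: \<A>_def)
  qed
  then obtain M where M: "M \<in> \<A>" and max: "\<And>X. X \<in> \<A> \<Longrightarrow> M \<subseteq> X \<Longrightarrow> X = M" by blast
  have MI: "poly_ideal M" "I \<subseteq> M" "(\<lambda>_. 1) \<notin> M" using M by (auto simp: \<A>_def)
  have "f \<in> M \<or> g \<in> M"
    if f: "real_polynomial_function f" and g: "real_polynomial_function g" and fg: "(\<lambda>v. f v * g v) \<in> M" for f g
  proof (rule ccontr)
    assume n: "\<not> ?thesis"
    define X where "X = {\<lambda>v. h v + p v * f v | h p. h \<in> M \<and> real_polynomial_function p}"
    have MX: "h \<in> X" if "h \<in> M" for h
      unfolding X_def using that by (intro CollectI exI[of _ h] exI[of _ "\<lambda>_. 0"]) (auto intro: real_polynomial_function.intros)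
    have fX: "f \<in> X"
      unfolding X_def using ideal_0[OF MI(1)]
      by (intro CollectI exI[of _ "\<lambda>_. 0"] exI[of _ "\<lambda>_. 1"]) (auto intro: real_polynomial_function.intros)
    have "poly_ideal X"
      unfolding poly_ideal_def
    proof (intro conjI ballI allI impI)
      show "real_polynomial_function k" if "k \<in> X" for k
        using that f ideal_poly[OF MI(1)] by (auto simp: X_def intro: real_polynomial_function.intros)
      show "(\<lambda>_. 0) \<in> X" using MX ideal_0[OF MI(1)] by blast
      show "(\<lambda>v. k v + l v) \<in> X" if kl: "k \<in> X" "l \<in> X" for k l
      proof -
        obtain h p h' p' where k: "k = (\<lambda>v. h v + p v * f v)" "h \<in> M" "real_polynomial_function p"
          and l: "l = (\<lambda>v. h' v + p' v * f v)" "h' \<in> M" "real_polynomial_function p'"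
          using kl unfolding X_def by blast
        have "(\<lambda>v. k v + l v) = (\<lambda>v. (h v + h' v) + (p v + p' v) * f v)" unfolding k(1) l(1) by (auto simp: algebra_simps)
        then show ?thesis unfolding X_def using ideal_add[OF MI(1) k(2) l(2)] k(3) l(3)
          by (intro CollectI exI[of _ "\<lambda>v. h v + h' v"] exI[of _ "\<lambda>v. p v + p' v"]) (simp add: real_polynomial_function.intros)
      qed
      show "(\<lambda>v. q v * k v) \<in> X" if kq: "k \<in> X" "real_polynomial_function q" for k q
      proof -
        obtain h p where k: "k = (\<lambda>v. h v + p v * f v)" "h \<in> M" "real_polynomial_function p"
          using kq unfolding X_def by blast
        have "(\<lambda>v. q v * k v) = (\<lambda>v. q v * h v + (q v * p v) * f v)" unfolding k(1) by (auto simp: algebra_simps)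
        then show ?thesis unfolding X_def using ideal_mult[OF MI(1) kq(2) k(2)] k(3) kq(2)
          by (intro CollectI exI[of _ "\<lambda>v. q v * h v"] exI[of _ "\<lambda>v. q v * p v"]) (simp add: real_polynomial_function.intros)
      qed
    qed
    moreover have "(\<lambda>_. 1) \<notin> X"
    proof
      assume "(\<lambda>_. 1) \<in> X"
      then obtain h p where hp: "(\<lambda>_. 1) = (\<lambda>v. h v + p v * f v)" "h \<in> M" "real_polynomial_function p"
        unfolding X_def by blast
      have "(\<lambda>v. g v * h v + p v * (f v * g v)) \<in> M"
        by (intro ideal_add[OF MI(1)] ideal_mult[OF MI(1)] hp g fg)
      moreover have "g v * h v + p v * (f v * g v) = g v" for v
      proof -
        have "g v * h v + p v * (f v * g v) = g v * (h v + p v * f v)" by (simp add: algebra_simps)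
        also have "h v + p v * f v = 1" using hp(1) by metis
        finally show ?thesis by simp
      qed
      ultimately show False using n by simp
    qed
    ultimately have "X \<in> \<A>" using MI MX by (auto simp: \<A>_def)
    then have "X = M" using max MX by blast
    then show False using n fX by blast
  qed
  then show ?thesis using that MI by blast
qed

lemma prime_prod:
  assumes M: "(\<lambda>_. 1) \<notin> M"
    "\<And>f g. real_polynomial_function f \<Longrightarrow> real_polynomial_function g \<Longrightarrow> (\<lambda>v. f v * g v) \<in> M \<Longrightarrow> f \<in> M \<or> g \<in> M"
    and f: "\<And>i. i \<in> A \<Longrightarrow> real_polynomial_function (f i)" "(\<lambda>v::'a::euclidean_space. \<Prod>i\<in>A. f i v) \<in> M"
  shows "\<exists>i\<in>A. f i \<in> M"
  using f
proof (induction A rule: infinite_finite_induct)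
  case (insert i A)
  have "(\<lambda>v. f i v * (\<Prod>i\<in>A. f i v)) \<in> M" using insert by simp
  then have "f i \<in> M \<or> (\<lambda>v. \<Prod>i\<in>A. f i v) \<in> M" using insert.prems by (intro M(2) polynomial_prod) auto
  then show ?case using insert by auto
qed (use M in auto)

text \<open>
  The zero set of the affine functions in a proper ideal is a nonempty affine subspace. A generic
  real point of it stands in for the possibly non-real point defined by a maximal ideal.
\<close>

lemma generic_affine_zero:
  fixes M :: "('a::euclidean_space \<Rightarrow> real) set"
  assumes M: "poly_ideal M" "(\<lambda>_. 1) \<notin> M" and B: "finite B" "\<And>u c. (u, c) \<in> B \<Longrightarrow> (\<lambda>v. v \<bullet> u + c) \<notin> M"
  obtains x where "\<And>u c. (\<lambda>v. v \<bullet> u + c) \<in> M \<Longrightarrow> x \<bullet> u + c = 0" "\<And>u c. (u, c) \<in> B \<Longrightarrow> x \<bullet> u + c \<noteq> 0"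
proof -
  define N where "N = {(u::'a, c::real). (\<lambda>v. v \<bullet> u + c) \<in> M}"
  have N: "subspace N"
    unfolding subspace_def
  proof (intro conjI ballI allI)
    show "0 \<in> N" using ideal_0[OF M(1)] by (simp add: N_def zero_prod_def)
    fix p q assume "p \<in> N" "q \<in> N"
    then show "p + q \<in> N"
      using ideal_add[OF M(1), of "\<lambda>v. v \<bullet> fst p + snd p" "\<lambda>v. v \<bullet> fst q + snd q"]
      by (simp add: N_def plus_prod_def case_prod_beta inner_add_right algebra_simps)
  next
    fix r p assume "p \<in> N"
    then show "r *\<^sub>R p \<in> N"
      using ideal_cmult[OF M(1), of "\<lambda>v. v \<bullet> fst p + snd p" r]
      by (simp add: N_def scaleR_prod_def case_prod_beta algebra_simps)
  qed
  define S where "S = {y. \<forall>n\<in>N. y \<bullet> n = 0}"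
  have S: "subspace S" by (auto simp: subspace_def S_def inner_add_left)
  have ex: "\<exists>s\<in>S. s \<bullet> b \<noteq> 0" if "b \<notin> N" for b
  proof -
    obtain y z where yz: "y \<in> span N" "\<And>u. u \<in> span N \<Longrightarrow> orthogonal z u" "b = y + z"
      using orthogonal_subspace_decomp_exists[of N b] by metis
    have "y \<in> N" using yz(1) N by (metis span_eq_iff)
    then have "z \<noteq> 0" using that yz(3) by auto
    moreover have "z \<bullet> y = 0" using yz(1,2) by (simp add: orthogonal_def)
    ultimately have "z \<bullet> b \<noteq> 0" by (simp add: yz(3) inner_add_right)
    moreover have "z \<in> S" using yz(2) by (auto simp: S_def orthogonal_def span_base)
    ultimately show ?thesis by blast
  qed
  \<comment> \<open>The pair \<open>(0, 1)\<close> encodes the constant function 1, which is not in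
    \<open>M\<close>. Including it makes the last coordinate of \<open>g\<close> nonzero, so that
    the homogeneous solution can be scaled to an actual point.\<close>
  have "\<exists>g\<in>S. \<forall>b\<in>insert (0, 1) B. g \<bullet> b \<noteq> 0"
  proof (rule generic_vector[OF _ S])
    show "finite (insert (0, 1) B)" using B by simp
    fix b assume "b \<in> insert (0, 1) B"
    then have "b \<notin> N" using M(2) B(2) by (cases b) (auto simp: N_def)
    then show "\<exists>s\<in>S. s \<bullet> b \<noteq> 0" by (rule ex)
  qed
  then obtain g where g: "g \<in> S" "\<forall>b\<in>insert (0, 1) B. g \<bullet> b \<noteq> 0" by blast
  obtain g1 g2 where gg: "g = (g1, g2)" by (cases g)
  have g2: "g2 \<noteq> 0" using g(2) by (auto simp: gg)
  have e: "(g1 /\<^sub>R g2) \<bullet> u + c = (g \<bullet> (u, c)) / g2" for u c using g2 by (simp add: gg field_simps)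
  show ?thesis
  proof (rule that[of "g1 /\<^sub>R g2"])
    fix u c assume "(\<lambda>v. v \<bullet> u + c) \<in> M"
    then have "(u, c) \<in> N" by (simp add: N_def)
    then show "(g1 /\<^sub>R g2) \<bullet> u + c = 0" unfolding e using g(1) by (simp add: S_def)
  next
    fix u c assume "(u, c) \<in> B"
    then show "(g1 /\<^sub>R g2) \<bullet> u + c \<noteq> 0" unfolding e using g(2) g2 by simp
  qed
qed

text \<open>Translating the second variable destroys its invariance, hence the empty set, which
  allows all polynomials. Summation over the group restores invariance later.\<close>

lemma tens_shift:
  "F \<in> tens I \<Longrightarrow> (\<And>g. g \<in> I \<Longrightarrow> real_polynomial_function g) \<Longrightarrow>
     (\<lambda>v y. F (v - c) (y - d)) \<in> tens (invariant_polynomials {})"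
proof (induction rule: tens.induct)
  case (base p g)
  show ?case using polynomial_shift_comp[OF base(1), of "- c"] polynomial_shift_comp[OF base(3)[OF base(2)], of "- d"]
    by (intro tens.base[of "\<lambda>v. p (v - c)" "\<lambda>y. g (y - d)"]) (auto simp: invariant_polynomials_def)
next
  case (add F G)
  then show ?case using tens.add[of "\<lambda>v y. F (v - c) (y - d)" _ "\<lambda>v y. G (v - c) (y - d)"] by simp
qed

lemma (in reflection_roots) tens_symmetrize:
  "F \<in> tens (invariant_polynomials {}) \<Longrightarrow>
     (\<lambda>v y. \<Sum>w\<in>weyl_group R. F v (w y)) \<in> tens (invariant_polynomials (weyl_group R))"
proof (induction rule: tens.induct)
  case (base p g)
  have g: "real_polynomial_function g" using base by (simp add: invariant_polynomials_def)
  have "real_polynomial_function (\<lambda>y. \<Sum>w\<in>weyl_group R. g (w y))"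
    by (rule polynomial_sum) (rule polynomial_linear_comp[OF g weyl_linear])
  moreover have "(\<Sum>w\<in>weyl_group R. g (w (h y))) = (\<Sum>w\<in>weyl_group R. g (w y))" if "h \<in> weyl_group R" for h y
    using sum.reindex_bij_betw[OF bij_betw_weyl_right[OF that], of "\<lambda>w. g (w y)"] by simp
  ultimately have "(\<lambda>y. \<Sum>w\<in>weyl_group R. g (w y)) \<in> invariant_polynomials (weyl_group R)"
    by (auto simp: invariant_polynomials_def)
  from tens.base[OF base(1) this] show ?case by (simp add: sum_distrib_left)
next
  case (add F G)
  from tens.add[OF add.IH] show ?case by (simp add: sum.distrib)
qed

section \<open>Translates by a minuscule orbit\<close>

locale minuscule_roots = crystallographic_roots +
  fixes a :: 'a
  assumes minuscule: "\<alpha> \<in> R \<Longrightarrow> a \<bullet> \<alpha> \<in> {-1, 0, 1}"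
begin

lemma minuscule_orbit: assumes "w \<in> weyl_group R" "\<alpha> \<in> R" shows "w a \<bullet> \<alpha> \<in> {-1, 0, 1}"
  unfolding weyl_adjoint[OF assms(1)] by (rule minuscule[OF weyl_root[OF weyl_group.inv[OF assms(1)] assms(2)]])

text \<open>A single reflection moves an orbit point by -1, 0 or 1 times a coroot.\<close>

lemma orbit_difference:
  assumes "w \<in> weyl_group R" "g \<in> weyl_group R" shows "w (g a) - g a \<in> coroot_lattice"
  using assms
proof (induction arbitrary: g rule: weyl_group.induct)
  case id
  then show ?case by (simp add: coroot_lattice_0)
next
  case (refl \<alpha>)
  have "reflection \<alpha> (g a) - g a = - ((g a \<bullet> \<alpha>) *\<^sub>R coroot \<alpha>)" by (simp add: reflection_coroot)
  moreover have "coroot \<alpha> \<in> coroot_lattice" by (rule coroot_lattice_coroot[OF refl(1)])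
  ultimately show ?case using minuscule_orbit[OF refl(2,1)] coroot_lattice_0 coroot_lattice_minus by auto
next
  case (comp v w)
  have "v ((w \<circ> g) a) - (w \<circ> g) a + (w (g a) - g a) \<in> coroot_lattice"
    using comp by (intro coroot_lattice_add comp.IH weyl_group.comp)
  then show ?case by simp
next
  case (inv w)
  have "- (w ((inv w \<circ> g) a) - (inv w \<circ> g) a) \<in> coroot_lattice"
    using inv by (intro coroot_lattice_minus inv.IH weyl_group.comp weyl_group.inv)
  then show ?case using weyl_inv_right[OF inv.hyps] by simp
qed

text \<open>Up to scaling, \<rho> perturbs the midpoint of \<open>x\<close> and
  \<open>x + a\<close>. At an integral root positive on \<rho> this gives 2 (\<alpha>, x) +
  (\<alpha>, a) \<ge> 0, and |(\<alpha>, a)| \<le> 1 then leaves no negative integer for (\<alpha>,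
  x).\<close>

lemma positive_on_integral:
  assumes "\<And>\<alpha>. \<alpha> \<in> R \<Longrightarrow> \<rho> \<bullet> \<alpha> \<noteq> 0" "\<And>\<alpha>. \<alpha> \<in> R \<Longrightarrow> (x + (x + a)) \<bullet> \<alpha> > 0 \<Longrightarrow> \<rho> \<bullet> \<alpha> > 0"
    "\<alpha> \<in> R" "x \<bullet> \<alpha> \<in> \<int>" "\<rho> \<bullet> \<alpha> > 0"
  shows "x \<bullet> \<alpha> \<ge> 0" "x \<bullet> \<alpha> = 0 \<Longrightarrow> a \<bullet> \<alpha> \<ge> 0"
proof -
  obtain m :: int where m: "x \<bullet> \<alpha> = m" using assms(4) by (auto elim: Ints_cases)
  have "\<not> (x + (x + a)) \<bullet> (-\<alpha>) > 0" using assms(2)[OF minus[OF assms(3)]] assms(5) by auto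
  then have "2 * real_of_int m + a \<bullet> \<alpha> \<ge> 0" by (simp add: inner_add_left m)
  moreover have "a \<bullet> \<alpha> = -1 \<or> a \<bullet> \<alpha> = 0 \<or> a \<bullet> \<alpha> = 1" using minuscule[OF assms(3)] by simp
  ultimately have "real_of_int m > -1" "m = 0 \<Longrightarrow> a \<bullet> \<alpha> \<ge> 0" by auto
  then show "x \<bullet> \<alpha> \<ge> 0" "x \<bullet> \<alpha> = 0 \<Longrightarrow> a \<bullet> \<alpha> \<ge> 0" by (auto simp: m)
qed

text \<open>Both ends are normalized: \<open>u\<close> makes \<open>b a\<close> dominant for the
  roots vanishing at \<open>x\<close>, and \<open>h\<close> corrects \<open>w\<close> by the
  stabilizer of \<open>x + a\<close>. The resulting \<open>k\<close>, with a translation from the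
  coroot lattice, fixes \<open>x\<close> and preserves the alcove at \<open>x\<close> in direction
  \<rho>. It is therefore the identity, and the dominant representative of \<open>b a\<close> is
  \<open>a\<close> itself.\<close>

theorem conjugate_translates:
  assumes w: "w \<in> weyl_group R" and b: "b \<in> weyl_group R" and eq: "w (x + b a) = x + a"
  shows "\<exists>u\<in>weyl_group {\<alpha> \<in> R. x \<bullet> \<alpha> = 0}. b a = u a"
proof -
  define z where "z = x + a"
  define Rx where "Rx = {\<alpha> \<in> R. x \<bullet> \<alpha> = 0}"
  define Rz where "Rz = {\<alpha> \<in> R. z \<bullet> \<alpha> = 0}"
  interpret X: reflection_roots Rx
    by (rule roots_subset) (use refl in \<open>auto simp: Rx_def reflection_adjoint[symmetric] reflection_fix\<close>)
  interpret Z: reflection_roots Rz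
    by (rule roots_subset) (use refl in \<open>auto simp: Rz_def reflection_adjoint[symmetric] reflection_fix\<close>)
  have sub: "weyl_group Rx \<subseteq> weyl_group R" "weyl_group Rz \<subseteq> weyl_group R"
    unfolding Rx_def Rz_def by (rule weyl_mono; blast)+
  obtain \<rho> where \<rho>: "\<And>\<alpha>. \<alpha> \<in> R \<Longrightarrow> \<rho> \<bullet> \<alpha> \<noteq> 0" "\<And>\<alpha>. \<alpha> \<in> R \<Longrightarrow> (x + (x + a)) \<bullet> \<alpha> > 0 \<Longrightarrow> \<rho> \<bullet> \<alpha> > 0"
    using generic_vector_near[OF fin nz] by metis
  have pos: "x \<bullet> \<alpha> \<ge> 0" "x \<bullet> \<alpha> = 0 \<Longrightarrow> a \<bullet> \<alpha> \<ge> 0" if "\<alpha> \<in> R" "x \<bullet> \<alpha> \<in> \<int>" "\<rho> \<bullet> \<alpha> > 0" for \<alpha>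
    using positive_on_integral[where \<rho> = \<rho> and x = x and \<alpha> = \<alpha>] \<rho> that by blast+
  obtain u where u: "u \<in> weyl_group Rx" "\<And>\<alpha>. \<alpha> \<in> Rx \<Longrightarrow> \<rho> \<bullet> \<alpha> > 0 \<Longrightarrow> u (b a) \<bullet> \<alpha> \<ge> 0"
    using X.weyl_maximizer by blast
  have uW: "u \<in> weyl_group R" using u sub by blast
  have ux: "u x = x" by (rule weyl_fix_orthogonal[OF u(1)]) (simp add: Rx_def)
  define c where "c = u (b a)"
  have c: "c = (u \<circ> b) a" "u \<circ> b \<in> weyl_group R" using uW b by (auto simp: c_def intro: weyl_group.comp)
  define w' where "w' = w \<circ> inv u"
  have w': "w' \<in> weyl_group R" unfolding w'_def using w uW by (intro weyl_group.intros)
  have w'z: "w' (x + c) = z"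
  proof -
    have "x + c = u (x + b a)" using weyl_add[OF uW] ux by (simp add: c_def)
    then show ?thesis using eq weyl_inv_left[OF uW] by (simp add: w'_def z_def)
  qed
  obtain h where h: "h \<in> weyl_group Rz" "\<And>\<alpha>. \<alpha> \<in> Rz \<Longrightarrow> \<rho> \<bullet> \<alpha> > 0 \<Longrightarrow> h (w' \<rho>) \<bullet> \<alpha> \<ge> 0"
    using Z.weyl_maximizer by blast
  have hW: "h \<in> weyl_group R" using h sub by blast
  have hz: "h z = z" by (rule weyl_fix_orthogonal[OF h(1)]) (simp add: Rz_def)
  define k where "k = h \<circ> w'"
  have k: "k \<in> weyl_group R" unfolding k_def using hW w' by (intro weyl_group.intros)
  have kz: "k (x + c) = z" using w'z hz by (simp add: k_def)
  \<comment> \<open>\<open>k\<close> sends \<open>x + c\<close> to \<open>x + a\<close>. Splitting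
    off the orbit points \<open>c\<close> and \<open>a\<close> turns this into an affine map fixing
    \<open>x\<close>, whose translation part is in the lattice because \<open>k c\<close> and
    \<open>a\<close> lie in one orbit.\<close>
  define q where "q = k c - a"
  have q: "q \<in> coroot_lattice"
    using orbit_difference[OF weyl_group.comp[OF k c(2)] weyl_group.id] by (simp add: q_def c(1))
  have kx: "k x + q = x" using kz weyl_add[OF k, of x c] by (simp add: q_def z_def algebra_simps)
  have k\<rho>: "\<rho> \<bullet> \<beta> \<noteq> 0 \<and> (\<rho> \<bullet> \<beta> > 0 \<longrightarrow> k \<rho> \<bullet> \<beta> > 0)" if \<beta>: "\<beta> \<in> R" "x \<bullet> \<beta> \<in> \<int>" for \<beta>
  proof (intro conjI impI)
    show "\<rho> \<bullet> \<beta> \<noteq> 0" by (rule \<rho>(1)[OF \<beta>(1)])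
    assume p: "\<rho> \<bullet> \<beta> > 0"
    define \<gamma> where "\<gamma> = inv k \<beta>"
    have \<gamma>: "\<gamma> \<in> R" unfolding \<gamma>_def by (rule weyl_root[OF weyl_group.inv[OF k] \<beta>(1)])
    have adj: "k v \<bullet> \<beta> = v \<bullet> \<gamma>" for v unfolding \<gamma>_def by (rule weyl_adjoint[OF k])
    have \<rho>\<gamma>: "\<rho> \<bullet> \<gamma> \<noteq> 0" by (rule \<rho>(1)[OF \<gamma>])
    have z0: "z \<bullet> \<beta> \<ge> 0"
    proof (cases "x \<bullet> \<beta> = 0")
      case True
      then show ?thesis using pos(2)[OF \<beta> p] by (simp add: z_def inner_add_left)
    next
      case False
      obtain m :: int where m: "x \<bullet> \<beta> = m" using \<beta>(2) by (auto elim: Ints_cases)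
      then have "m \<ge> 1" using pos(1)[OF \<beta> p] False by simp
      then show ?thesis using m minuscule[OF \<beta>(1)] by (auto simp: z_def inner_add_left)
    qed
    show "k \<rho> \<bullet> \<beta> > 0"
    proof (cases "z \<bullet> \<beta> = 0")
      case True
      then have "\<beta> \<in> Rz" using \<beta> by (simp add: Rz_def)
      then have "k \<rho> \<bullet> \<beta> \<ge> 0" using h(2) p by (simp add: k_def)
      then show ?thesis using \<rho>\<gamma> adj by simp
    next
      case False
      have "(x + c) \<bullet> \<gamma> > 0" using adj[of "x + c"] kz False z0 by simp
      have "\<rho> \<bullet> \<gamma> > 0"
      proof (rule ccontr)
        assume "\<not> ?thesis"
        then have n: "\<rho> \<bullet> (- \<gamma>) > 0" using \<rho>\<gamma> by simp
        \<comment> \<open>Integrality at \<open>x\<close> passes from \<beta> to \<gamma> since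
          \<open>q\<close> pairs integrally, so the sign information from \<rho> is available for
          \<open>- \<gamma>\<close> as well.\<close>
        have "x \<bullet> \<gamma> = (x - q) \<bullet> \<beta>" using adj[of x] kx by (metis add_diff_cancel_right')
        then have i: "x \<bullet> \<gamma> \<in> \<int>" using \<beta> coroot_lattice_int[OF q \<beta>(1)] by (simp add: inner_diff_left)
        then have i': "x \<bullet> (- \<gamma>) \<in> \<int>" by simp
        have x0: "x \<bullet> (- \<gamma>) \<ge> 0" by (rule pos(1)[OF minus[OF \<gamma>] i' n])
        have "(x + c) \<bullet> (- \<gamma>) \<ge> 0"
        proof (cases "x \<bullet> \<gamma> = 0")
          case True
          then have "- \<gamma> \<in> Rx" using minus[OF \<gamma>] by (simp add: Rx_def)
          then have "c \<bullet> (- \<gamma>) \<ge> 0" unfolding c_def using u(2) n by blast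
          then show ?thesis using True by (simp add: inner_add_left)
        next
          case False
          obtain m :: int where m: "x \<bullet> (- \<gamma>) = m" using i' by (rule Ints_cases)
          then have "m \<ge> 1" using x0 False by simp
          moreover have "c \<bullet> (- \<gamma>) \<in> {-1, 0, 1}" unfolding c(1) by (rule minuscule_orbit[OF c(2) minus[OF \<gamma>]])
          ultimately show ?thesis using m unfolding inner_add_left by auto
        qed
        then show False using \<open>(x + c) \<bullet> \<gamma> > 0\<close> by simp
      qed
      then show ?thesis using adj by simp
    qed
  qed
  have "k = id" by (rule affine_alcove_preserving_id[OF k q kx k\<rho>])
  then have "u (b a) = a" using kx by (simp add: q_def c_def)
  then have "b a = inv u a" using weyl_inv_left[OF uW] by metis
  then show ?thesis using weyl_group.inv[OF u(1)] unfolding Rx_def by blast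
qed

end

section \<open>The class of a point\<close>

context minuscule_roots begin

definition point_ideal where
  "point_ideal = {d. real_polynomial_function d \<and> (\<exists>F\<in>tens (invariant_polynomials (weyl_group R)).
     (\<forall>v. F v (v + a) = d v * (\<Prod>\<beta>\<in>{\<beta> \<in> R. a \<bullet> \<beta> < 0}. v \<bullet> \<beta>)) \<and>
     (\<forall>b\<in>weyl_group R. b a \<noteq> a \<longrightarrow> (\<forall>v. F v (v + b a) = 0)))}"

lemma point_idealI:
  assumes "real_polynomial_function d" "F \<in> tens (invariant_polynomials (weyl_group R))"
    "\<And>v. F v (v + a) = d v * (\<Prod>\<beta>\<in>{\<beta> \<in> R. a \<bullet> \<beta> < 0}. v \<bullet> \<beta>)"
    "\<And>b v. b \<in> weyl_group R \<Longrightarrow> b a \<noteq> a \<Longrightarrow> F v (v + b a) = 0"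
  shows "d \<in> point_ideal"
  unfolding point_ideal_def using assms by blast

lemma point_idealD:
  assumes "d \<in> point_ideal"
  shows "real_polynomial_function d" "\<exists>F\<in>tens (invariant_polynomials (weyl_group R)).
     (\<forall>v. F v (v + a) = d v * (\<Prod>\<beta>\<in>{\<beta> \<in> R. a \<bullet> \<beta> < 0}. v \<bullet> \<beta>)) \<and>
     (\<forall>b\<in>weyl_group R. b a \<noteq> a \<longrightarrow> (\<forall>v. F v (v + b a) = 0))"
  using assms unfolding point_ideal_def by blast+

lemma poly_ideal_point_ideal: "poly_ideal point_ideal"
  unfolding poly_ideal_def
proof (intro conjI ballI allI impI)
  show "real_polynomial_function f" if "f \<in> point_ideal" for f using that by (rule point_idealD)
  show "(\<lambda>_. 0) \<in> point_ideal"
    by (rule point_idealI[OF _ tens_left[OF HOL.refl, of "\<lambda>_. 0"]]) (auto intro: real_polynomial_function.intros)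
  show "(\<lambda>v. f v + g v) \<in> point_ideal" if fI: "f \<in> point_ideal" and gI: "g \<in> point_ideal" for f g
  proof -
    obtain F where F: "F \<in> tens (invariant_polynomials (weyl_group R))"
      "\<forall>v. F v (v + a) = f v * (\<Prod>\<beta>\<in>{\<beta> \<in> R. a \<bullet> \<beta> < 0}. v \<bullet> \<beta>)"
      "\<forall>b\<in>weyl_group R. b a \<noteq> a \<longrightarrow> (\<forall>v. F v (v + b a) = 0)"
      using point_idealD(2)[OF fI] by blast
    obtain G where G: "G \<in> tens (invariant_polynomials (weyl_group R))"
      "\<forall>v. G v (v + a) = g v * (\<Prod>\<beta>\<in>{\<beta> \<in> R. a \<bullet> \<beta> < 0}. v \<bullet> \<beta>)"
      "\<forall>b\<in>weyl_group R. b a \<noteq> a \<longrightarrow> (\<forall>v. G v (v + b a) = 0)"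
      using point_idealD(2)[OF gI] by blast
    show ?thesis
      by (rule point_idealI[OF real_polynomial_function.intros(3)[OF point_idealD(1)[OF fI] point_idealD(1)[OF gI]] tens.add[OF F(1) G(1)]])
        (simp_all add: F G distrib_right)
  qed
  show "(\<lambda>v. p v * f v) \<in> point_ideal" if fI: "f \<in> point_ideal" and p: "real_polynomial_function p" for f p
  proof -
    obtain F where F: "F \<in> tens (invariant_polynomials (weyl_group R))"
      "\<forall>v. F v (v + a) = f v * (\<Prod>\<beta>\<in>{\<beta> \<in> R. a \<bullet> \<beta> < 0}. v \<bullet> \<beta>)"
      "\<forall>b\<in>weyl_group R. b a \<noteq> a \<longrightarrow> (\<forall>v. F v (v + b a) = 0)"
      using point_idealD(2)[OF fI] by blast
    show ?thesis
      by (rule point_idealI[OF real_polynomial_function.intros(4)[OF p point_idealD(1)[OF fI]] tens_mult[OF HOL.refl tens_left[OF HOL.refl p] F(1)]])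
        (simp_all add: F)
  qed
qed

text \<open>Modulo \<open>M\<close> the point \<open>v + a\<close> lies on all hyperplanes of
  \<open>S\<close>, so the reflections in \<open>S\<close>, and with them the whole group, fix it
  modulo \<open>M\<close>.\<close>

lemma stabilizer_congruence:
  assumes M: "poly_ideal M" and Z: "\<And>\<alpha>. \<alpha> \<in> S \<Longrightarrow> (\<lambda>v. v \<bullet> \<alpha> + a \<bullet> \<alpha>) \<in> M"
    and w: "w \<in> weyl_group S"
  shows "(\<lambda>v. w (v + a) \<bullet> \<mu> - (v + a) \<bullet> \<mu>) \<in> M"
  using w
proof (induction arbitrary: \<mu> rule: weyl_group.induct)
  case id
  then show ?case using ideal_0[OF M] by simp
next
  case (refl \<alpha>)
  have "(\<lambda>v. - (coroot \<alpha> \<bullet> \<mu>) * (v \<bullet> \<alpha> + a \<bullet> \<alpha>)) \<in> M" by (rule ideal_cmult[OF M Z[OF refl]])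
  moreover have "reflection \<alpha> (v + a) \<bullet> \<mu> - (v + a) \<bullet> \<mu> = - (coroot \<alpha> \<bullet> \<mu>) * (v \<bullet> \<alpha> + a \<bullet> \<alpha>)" for v
    unfolding reflection_coroot inner_diff_left by (simp add: inner_add_left)
  ultimately show ?case by simp
next
  case (comp v w)
  have "(\<lambda>y. (w (y + a) \<bullet> inv v \<mu> - (y + a) \<bullet> inv v \<mu>) + (v (y + a) \<bullet> \<mu> - (y + a) \<bullet> \<mu>)) \<in> M"
    by (intro ideal_add[OF M] comp.IH)
  then show ?case by (simp add: weyl_adjoint[OF comp.hyps(1)])
next
  case (inv w)
  have "(\<lambda>y. (-1) * (w (y + a) \<bullet> w \<mu> - (y + a) \<bullet> w \<mu>)) \<in> M" by (intro ideal_cmult[OF M] inv.IH)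
  then show ?case unfolding weyl_inner[OF inv.hyps] unfolding weyl_adjoint'[OF inv.hyps] by simp
qed

text \<open>The recentred local class is multiplied by \<open>e\<close>, which kills all unwanted
  conjugates, and is then summed over the group. The resulting multiplier \<open>E\<close> belongs
  to the ideal, hence to \<open>M\<close>; primality would then put into \<open>M\<close> an affine
  function that is nonzero at \<open>x\<close>.\<close>

theorem one_in_point_ideal: "(\<lambda>_. 1) \<in> point_ideal"
proof (rule ccontr)
  assume "(\<lambda>_. 1) \<notin> point_ideal"
  then obtain M where M: "poly_ideal M" "point_ideal \<subseteq> M" "(\<lambda>_. 1) \<notin> M"
    and prime: "\<And>f g. real_polynomial_function f \<Longrightarrow> real_polynomial_function g \<Longrightarrow> (\<lambda>v. f v * g v) \<in> M \<Longrightarrow> f \<in> M \<or> g \<in> M"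
    using prime_ideal_exists[OF poly_ideal_point_ideal] by metis
  \<comment> \<open>Roots whose hyperplane through \<open>- a\<close> is not forced by
    \<open>M\<close>. Avoiding them makes \<open>x + a\<close> lie on exactly those root hyperplanes
    that \<open>M\<close> prescribes.\<close>
  define B where "B = {p \<in> (\<lambda>\<alpha>. (\<alpha>, a \<bullet> \<alpha>)) ` R. (\<lambda>v. v \<bullet> fst p + snd p) \<notin> M}"
  have finB: "finite B" using fin by (simp add: B_def)
  have BM: "(\<lambda>v. v \<bullet> u + c) \<notin> M" if "(u, c) \<in> B" for u c using that by (simp add: B_def)
  obtain x where x: "\<And>u c. (\<lambda>v. v \<bullet> u + c) \<in> M \<Longrightarrow> x \<bullet> u + c = 0" "\<And>u c. (u, c) \<in> B \<Longrightarrow> x \<bullet> u + c \<noteq> 0"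
    using generic_affine_zero[OF M(1,3) finB BM] by blast
  have wall: "(\<lambda>v. v \<bullet> \<alpha> + a \<bullet> \<alpha>) \<in> M" if "\<alpha> \<in> R" "x \<bullet> \<alpha> + a \<bullet> \<alpha> = 0" for \<alpha>
    using x(2)[of \<alpha> "a \<bullet> \<alpha>"] that by (auto simp: B_def)
  define z where "z = x + a"
  define R' where "R' = {\<alpha> \<in> R. x \<bullet> \<alpha> \<in> \<int>}"
  have R'R: "R' \<subseteq> R" by (auto simp: R'_def)
  have R'refl: "reflection \<alpha> \<beta> \<in> R'" if "\<alpha> \<in> R'" "\<beta> \<in> R'" for \<alpha> \<beta>
  proof -
    have "2 * (\<beta> \<bullet> \<alpha>) / (\<alpha> \<bullet> \<alpha>) \<in> \<int>" "x \<bullet> \<alpha> \<in> \<int>" "x \<bullet> \<beta> \<in> \<int>"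
      using that R'R cryst by (auto simp: R'_def)
    then have "x \<bullet> reflection \<alpha> \<beta> \<in> \<int>" unfolding inner_reflection by (intro Ints_diff Ints_mult)
    then show ?thesis using that R'R refl by (auto simp: R'_def)
  qed
  interpret R': reflection_roots R' using roots_subset[OF R'R R'refl] .
  define H where "H = {h \<in> weyl_group R'. h z = z}"
  define J where "J = {\<alpha> \<in> R'. x \<bullet> \<alpha> = 0}"
  have J: "J = {\<alpha> \<in> R. x \<bullet> \<alpha> = 0}" by (auto simp: J_def R'_def)
  have dom: "z \<bullet> \<alpha> \<ge> 0" if \<alpha>: "\<alpha> \<in> R'" "x \<bullet> \<alpha> > 0" for \<alpha>
  proof -
    obtain m :: int where m: "x \<bullet> \<alpha> = m" using \<alpha> by (auto simp: R'_def elim: Ints_cases)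
    then have "real_of_int m \<ge> 1" using \<alpha> by simp
    moreover have "\<alpha> \<in> R" using \<alpha>(1) R'R by blast
    note minuscule[OF this]
    ultimately show ?thesis using m by (auto simp: z_def inner_add_left)
  qed
  obtain F0 where F0: "F0 \<in> tens (invariant_polynomials H)"
    "\<And>y. F0 y y = (\<Prod>\<beta>\<in>{\<beta> \<in> J. z \<bullet> \<beta> < 0}. y \<bullet> \<beta>)"
    "\<And>u y. u \<in> weyl_group J \<Longrightarrow> u z \<noteq> z \<Longrightarrow> F0 (u y) y = 0"
    using R'.parabolic_point_class[of x z, OF dom] unfolding H_def J_def by blast
  have F0inv: "F0 v (h y) = F0 v y" if "h \<in> H" for h v y
    by (rule tens_invariant[OF HOL.refl F0(1) that])
  \<comment> \<open>The point \<open>(x, z)\<close> becomes the origin of the local picture; for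
    \<open>y = v + a\<close> the two shifted arguments coincide.\<close>
  define FK where "FK = (\<lambda>v y. F0 (v - x) (y - z))"
  have FK: "FK \<in> tens (invariant_polynomials {})"
    unfolding FK_def by (rule tens_shift[OF F0(1)]) (simp add: invariant_polynomials_def)
  define bad where "bad = {(w, b). w \<in> weyl_group R \<and> b \<in> (\<lambda>g. g a) ` weyl_group R \<and> w (x + b) \<noteq> z}"
  have finbad: "finite bad"
    by (rule finite_subset[of _ "weyl_group R \<times> (\<lambda>g. g a) ` weyl_group R"]) (auto simp: bad_def finite_weyl)
  obtain \<mu> where \<mu>: "\<And>w b. (w, b) \<in> bad \<Longrightarrow> \<mu> \<bullet> (z - w (x + b)) \<noteq> 0"
  proof -
    have f: "finite ((\<lambda>(w, b). z - w (x + b)) ` bad)" using finbad by simp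
    have n: "0 \<notin> (\<lambda>(w, b). z - w (x + b)) ` bad" by (auto simp: bad_def)
    obtain \<mu> where \<mu>: "\<And>c. c \<in> (\<lambda>(w, b). z - w (x + b)) ` bad \<Longrightarrow> \<mu> \<bullet> c \<noteq> 0"
      using generic_vector_near[OF f n] by metis
    have "\<mu> \<bullet> (z - w (x + b)) \<noteq> 0" if "(w, b) \<in> bad" for w b
      by (rule \<mu>, rule image_eqI[OF _ that]) simp
    then show ?thesis using that by blast
  qed
  \<comment> \<open>The factor of a bad pair vanishes identically at \<open>y = w (v + b)\<close>,
    while the choice of \<mu> keeps all factors nonzero at \<open>(x, z)\<close>.\<close>
  define e where "e = (\<lambda>v y. \<Prod>(w, b)\<in>bad. y \<bullet> \<mu> - w (v + b) \<bullet> \<mu>)"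
  have poly_translate: "real_polynomial_function (\<lambda>v. w (v + b) \<bullet> \<mu>)" if "w \<in> weyl_group R" for w b
    by (rule polynomial_shift_comp[of "\<lambda>v. w v \<bullet> \<mu>", OF polynomial_linear_comp[OF polynomial_inner weyl_linear[OF that]]])
  have e: "e \<in> tens (invariant_polynomials {})"
    unfolding e_def
  proof (rule tens_prod[OF HOL.refl])
    fix i assume i: "i \<in> bad"
    obtain w b where wb: "i = (w, b)" by (cases i)
    then have w: "w \<in> weyl_group R" using i by (simp add: bad_def)
    have "(\<lambda>v y. y \<bullet> \<mu>) \<in> tens (invariant_polynomials {})"
      by (rule tens_right[OF HOL.refl]) (simp add: invariant_polynomials_def)
    moreover have "(\<lambda>v y. w (v + b) \<bullet> \<mu>) \<in> tens (invariant_polynomials {})"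
      by (rule tens_left[OF HOL.refl poly_translate[OF w]])
    ultimately have "(\<lambda>v y. y \<bullet> \<mu> - w (v + b) \<bullet> \<mu>) \<in> tens (invariant_polynomials {})"
      by (rule tens_diff[OF HOL.refl])
    then show "(\<lambda>v y. case i of (w, b) \<Rightarrow> y \<bullet> \<mu> - w (v + b) \<bullet> \<mu>) \<in> tens (invariant_polynomials {})"
      by (simp add: wb)
  qed
  define T where "T = (\<lambda>v y. \<Sum>w\<in>weyl_group R. FK v (w y) * e v (w y))"
  have T: "T \<in> tens (invariant_polynomials (weyl_group R))"
    unfolding T_def by (rule tens_symmetrize[OF tens_mult[OF HOL.refl FK e]])
  have e0: "e v (w (v + b)) = 0" if "(w, b) \<in> bad" for w b v
    unfolding e_def by (rule prod_zero[OF finbad]) (rule bexI[OF _ that], simp)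
  have Rz: "{\<alpha> \<in> R. z \<bullet> \<alpha> = 0} \<subseteq> R'"
  proof
    fix \<alpha> assume \<alpha>: "\<alpha> \<in> {\<alpha> \<in> R. z \<bullet> \<alpha> = 0}"
    then have "x \<bullet> \<alpha> = - (a \<bullet> \<alpha>)" by (simp add: z_def inner_add_left)
    then show "\<alpha> \<in> R'" using \<alpha> minuscule[of \<alpha>] by (auto simp: R'_def)
  qed
  have stabH: "k \<in> H" if "k \<in> weyl_group R" "k z = z" for k
    using stabilizer_reflections[OF that] weyl_mono[OF Rz] that by (auto simp: H_def)
  \<comment> \<open>If \<open>w\<close> carries \<open>x + u a\<close> to \<open>z\<close>, then
    \<open>w \<circ> u\<close> fixes \<open>z\<close>, and the invariance of \<open>F0\<close> in
    its second argument removes it.\<close>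
  have FKval: "FK v (w (v + u a)) = F0 (v - x) (inv u (v - x))"
    if w: "w \<in> weyl_group R" and u: "u \<in> weyl_group J" and wz: "w (x + u a) = z" for w u v
  proof -
    have uW: "u \<in> weyl_group R" using u weyl_mono[of J R] J by auto
    have ux: "u x = x" by (rule weyl_fix_orthogonal[OF u]) (simp add: J)
    then have iux: "inv u x = x" using weyl_inv_left[OF uW] by metis
    have "(w \<circ> u) z = z" using wz ux weyl_add[OF uW] by (simp add: z_def)
    then have h: "w \<circ> u \<in> H" by (intro stabH weyl_group.comp w uW)
    then have hW: "w \<circ> u \<in> weyl_group R" by (intro weyl_group.comp w uW)
    have hz: "(w \<circ> u) z = z" using h by (simp add: H_def)
    have "w (v + u a) = (w \<circ> u) (inv u v + a)"
      using weyl_add[OF uW] weyl_inv_right[OF uW] by simp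
    then have "w (v + u a) - z = (w \<circ> u) (inv u v + a - z)" using weyl_diff[OF hW] hz by simp
    also have "inv u v + a - z = inv u (v - x)"
      using weyl_diff[OF weyl_group.inv[OF uW]] iux by (simp add: z_def)
    finally show ?thesis unfolding FK_def by (simp only: F0inv[OF h])
  qed
  define St where "St = {w \<in> weyl_group R. w z = z}"
  have finSt: "finite St" using finite_weyl by (simp add: St_def)
  define E where "E = (\<lambda>v. \<Sum>w\<in>St. e v (w (v + a)))"
  define P where "P = (\<lambda>v. \<Prod>\<beta>\<in>{\<beta> \<in> J. z \<bullet> \<beta> < 0}. v \<bullet> \<beta>)"
  have P_shift: "P (v - x) = P v" for v
    unfolding P_def by (rule prod.cong) (auto simp: J inner_diff_left)
  have Ta: "T v (v + a) = P v * E v" for v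
  proof -
    have "T v (v + a) = (\<Sum>w\<in>St. FK v (w (v + a)) * e v (w (v + a)))"
      unfolding T_def
    proof (rule sum.mono_neutral_right[OF finite_weyl])
      show "\<forall>w\<in>weyl_group R - St. FK v (w (v + a)) * e v (w (v + a)) = 0"
      proof
        fix w assume w: "w \<in> weyl_group R - St"
        have "a \<in> (\<lambda>g. g a) ` weyl_group R" using weyl_group.id by (intro image_eqI[of _ _ id]) auto
        then have "(w, a) \<in> bad" using w by (auto simp: bad_def St_def z_def)
        then show "FK v (w (v + a)) * e v (w (v + a)) = 0" using e0 by simp
      qed
    qed (auto simp: St_def)
    also have "\<dots> = (\<Sum>w\<in>St. P v * e v (w (v + a)))"
    proof (rule sum.cong[OF HOL.refl])
      fix w assume w: "w \<in> St"
      have "FK v (w (v + id a)) = F0 (v - x) (inv id (v - x))"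
        using w by (intro FKval weyl_group.id) (auto simp: St_def z_def)
      then have "FK v (w (v + a)) = P v" using F0(2)[of "v - x"] P_shift by (simp add: P_def)
      then show "FK v (w (v + a)) * e v (w (v + a)) = P v * e v (w (v + a))" by simp
    qed
    finally show ?thesis by (simp add: E_def sum_distrib_left)
  qed
  have Tb: "T v (v + b a) = 0" if b: "b \<in> weyl_group R" "b a \<noteq> a" for b v
    unfolding T_def
  proof (rule sum.neutral, rule ballI)
    fix w assume w: "w \<in> weyl_group R"
    show "FK v (w (v + b a)) * e v (w (v + b a)) = 0"
    proof (cases "w (x + b a) = z")
      case False
      then have "(w, b a) \<in> bad" using w b by (auto simp: bad_def)
      then show ?thesis using e0 by simp
    next
      case True
      then obtain u where u: "u \<in> weyl_group J" "b a = u a"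
        using conjugate_translates[OF w b(1)] unfolding z_def J by blast
      have uW: "u \<in> weyl_group R" using u weyl_mono[of J R] J by auto
      have ux: "u x = x" by (rule weyl_fix_orthogonal[OF u(1)]) (simp add: J)
      have "u z \<noteq> z" using b(2) u(2) weyl_add[OF uW] ux by (simp add: z_def)
      then have "F0 (u (inv u (v - x))) (inv u (v - x)) = 0" by (rule F0(3)[OF u(1)])
      then have "F0 (v - x) (inv u (v - x)) = 0" using weyl_inv_right[OF uW] by simp
      then show ?thesis using FKval[OF w u(1), of v] True u(2) by simp
    qed
  qed
  have polyE: "real_polynomial_function (\<lambda>v. e v (w (v + a)))" if w: "w \<in> weyl_group R" for w
    unfolding e_def case_prod_beta
    by (intro polynomial_prod real_polynomial_function_diff poly_translate w) (auto simp: bad_def)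
  have EI: "E \<in> point_ideal"
  proof (rule point_idealI)
    show "real_polynomial_function E"
      unfolding E_def by (rule polynomial_sum) (auto intro: polyE simp: St_def)
    \<comment> \<open>The local class yields only the roots vanishing at \<open>x\<close>, on which
      \<open>z\<close> and \<open>a\<close> agree. The other factors of the target are supplied by
      hand.\<close>
    let ?Q = "\<lambda>v. \<Prod>\<beta>\<in>{\<beta> \<in> R - J. a \<bullet> \<beta> < 0}. v \<bullet> \<beta>"
    have "real_polynomial_function ?Q" by (intro polynomial_prod polynomial_inner)
    then show "(\<lambda>v y. ?Q v * T v y) \<in> tens (invariant_polynomials (weyl_group R))"
      by (intro tens_mult[OF HOL.refl] tens_left[OF HOL.refl] T)
    show "?Q v * T v (v + b a) = 0" if "b \<in> weyl_group R" "b a \<noteq> a" for b v using Tb[OF that] by simp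
    have QP: "?Q v * P v = (\<Prod>\<beta>\<in>{\<beta> \<in> R. a \<bullet> \<beta> < 0}. v \<bullet> \<beta>)" for v
    proof -
      have 1: "{\<beta> \<in> R. a \<bullet> \<beta> < 0} = {\<beta> \<in> R - J. a \<bullet> \<beta> < 0} \<union> {\<beta> \<in> J. z \<bullet> \<beta> < 0}"
        by (auto simp: J z_def inner_add_left)
      show ?thesis unfolding P_def 1 by (rule prod.union_disjoint[symmetric]) (use fin J in auto)
    qed
    show "?Q v * T v (v + a) = E v * (\<Prod>\<beta>\<in>{\<beta> \<in> R. a \<bullet> \<beta> < 0}. v \<bullet> \<beta>)" for v
      unfolding Ta mult.assoc[symmetric] QP by (rule mult.commute)
  qed
  have id': "real_polynomial_function (\<lambda>v. (v + a) \<bullet> \<mu>)" using poly_translate[OF weyl_group.id, of a] by simp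
  \<comment> \<open>Each summand of \<open>E\<close> is congruent to \<open>e v (v + a)\<close>
    modulo \<open>M\<close>, so \<open>E\<close> is congruent to \<open>card St\<close> times it;
    invertibility of that number puts \<open>e v (v + a)\<close> into \<open>M\<close>.\<close>
  have cong: "(\<lambda>v. e v (w (v + a)) - e v (v + a)) \<in> M" if w: "w \<in> St" for w
  proof -
    have wW: "w \<in> weyl_group R" "w z = z" using w by (auto simp: St_def)
    have "w \<in> weyl_group {\<alpha> \<in> R. z \<bullet> \<alpha> = 0}" using stabilizer_reflections[OF wW] .
    then have s: "(\<lambda>v. w (v + a) \<bullet> \<mu> - (v + a) \<bullet> \<mu>) \<in> M"
      by (rule stabilizer_congruence[OF M(1), rotated]) (auto intro: wall simp: z_def inner_add_left)
    show ?thesis unfolding e_def case_prod_beta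
    proof (rule ideal_prod_cong[OF M(1)])
      fix i assume i: "i \<in> bad"
      then have f: "fst i \<in> weyl_group R" by (auto simp: bad_def)
      show "real_polynomial_function (\<lambda>v. w (v + a) \<bullet> \<mu> - fst i (v + snd i) \<bullet> \<mu>)"
        by (intro real_polynomial_function_diff poly_translate wW f)
      show "real_polynomial_function (\<lambda>v. (v + a) \<bullet> \<mu> - fst i (v + snd i) \<bullet> \<mu>)"
        by (intro real_polynomial_function_diff poly_translate id' f)
      show "(\<lambda>v. (w (v + a) \<bullet> \<mu> - fst i (v + snd i) \<bullet> \<mu>) - ((v + a) \<bullet> \<mu> - fst i (v + snd i) \<bullet> \<mu>)) \<in> M"
        using s by simp
    qed
  qed
  have "(\<lambda>v. \<Sum>w\<in>St. e v (w (v + a)) - e v (v + a)) \<in> M" by (rule ideal_sum[OF M(1) cong])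
  then have "(\<lambda>v. E v - card St * e v (v + a)) \<in> M" by (simp add: E_def sum_subtractf)
  from ideal_diff[OF M(1) subsetD[OF M(2) EI] this]
  have "(\<lambda>v. (1 / card St) * (E v - (E v - card St * e v (v + a)))) \<in> M" by (rule ideal_cmult[OF M(1)])
  moreover have "id \<in> St" by (simp add: St_def weyl_group.id)
  then have "card St > 0" using finSt card_gt_0_iff by blast
  ultimately have "(\<lambda>v. e v (v + a)) \<in> M" by simp
  then have "\<exists>i\<in>bad. (\<lambda>v. (v + a) \<bullet> \<mu> - fst i (v + snd i) \<bullet> \<mu>) \<in> M"
    unfolding e_def case_prod_beta
  proof (rule prime_prod[OF M(3) prime, rotated -1])
    fix i assume i: "i \<in> bad"
    then have f: "fst i \<in> weyl_group R" by (auto simp: bad_def)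
    show "real_polynomial_function (\<lambda>v. (v + a) \<bullet> \<mu> - fst i (v + snd i) \<bullet> \<mu>)"
      by (intro real_polynomial_function_diff poly_translate id' f)
  qed
  then obtain w b where wb: "(w, b) \<in> bad" "(\<lambda>v. (v + a) \<bullet> \<mu> - w (v + b) \<bullet> \<mu>) \<in> M" by force
  have w: "w \<in> weyl_group R" using wb by (auto simp: bad_def)
  have aff: "(v + a) \<bullet> \<mu> - w (v + b) \<bullet> \<mu> = v \<bullet> (\<mu> - inv w \<mu>) + (a \<bullet> \<mu> - w b \<bullet> \<mu>)" for v
    using weyl_adjoint[OF w, of v \<mu>] by (simp add: weyl_add[OF w] inner_add_left inner_diff_right)
  have "x \<bullet> (\<mu> - inv w \<mu>) + (a \<bullet> \<mu> - w b \<bullet> \<mu>) = 0" using wb(2) unfolding aff by (rule x(1))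
  then have "(x + a) \<bullet> \<mu> - w (x + b) \<bullet> \<mu> = 0" unfolding aff .
  then have "\<mu> \<bullet> (z - w (x + b)) = 0" by (simp add: z_def inner_diff_left inner_diff_right inner_commute)
  then show False using \<mu>[OF wb(1)] by simp
qed

end

section \<open>Antisymmetrization\<close>

context reflection_roots begin

definition discriminant where "discriminant \<rho> v = (\<Prod>\<alpha>\<in>{\<alpha> \<in> R. \<rho> \<bullet> \<alpha> > 0}. v \<bullet> \<alpha>)"

context
  fixes \<rho> :: 'a assumes \<rho>: "\<And>\<alpha>. \<alpha> \<in> R \<Longrightarrow> \<rho> \<bullet> \<alpha> \<noteq> 0"
begin

lemma discriminant_nz: "discriminant \<rho> v \<noteq> 0 \<longleftrightarrow> (\<forall>\<alpha>\<in>R. v \<bullet> \<alpha> \<noteq> 0)"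
proof
  assume d: "discriminant \<rho> v \<noteq> 0"
  have pos: "v \<bullet> \<alpha> \<noteq> 0" if "\<alpha> \<in> R" "\<rho> \<bullet> \<alpha> > 0" for \<alpha>
    using d that fin by (auto simp: discriminant_def)
  show "\<forall>\<alpha>\<in>R. v \<bullet> \<alpha> \<noteq> 0"
  proof
    fix \<alpha> assume \<alpha>: "\<alpha> \<in> R"
    show "v \<bullet> \<alpha> \<noteq> 0"
      using pos[OF \<alpha>] pos[OF minus[OF \<alpha>]] \<rho>[OF \<alpha>] by (cases "\<rho> \<bullet> \<alpha> > 0") auto
  qed
qed (use fin in \<open>auto simp: discriminant_def\<close>)

text \<open>A reflection permutes the positive roots up to sign, so it multiplies the product by a
  constant \<open>c\<close>. Dividing by the form of \<beta> and evaluating at a point of its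
  hyperplane on no other positive root's hyperplane gives \<open>c = -1\<close>, without any appeal
  to simple roots.\<close>

lemma discriminant_reflection:
  assumes "\<beta> \<in> R" shows "discriminant \<rho> (reflection \<beta> v) = - discriminant \<rho> v"
proof -
  define P where "P = {\<alpha> \<in> R. \<rho> \<bullet> \<alpha> > 0}"
  have main: "discriminant \<rho> (reflection \<beta> v) = - discriminant \<rho> v" if \<beta>: "\<beta> \<in> P" for \<beta> v
  proof -
    define s where "s = reflection \<beta>"
    have \<beta>R: "\<beta> \<in> R" using \<beta> by (simp add: P_def)
    have ss [simp]: "s (s u) = u" "s (- u) = - s u" for u
      by (simp_all add: s_def linear_neg[OF linear_reflection])
    define f where "f = (\<lambda>\<alpha>. if \<rho> \<bullet> s \<alpha> > 0 then s \<alpha> else - s \<alpha>)"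
    define c where "c = (\<Prod>\<alpha>\<in>P. if \<rho> \<bullet> s \<alpha> > 0 then 1 else - 1 :: real)"
    have sR: "s \<alpha> \<in> R" if "\<alpha> \<in> P" for \<alpha> using that \<beta>R refl by (simp add: P_def s_def)
    have fP: "f ` P \<subseteq> P" using sR minus \<rho> by (force simp: f_def P_def)
    moreover have ff: "f (f \<alpha>) = \<alpha>" if "\<alpha> \<in> P" for \<alpha> using that by (auto simp: f_def P_def)
    ultimately have bij: "bij_betw f P P" by (intro bij_betw_byWitness[of _ f]) auto
    have disc: "discriminant \<rho> (s u) = c * discriminant \<rho> u" for u
    proof -
      have "discriminant \<rho> (s u) = (\<Prod>\<alpha>\<in>P. (if \<rho> \<bullet> s \<alpha> > 0 then 1 else - 1) * (u \<bullet> f \<alpha>))"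
        unfolding discriminant_def P_def[symmetric]
        by (rule prod.cong) (auto simp: f_def s_def reflection_adjoint)
      also have "\<dots> = c * (\<Prod>\<alpha>\<in>P. u \<bullet> f \<alpha>)" by (simp add: c_def prod.distrib)
      also have "(\<Prod>\<alpha>\<in>P. u \<bullet> f \<alpha>) = discriminant \<rho> u"
        unfolding discriminant_def P_def[symmetric] by (rule prod.reindex_bij_betw[OF bij])
      finally show ?thesis .
    qed
    define r where "r = (\<lambda>u. \<Prod>\<alpha>\<in>P - {\<beta>}. u \<bullet> \<alpha>)"
    have finP: "finite P" using fin by (simp add: P_def)
    have dr: "discriminant \<rho> u = (u \<bullet> \<beta>) * r u" for u
      unfolding discriminant_def P_def[symmetric] r_def by (rule prod.remove[OF finP \<beta>])
    have rpoly: "real_polynomial_function r" unfolding r_def by (intro polynomial_prod polynomial_inner)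
    have zero: "c * r u + r (s u) = 0" for u
    proof (rule cancel_linear_factor_UNIV[where f = "\<lambda>u. c * r u + r (s u)", OF _ root_nz[OF \<beta>R]])
      have "real_polynomial_function (\<lambda>u. r (s u))"
        unfolding s_def by (rule polynomial_linear_comp[OF rpoly linear_reflection])
      then show "real_polynomial_function (\<lambda>u. c * r u + r (s u))"
        using rpoly by (intro real_polynomial_function.intros(2-4))
      show "(u \<bullet> \<beta>) * (c * r u + r (s u)) = 0" for u
        using disc[of u] reflection_inner_self[OF root_nz[OF \<beta>R], of u]
        unfolding dr s_def by (simp add: algebra_simps)
    qed
    have "\<exists>g\<in>{u. u \<bullet> \<beta> = 0}. \<forall>\<alpha>\<in>P - {\<beta>}. g \<bullet> \<alpha> \<noteq> 0"
    proof (rule generic_vector)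
      show "finite (P - {\<beta>})" using finP by simp
      show "subspace {u. u \<bullet> \<beta> = 0}" by (auto simp: subspace_def inner_add_left)
      fix \<alpha> assume \<alpha>: "\<alpha> \<in> P - {\<beta>}"
      then have "\<alpha> \<noteq> - \<beta>" using \<beta> by (auto simp: P_def)
      then have np: "\<And>c. \<alpha> \<noteq> c *\<^sub>R \<beta>" using \<alpha> \<beta>R by (intro not_proportional) (auto simp: P_def)
      obtain u where "u \<bullet> \<beta> = 0" "u \<bullet> \<alpha> \<noteq> 0"
        by (rule not_proportional_witness[OF root_nz[OF \<beta>R] np])
      then show "\<exists>s\<in>{u. u \<bullet> \<beta> = 0}. s \<bullet> \<alpha> \<noteq> 0" by blast
    qed
    then obtain g where g: "g \<bullet> \<beta> = 0" "\<forall>\<alpha>\<in>P - {\<beta>}. g \<bullet> \<alpha> \<noteq> 0" by blast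
    have "s g = g" unfolding s_def by (rule reflection_fix[OF g(1)])
    then have "(c + 1) * r g = 0" using zero[of g] by (simp add: algebra_simps)
    moreover have "r g \<noteq> 0" using g(2) finP by (simp add: r_def)
    ultimately have "c = -1" by simp
    then show ?thesis using disc[of v] by (simp add: s_def)
  qed
  show ?thesis
  proof (cases "\<rho> \<bullet> \<beta> > 0")
    case True
    then show ?thesis using assms by (intro main) (simp add: P_def)
  next
    case False
    then have "- \<beta> \<in> P" using \<rho>[OF assms] minus[OF assms] by (simp add: P_def)
    from main[OF this] show ?thesis using reflection_scale[of "-1" \<beta>] by simp
  qed
qed

lemma discriminant_sign:
  "w \<in> weyl_group R \<Longrightarrow> \<exists>c. (c = 1 \<or> c = -1) \<and> (\<forall>v. discriminant \<rho> (w v) = c * discriminant \<rho> v)"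
proof (induction rule: weyl_group.induct)
  case id
  show ?case by (rule exI[of _ 1]) simp
next
  case (refl \<alpha>)
  show ?case by (rule exI[of _ "-1"]) (simp add: discriminant_reflection[OF refl])
next
  case (comp v w)
  obtain c where c: "c = 1 \<or> c = -1" "\<And>u. discriminant \<rho> (v u) = c * discriminant \<rho> u" using comp.IH by blast
  obtain d where d: "d = 1 \<or> d = -1" "\<And>u. discriminant \<rho> (w u) = d * discriminant \<rho> u" using comp.IH by blast
  show ?case by (rule exI[of _ "c * d"]) (use c d in auto)
next
  case (inv w)
  obtain c where c: "c = 1 \<or> c = -1" "\<And>u. discriminant \<rho> (w u) = c * discriminant \<rho> u" using inv.IH by blast
  have "discriminant \<rho> (inv w u) = c * discriminant \<rho> u" for u
    using c(2)[of "inv w u"] c(1) weyl_inv_right[OF inv.hyps] by auto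
  then show ?case using c(1) by blast
qed

text \<open>The signed sum \<open>G\<close> changes sign under each reflection, hence vanishes on
  every root hyperplane and is divisible by the discriminant. Invariance of the quotient is read off
  from the formula at regular points and extended by cancelling the discriminant.\<close>

theorem antisymmetrization:
  assumes p: "real_polynomial_function p"
  shows "\<exists>T\<in>invariant_polynomials (weyl_group R). \<forall>v. discriminant \<rho> v \<noteq> 0 \<longrightarrow>
    T v = (\<Sum>w\<in>weyl_group R. p (w v) / discriminant \<rho> (w v))"
proof -
  have "\<forall>w\<in>weyl_group R. \<exists>c. (c = 1 \<or> c = -1) \<and> (\<forall>v. discriminant \<rho> (w v) = c * discriminant \<rho> v)"
    using discriminant_sign by blast
  then obtain c where c: "\<And>w. w \<in> weyl_group R \<Longrightarrow> c w = 1 \<or> c w = -1"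
    "\<And>w v. w \<in> weyl_group R \<Longrightarrow> discriminant \<rho> (w v) = c w * discriminant \<rho> v"
    by (auto dest!: bchoice)
  have d\<rho>: "discriminant \<rho> \<rho> \<noteq> 0" using discriminant_nz \<rho> by blast
  define G where "G = (\<lambda>v. \<Sum>w\<in>weyl_group R. c w * p (w v))"
  have "real_polynomial_function (\<lambda>v. c w * p (w v))" if "w \<in> weyl_group R" for w
    by (intro real_polynomial_function.intros(2,4) polynomial_linear_comp[OF p weyl_linear[OF that]])
  then have G: "real_polynomial_function G" unfolding G_def by (rule polynomial_sum)
  have G0: "G v = 0" if \<beta>: "\<beta> \<in> R" "v \<bullet> \<beta> = 0" for \<beta> v
  proof -
    have s: "reflection \<beta> \<in> weyl_group R" by (rule weyl_group.refl[OF \<beta>(1)])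
    have cs: "c (w \<circ> reflection \<beta>) = - c w" if w: "w \<in> weyl_group R" for w
    proof -
      have "c (w \<circ> reflection \<beta>) * discriminant \<rho> \<rho> = - c w * discriminant \<rho> \<rho>"
        using c(2)[OF weyl_group.comp[OF w s], of \<rho>] c(2)[OF w, of "reflection \<beta> \<rho>"]
          discriminant_reflection[OF \<beta>(1), of \<rho>] by simp
      then show ?thesis using d\<rho> by (metis mult_right_cancel)
    qed
    \<comment> \<open>Reindexing by the reflection, which fixes \<open>v\<close>, changes every sign
      and gives \<open>G v = - G v\<close>.\<close>
    have "G v = (\<Sum>w\<in>weyl_group R. c (w \<circ> reflection \<beta>) * p ((w \<circ> reflection \<beta>) v))"
      unfolding G_def by (rule sum.reindex_bij_betw[OF bij_betw_weyl_right[OF s], symmetric])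
    also have "\<dots> = (\<Sum>w\<in>weyl_group R. - (c w * p (w v)))"
      by (rule sum.cong) (simp_all add: cs reflection_fix[OF \<beta>(2)])
    also have "\<dots> = - G v" by (simp add: G_def sum_negf)
    finally show ?thesis by simp
  qed
  have "\<exists>T. real_polynomial_function T \<and> (\<forall>v. G v = (\<Prod>\<alpha>\<in>{\<alpha> \<in> R. \<rho> \<bullet> \<alpha> > 0}. v \<bullet> \<alpha>) * T v)"
  proof (rule polynomial_divide_prod[OF _ _ G])
    show "finite {\<alpha> \<in> R. \<rho> \<bullet> \<alpha> > 0}" using fin by simp
    show "0 \<notin> {\<alpha> \<in> R. \<rho> \<bullet> \<alpha> > 0}" by simp
    show "G v = 0" if "\<alpha> \<in> {\<alpha> \<in> R. \<rho> \<bullet> \<alpha> > 0}" "v \<bullet> \<alpha> = 0" for \<alpha> v using that G0 by blast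
    fix \<alpha> \<beta> k assume h: "\<alpha> \<in> {\<alpha> \<in> R. \<rho> \<bullet> \<alpha> > 0}" "\<beta> \<in> {\<alpha> \<in> R. \<rho> \<bullet> \<alpha> > 0}" "\<alpha> \<noteq> \<beta>"
    then have "\<alpha> \<noteq> - \<beta>" by auto
    then show "\<alpha> \<noteq> k *\<^sub>R \<beta>" using h by (intro not_proportional) auto
  qed
  then obtain T where T: "real_polynomial_function T" "\<And>v. G v = discriminant \<rho> v * T v"
    by (auto simp: discriminant_def)
  have val: "T v = (\<Sum>w\<in>weyl_group R. p (w v) / discriminant \<rho> (w v))" if v: "discriminant \<rho> v \<noteq> 0" for v
  proof -
    have "T v = G v / discriminant \<rho> v" using T(2)[of v] v by simp
    also have "\<dots> = (\<Sum>w\<in>weyl_group R. c w * p (w v) / discriminant \<rho> v)" by (simp add: G_def sum_divide_distrib)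
    also have "\<dots> = (\<Sum>w\<in>weyl_group R. p (w v) / discriminant \<rho> (w v))"
    proof (rule sum.cong[OF HOL.refl])
      fix w assume w: "w \<in> weyl_group R"
      show "c w * p (w v) / discriminant \<rho> v = p (w v) / discriminant \<rho> (w v)"
        using c(1)[OF w] c(2)[OF w, of v] by auto
    qed
    finally show ?thesis .
  qed
  have "T (g v) = T v" if g: "g \<in> weyl_group R" for g v
  proof -
    have "T (g v) - T v = 0"
    proof (rule cancel_prod_linear[where Q = "{\<alpha> \<in> R. \<rho> \<bullet> \<alpha> > 0}" and f = "\<lambda>v. T (g v) - T v"])
      show "real_polynomial_function (\<lambda>v. T (g v) - T v)"
        by (intro real_polynomial_function_diff T polynomial_linear_comp[OF T(1) weyl_linear[OF g]])
      fix v
      have "T (g v) = T v" if v: "discriminant \<rho> v \<noteq> 0"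
      proof -
        have gv: "discriminant \<rho> (g v) \<noteq> 0" using c[OF g] v by auto
        show ?thesis unfolding val[OF v] val[OF gv]
          using sum.reindex_bij_betw[OF bij_betw_weyl_right[OF g], of "\<lambda>w. p (w v) / discriminant \<rho> (w v)"] by simp
      qed
      then show "(\<Prod>\<alpha>\<in>{\<alpha> \<in> R. \<rho> \<bullet> \<alpha> > 0}. v \<bullet> \<alpha>) * (T (g v) - T v) = 0"
        unfolding discriminant_def[symmetric] by auto
    qed (use fin in auto)
    then show ?thesis by simp
  qed
  then have "T \<in> invariant_polynomials (weyl_group R)" using T(1) by (simp add: invariant_polynomials_def)
  then show ?thesis using val by blast
qed

end

end

section \<open>The two inclusions for the generated algebra\<close>

lemma generated_algebra_subset_invariant:
  "generated_algebra (invariant_polynomials (weyl_group R) \<union>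
      {\<lambda>v. f (v + a) | f. f \<in> invariant_polynomials (weyl_group R)}) \<subseteq> invariant_polynomials (weyl_stabilizer R a)"
    (is "generated_algebra ?S \<subseteq> ?I") for R :: "'a::euclidean_space set"
proof
  have S: "f \<in> ?I" if "f \<in> ?S" for f
    using that
  proof
    assume "f \<in> {\<lambda>v. f (v + a) | f. f \<in> invariant_polynomials (weyl_group R)}"
    then obtain g where g: "f = (\<lambda>v. g (v + a))" "g \<in> invariant_polynomials (weyl_group R)" by blast
    have "g (w v + a) = g (v + a)" if w: "w \<in> weyl_group R" "w a = a" for w v
    proof -
      have "g (w (v + a)) = g (v + a)" using g(2) w by (auto simp: invariant_polynomials_def)
      then show ?thesis using weyl_add[OF w(1), of v a] w(2) by simp
    qed
    moreover have "real_polynomial_function (\<lambda>v. g (v + a))"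
      using g(2) by (intro polynomial_shift_comp) (simp add: invariant_polynomials_def)
    ultimately show ?thesis unfolding g(1) by (simp add: invariant_polynomials_def weyl_stabilizer_def)
  qed (auto simp: invariant_polynomials_def weyl_stabilizer_def)
  fix f assume "f \<in> generated_algebra ?S"
  then show "f \<in> ?I"
  proof (induction rule: generated_algebra.induct)
    case (gen f)
    then show ?case by (rule S)
  next
    case (const c)
    show ?case by (simp add: invariant_polynomials_def real_polynomial_function.intros)
  next
    case (add f g)
    then show ?case by (simp add: invariant_polynomials_def real_polynomial_function.intros)
  next
    case (mult f g)
    then show ?case by (simp add: invariant_polynomials_def real_polynomial_function.intros)
  qed
qed

context minuscule_roots begin

text \<open>The function \<open>b\<close> is the trace of \<open>h * q * F / \<Delta>\<close> over
  the group. As a sum of products it lies in the generated algebra, since only the polynomial in the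
  first variable is antisymmetrized and the factor in \<open>v + a\<close> stays put. On regular
  points it collapses to \<open>h\<close> times the order of the stabilizer.\<close>

theorem invariant_in_generated_algebra:
  assumes h: "h \<in> invariant_polynomials (weyl_stabilizer R a)"
  shows "h \<in> generated_algebra (invariant_polynomials (weyl_group R) \<union>
      {\<lambda>v. f (v + a) | f. f \<in> invariant_polynomials (weyl_group R)})" (is "h \<in> generated_algebra ?S")
proof -
  obtain \<rho> where \<rho>: "\<And>\<alpha>. \<alpha> \<in> R \<Longrightarrow> \<rho> \<bullet> \<alpha> \<noteq> 0" "\<And>\<alpha>. \<alpha> \<in> R \<Longrightarrow> (- a) \<bullet> \<alpha> > 0 \<Longrightarrow> \<rho> \<bullet> \<alpha> > 0"
    \<comment> \<open>Perturbing \<open>- a\<close> makes every root with (\<beta>, a) < 0 positive,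
      so \<Delta> splits into \<pi> and the positive roots orthogonal to \<open>a\<close>.\<close>
    using generic_vector_near[OF fin nz] by metis
  define \<Delta> where "\<Delta> = discriminant \<rho>"
  define \<pi> where "\<pi> = (\<lambda>v. \<Prod>\<beta>\<in>{\<beta> \<in> R. a \<bullet> \<beta> < 0}. v \<bullet> \<beta>)"
  define q where "q = (\<lambda>v. \<Prod>\<beta>\<in>{\<beta> \<in> R. \<rho> \<bullet> \<beta> > 0 \<and> a \<bullet> \<beta> = 0}. v \<bullet> \<beta>)"
  have \<Delta>: "\<Delta> v = q v * \<pi> v" for v
  proof -
    have "a \<bullet> \<beta> \<le> 0" if "\<beta> \<in> R" "\<rho> \<bullet> \<beta> > 0" for \<beta>
      using \<rho>(2)[OF minus[OF that(1)]] that(2) by (cases "a \<bullet> \<beta> > 0") auto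
    then have 1: "{\<alpha> \<in> R. \<rho> \<bullet> \<alpha> > 0} = {\<beta> \<in> R. \<rho> \<bullet> \<beta> > 0 \<and> a \<bullet> \<beta> = 0} \<union> {\<beta> \<in> R. a \<bullet> \<beta> < 0}"
      using \<rho>(2) by force
    show ?thesis unfolding \<Delta>_def discriminant_def q_def \<pi>_def 1
      by (rule prod.union_disjoint) (use fin in auto)
  qed
  have hp: "real_polynomial_function h" "\<And>w v. w \<in> weyl_group R \<Longrightarrow> w a = a \<Longrightarrow> h (w v) = h v"
    using h by (auto simp: invariant_polynomials_def weyl_stabilizer_def)
  have qp: "real_polynomial_function q" unfolding q_def by (intro polynomial_prod polynomial_inner)
  have trace: "\<exists>b\<in>generated_algebra ?S. \<forall>v. \<Delta> v \<noteq> 0 \<longrightarrow>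
      b v = (\<Sum>w\<in>weyl_group R. h (w v) * q (w v) * F (w v) (v + a) / \<Delta> (w v))"
    if "F \<in> tens (invariant_polynomials (weyl_group R))" for F
    using that
  proof (induction rule: tens.induct)
    case (base p g)
    have "real_polynomial_function (\<lambda>v. h v * q v * p v)"
      using hp(1) qp base(1) by (intro real_polynomial_function.intros(4))
    then obtain T where T: "T \<in> invariant_polynomials (weyl_group R)"
      "\<And>v. \<Delta> v \<noteq> 0 \<Longrightarrow> T v = (\<Sum>w\<in>weyl_group R. h (w v) * q (w v) * p (w v) / \<Delta> (w v))"
      unfolding \<Delta>_def using antisymmetrization[of \<rho> "\<lambda>v. h v * q v * p v"] \<rho>(1) by blast
    have "(\<lambda>v. T v * g (v + a)) \<in> generated_algebra ?S"
      by (intro generated_algebra.mult generated_algebra.gen) (use T(1) base(2) in blast)+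
    moreover have "T v * g (v + a) = (\<Sum>w\<in>weyl_group R. h (w v) * q (w v) * (p (w v) * g (v + a)) / \<Delta> (w v))"
      if "\<Delta> v \<noteq> 0" for v
      unfolding T(2)[OF that] sum_distrib_right by (simp add: mult.assoc)
    ultimately show ?case by (intro bexI[of _ "\<lambda>v. T v * g (v + a)"]) auto
  next
    case (add F G)
    then obtain b c where "b \<in> generated_algebra ?S" "c \<in> generated_algebra ?S"
      "\<And>v. \<Delta> v \<noteq> 0 \<Longrightarrow> b v = (\<Sum>w\<in>weyl_group R. h (w v) * q (w v) * F (w v) (v + a) / \<Delta> (w v))"
      "\<And>v. \<Delta> v \<noteq> 0 \<Longrightarrow> c v = (\<Sum>w\<in>weyl_group R. h (w v) * q (w v) * G (w v) (v + a) / \<Delta> (w v))"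
      by blast
    then show ?case
      by (intro bexI[of _ "\<lambda>v. b v + c v"] generated_algebra.add)
        (simp_all add: distrib_left add_divide_distrib sum.distrib)
  qed
  obtain F where F: "F \<in> tens (invariant_polynomials (weyl_group R))" "\<And>v. F v (v + a) = \<pi> v"
    "\<And>b v. b \<in> weyl_group R \<Longrightarrow> b a \<noteq> a \<Longrightarrow> F v (v + b a) = 0"
    using point_idealD(2)[OF one_in_point_ideal] unfolding \<pi>_def by auto
  obtain b where b: "b \<in> generated_algebra ?S"
    "\<And>v. \<Delta> v \<noteq> 0 \<Longrightarrow> b v = (\<Sum>w\<in>weyl_group R. h (w v) * q (w v) * F (w v) (v + a) / \<Delta> (w v))"
    using trace[OF F(1)] by blast
  define N where "N = card (weyl_stabilizer R a)"
  have "finite (weyl_stabilizer R a)" "id \<in> weyl_stabilizer R a"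
    using finite_weyl weyl_group.id by (auto simp: weyl_stabilizer_def)
  then have N: "N > 0" unfolding N_def using card_gt_0_iff by blast
  have regular: "b v = N * h v" if v: "\<Delta> v \<noteq> 0" for v
  proof -
    have "b v = (\<Sum>w\<in>weyl_group R. if w a = a then h v else 0)"
      unfolding b(2)[OF v]
    proof (rule sum.cong[OF HOL.refl])
      fix w assume w: "w \<in> weyl_group R"
      \<comment> \<open>Invariance in the second variable turns \<open>v + a\<close> into
        \<open>w v + w a\<close>, where the values of \<open>F\<close> are prescribed.\<close>
      have "F (w v) (v + a) = F (w v) (w (v + a))" by (rule tens_invariant[OF HOL.refl F(1) w, symmetric])
      then have Fw: "F (w v) (v + a) = F (w v) (w v + w a)" using weyl_add[OF w] by simp
      have "\<Delta> (w v) \<noteq> 0" using discriminant_sign[of \<rho>, OF \<rho>(1) w] v unfolding \<Delta>_def by auto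
      then show "h (w v) * q (w v) * F (w v) (v + a) / \<Delta> (w v) = (if w a = a then h v else 0)"
        unfolding Fw using F(2)[of "w v"] F(3)[OF w, of "w v"] hp(2)[OF w] \<Delta>[of "w v"] by auto
    qed
    also have "\<dots> = (\<Sum>w\<in>weyl_stabilizer R a. h v)"
      unfolding weyl_stabilizer_def by (rule sum.inter_filter[OF finite_weyl, symmetric])
    finally show ?thesis by (simp add: N_def)
  qed
  have bp: "real_polynomial_function b"
    using generated_algebra_subset_invariant b(1) by (auto simp: invariant_polynomials_def)
  have "b v - N * h v = 0" for v
  proof (rule cancel_prod_linear[where Q = "{\<alpha> \<in> R. \<rho> \<bullet> \<alpha> > 0}" and f = "\<lambda>v. b v - N * h v"])
    show "real_polynomial_function (\<lambda>v. b v - N * h v)"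
      by (intro real_polynomial_function_diff bp real_polynomial_function.intros(2,4) hp(1))
    show "(\<Prod>\<alpha>\<in>{\<alpha> \<in> R. \<rho> \<bullet> \<alpha> > 0}. v \<bullet> \<alpha>) * (b v - N * h v) = 0" for v
      using regular[of v] unfolding \<Delta>_def discriminant_def by auto
  qed (use fin in auto)
  then have "h = (\<lambda>v. (1 / N) * b v)" using N by (simp add: fun_eq_iff field_simps)
  moreover have "(\<lambda>v. (1 / N) * b v) \<in> generated_algebra ?S"
    by (intro generated_algebra.mult generated_algebra.const b)
  ultimately show ?thesis by simp
qed

end

section \<open>Normalization of the components\<close>

text \<open>Irreducible components appear as the classes of the equivalence relation on roots
  generated by non-orthogonality.\<close>

definition root_link :: "'a::real_inner set \<Rightarrow> ('a \<times> 'a) set" where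
  "root_link R = {(\<alpha>, \<beta>). \<alpha> \<in> R \<and> \<beta> \<in> R \<and> \<alpha> \<bullet> \<beta> \<noteq> 0}\<^sup>*"

lemma root_link_sym: "(\<alpha>, \<beta>) \<in> root_link R \<Longrightarrow> (\<beta>, \<alpha>) \<in> root_link R"
  unfolding root_link_def by (rule symD[OF sym_rtrancl]) (auto simp: sym_def inner_commute)

lemma root_link_irreducible_component:
  assumes "\<alpha> \<in> R" defines "C \<equiv> {\<beta> \<in> R. (\<alpha>, \<beta>) \<in> root_link R}"
  shows "irreducible_component R C"
  unfolding irreducible_component_def irreducible_roots_def
proof (intro conjI notI ballI)
  have \<alpha>C: "\<alpha> \<in> C" using assms by (simp add: root_link_def)
  then show "C = {} \<Longrightarrow> False" by blast
  show "C \<subseteq> R" by (auto simp: C_def)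
  show "\<beta> \<bullet> \<gamma> = 0" if "\<beta> \<in> C" "\<gamma> \<in> R - C" for \<beta> \<gamma>
  proof (rule ccontr)
    assume "\<beta> \<bullet> \<gamma> \<noteq> 0"
    then have "(\<alpha>, \<gamma>) \<in> root_link R"
      using that unfolding C_def root_link_def by (auto intro: rtrancl_into_rtrancl)
    then show False using that by (simp add: C_def)
  qed
  assume "\<exists>A B. A \<noteq> {} \<and> B \<noteq> {} \<and> A \<inter> B = {} \<and> A \<union> B = C \<and> (\<forall>\<alpha>\<in>A. \<forall>\<beta>\<in>B. \<alpha> \<bullet> \<beta> = 0)"
  then obtain A B where AB: "A \<noteq> {}" "B \<noteq> {}" "A \<inter> B = {}" "A \<union> B = C" "\<And>\<alpha> \<beta>. \<alpha> \<in> A \<Longrightarrow> \<beta> \<in> B \<Longrightarrow> \<alpha> \<bullet> \<beta> = 0"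
    by blast
  have *: False if D: "D \<union> E = C" "\<alpha> \<in> D" "E \<noteq> {}" "D \<inter> E = {}" and orth: "\<And>\<alpha> \<beta>. \<alpha> \<in> D \<Longrightarrow> \<beta> \<in> E \<Longrightarrow> \<alpha> \<bullet> \<beta> = 0" for D E
  proof -
    have "\<beta> \<in> D" if "(\<alpha>, \<beta>) \<in> root_link R" for \<beta>
      using that unfolding root_link_def
    proof (induction rule: rtrancl_induct)
      case base
      then show ?case using D by simp
    next
      case (step y z)
      then have "(\<alpha>, z) \<in> root_link R" unfolding root_link_def by (rule_tac rtrancl_into_rtrancl)
      then have "z \<in> D \<union> E" using step D by (simp add: C_def)
      then show ?case using step orth by blast
    qed
    moreover obtain \<beta> where "\<beta> \<in> E" using D by blast
    moreover then have "(\<alpha>, \<beta>) \<in> root_link R" using D by (auto simp: C_def)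
    ultimately show False using D by blast
  qed
  show False
  proof (cases "\<alpha> \<in> A")
    case True
    then show ?thesis using *[of A B] AB by blast
  next
    case False
    then have "\<alpha> \<in> B" using AB \<alpha>C by blast
    moreover have "\<beta> \<bullet> \<gamma> = 0" if "\<beta> \<in> B" "\<gamma> \<in> A" for \<beta> \<gamma>
      using AB(5)[OF that(2,1)] by (simp add: inner_commute)
    ultimately show ?thesis using *[of B A] AB by blast
  qed
qed

lemma root_system_minus:
  assumes "root_system R" "\<alpha> \<in> R" shows "- \<alpha> \<in> R"
proof -
  have "reflection \<alpha> \<alpha> \<in> R" "\<alpha> \<noteq> 0" using assms by (auto simp: root_system_def)
  then show ?thesis by (simp add: reflection_def scaleR_2)
qed

text \<open>A component is closed under negation, so its pairings with \<open>a\<close> form a set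
  symmetric about 0. With at most three elements, this set has at most one nonzero absolute value,
  which is the constant of the component.\<close>

lemma minuscule_normalization:
  fixes R :: "'a::euclidean_space set"
  assumes R: "root_system R" and a: "minuscule R a"
  obtains c :: "'a \<Rightarrow> real" where "\<And>\<alpha>. c \<alpha> > 0"
    "\<And>\<alpha> \<beta>. \<alpha> \<in> R \<Longrightarrow> \<beta> \<in> R \<Longrightarrow> \<alpha> \<bullet> \<beta> \<noteq> 0 \<Longrightarrow> c \<alpha> = c \<beta>"
    "\<And>\<alpha>. \<alpha> \<in> R \<Longrightarrow> a \<bullet> \<alpha> \<in> {- c \<alpha>, 0, c \<alpha>}"
proof -
  have finR: "finite R" using R by (simp add: root_system_def)
  define C where "C = (\<lambda>\<alpha>. {\<beta> \<in> R. (\<alpha>, \<beta>) \<in> root_link R})"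
  define m where "m = (\<lambda>\<alpha>. Max (insert 0 ((\<lambda>\<beta>. \<bar>\<beta> \<bullet> a\<bar>) ` C \<alpha>)))"
  \<comment> \<open>The default 1 is for components orthogonal to \<open>a\<close>, where every
    positive constant would do.\<close>
  define c where "c = (\<lambda>\<alpha>. if m \<alpha> = 0 then 1 else m \<alpha>)"
  have finC: "finite (insert 0 ((\<lambda>\<beta>. \<bar>\<beta> \<bullet> a\<bar>) ` C \<alpha>))" for \<alpha> using finR by (simp add: C_def)
  have m0: "m \<alpha> \<ge> 0" for \<alpha> unfolding m_def by (rule Max_ge[OF finC]) simp
  show ?thesis
  proof (rule that)
    show "c \<alpha> > 0" for \<alpha> using m0[of \<alpha>] by (simp add: c_def)
    show "c \<alpha> = c \<beta>" if h: "\<alpha> \<in> R" "\<beta> \<in> R" "\<alpha> \<bullet> \<beta> \<noteq> 0" for \<alpha> \<beta>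
    proof -
      have l: "(\<alpha>, \<beta>) \<in> root_link R" unfolding root_link_def using h by (intro r_into_rtrancl) simp
      have "(\<alpha>, \<gamma>) \<in> root_link R \<longleftrightarrow> (\<beta>, \<gamma>) \<in> root_link R" for \<gamma>
        using l root_link_sym[OF l] unfolding root_link_def by (meson rtrancl_trans)
      then have "C \<alpha> = C \<beta>" by (simp add: C_def)
      then show ?thesis by (simp add: c_def m_def)
    qed
    fix \<alpha> assume \<alpha>: "\<alpha> \<in> R"
    have \<alpha>C: "\<alpha> \<in> C \<alpha>" using \<alpha> by (simp add: C_def root_link_def)
    have le: "\<bar>\<alpha> \<bullet> a\<bar> \<le> m \<alpha>" unfolding m_def by (rule Max_ge[OF finC]) (use \<alpha>C in blast)
    show "a \<bullet> \<alpha> \<in> {- c \<alpha>, 0, c \<alpha>}"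
    proof (rule ccontr)
      assume n: "\<not> ?thesis"
      then have nz: "\<alpha> \<bullet> a \<noteq> 0" by (simp add: inner_commute)
      then have mpos: "m \<alpha> > 0" using le by linarith
      then have cm: "c \<alpha> = m \<alpha>" by (simp add: c_def)
      have neg: "- \<beta> \<in> C \<alpha>" if \<beta>: "\<beta> \<in> C \<alpha>" for \<beta>
      proof -
        have "\<beta> \<in> R" using \<beta> by (simp add: C_def)
        moreover from this have "- \<beta> \<in> R" "\<beta> \<noteq> 0" using root_system_minus[OF R] R by (auto simp: root_system_def)
        ultimately have "(\<beta>, - \<beta>) \<in> {(\<alpha>, \<beta>). \<alpha> \<in> R \<and> \<beta> \<in> R \<and> \<alpha> \<bullet> \<beta> \<noteq> 0}" by simp
        then show ?thesis using \<beta> \<open>- \<beta> \<in> R\<close> unfolding C_def root_link_def by (auto intro: rtrancl_into_rtrancl)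
      qed
      have "m \<alpha> \<in> insert 0 ((\<lambda>\<beta>. \<bar>\<beta> \<bullet> a\<bar>) ` C \<alpha>)" unfolding m_def by (rule Max_in[OF finC]) simp
      then obtain \<beta> where \<beta>: "\<beta> \<in> C \<alpha>" "m \<alpha> = \<bar>\<beta> \<bullet> a\<bar>" using mpos by auto
      \<comment> \<open>A nonzero value other than plus or minus the maximum would give four
        distinct pairings on one component.\<close>
      have vals: "{m \<alpha>, - m \<alpha>, \<alpha> \<bullet> a, - (\<alpha> \<bullet> a)} \<subseteq> (\<lambda>\<gamma>. \<gamma> \<bullet> a) ` C \<alpha>"
      proof -
        have "\<gamma> \<bullet> a \<in> (\<lambda>\<gamma>. \<gamma> \<bullet> a) ` C \<alpha> \<and> - (\<gamma> \<bullet> a) \<in> (\<lambda>\<gamma>. \<gamma> \<bullet> a) ` C \<alpha>" if "\<gamma> \<in> C \<alpha>" for \<gamma>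
          using that neg[OF that] by (metis image_eqI inner_minus_left)
        from this[OF \<beta>(1)] this[OF \<alpha>C] show ?thesis using \<beta>(2) by (cases "\<beta> \<bullet> a \<ge> 0") auto
      qed
      have "card {m \<alpha>, - m \<alpha>, \<alpha> \<bullet> a, - (\<alpha> \<bullet> a)} = 4"
        using n nz mpos cm by (auto simp: inner_commute card_insert_if)
      moreover have "finite ((\<lambda>\<gamma>. \<gamma> \<bullet> a) ` C \<alpha>)" using finR by (simp add: C_def)
      ultimately have "card ((\<lambda>\<gamma>. \<gamma> \<bullet> a) ` C \<alpha>) \<ge> 4" using card_mono[OF _ vals] by simp
      moreover have "card ((\<lambda>\<gamma>. \<gamma> \<bullet> a) ` C \<alpha>) \<le> 3"
        using a root_link_irreducible_component[OF \<alpha>] unfolding minuscule_def C_def by blast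
      ultimately show False by simp
    qed
  qed
qed

lemma weyl_group_rescale:
  assumes "\<And>\<alpha>. \<alpha> \<in> R \<Longrightarrow> k \<alpha> \<noteq> 0"
  shows "weyl_group ((\<lambda>\<alpha>. k \<alpha> *\<^sub>R \<alpha>) ` R) = weyl_group R"
proof (intro equalityI subsetI)
  fix w assume "w \<in> weyl_group ((\<lambda>\<alpha>. k \<alpha> *\<^sub>R \<alpha>) ` R)"
  then show "w \<in> weyl_group R"
  proof (induction rule: weyl_group.induct)
    case (refl \<alpha>)
    then obtain \<beta> where \<beta>: "\<beta> \<in> R" "\<alpha> = k \<beta> *\<^sub>R \<beta>" by blast
    have "reflection \<alpha> = reflection \<beta>" unfolding \<beta>(2) by (rule reflection_scale[OF assms[OF \<beta>(1)]])
    then show ?case using weyl_group.refl[OF \<beta>(1)] by simp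
  qed (rule weyl_group.intros; assumption)+
next
  fix w assume "w \<in> weyl_group R"
  then show "w \<in> weyl_group ((\<lambda>\<alpha>. k \<alpha> *\<^sub>R \<alpha>) ` R)"
  proof (induction rule: weyl_group.induct)
    case (refl \<alpha>)
    then have "reflection (k \<alpha> *\<^sub>R \<alpha>) \<in> weyl_group ((\<lambda>\<alpha>. k \<alpha> *\<^sub>R \<alpha>) ` R)" by (intro weyl_group.refl) blast
    then show ?case using reflection_scale[OF assms[OF refl], of \<alpha>] by simp
  qed (rule weyl_group.intros; assumption)+
qed

text \<open>Dividing each component by its constant makes all pairings with \<open>a\<close> equal
  to -1, 0 or 1. Reflections are unchanged, and so are Cartan integers: non-orthogonal roots share
  the same constant, and for orthogonal ones the integer is 0.\<close>

lemma minuscule_roots_rescale: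
  fixes R :: "'a::euclidean_space set"
  assumes R: "reduced_root_system R" and a: "minuscule R a"
  obtains k :: "'a \<Rightarrow> real" where "\<And>\<alpha>. k \<alpha> \<noteq> 0" "minuscule_roots ((\<lambda>\<alpha>. k \<alpha> *\<^sub>R \<alpha>) ` R) a"
proof -
  have rs: "root_system R" and red: "\<And>\<alpha> c. \<alpha> \<in> R \<Longrightarrow> c *\<^sub>R \<alpha> \<in> R \<Longrightarrow> c = 1 \<or> c = -1"
    using R by (auto simp: reduced_root_system_def)
  have fin: "finite R" and nz: "0 \<notin> R" and refl: "\<And>\<alpha> \<beta>. \<alpha> \<in> R \<Longrightarrow> \<beta> \<in> R \<Longrightarrow> reflection \<alpha> \<beta> \<in> R"
    and cryst: "\<And>\<alpha> \<beta>. \<alpha> \<in> R \<Longrightarrow> \<beta> \<in> R \<Longrightarrow> 2 * (\<beta> \<bullet> \<alpha>) / (\<alpha> \<bullet> \<alpha>) \<in> \<int>"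
    using rs by (auto simp: root_system_def)
  obtain c :: "'a \<Rightarrow> real" where pos: "\<And>\<alpha>. c \<alpha> > 0"
    and const: "\<And>\<alpha> \<beta>. \<alpha> \<in> R \<Longrightarrow> \<beta> \<in> R \<Longrightarrow> \<alpha> \<bullet> \<beta> \<noteq> 0 \<Longrightarrow> c \<alpha> = c \<beta>"
    and val: "\<And>\<alpha>. \<alpha> \<in> R \<Longrightarrow> a \<bullet> \<alpha> \<in> {- c \<alpha>, 0, c \<alpha>}"
    using minuscule_normalization[OF rs a] by metis
  define k where "k = (\<lambda>\<alpha>. 1 / c \<alpha>)"
  have k0: "k \<alpha> \<noteq> 0" for \<alpha> using pos[of \<alpha>] by (simp add: k_def)
  have crefl: "c (reflection \<alpha> \<beta>) = c \<beta>" if h: "\<alpha> \<in> R" "\<beta> \<in> R" for \<alpha> \<beta>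
  proof (cases "\<beta> \<bullet> \<alpha> = 0")
    case True
    then show ?thesis by (simp add: reflection_fix)
  next
    case False
    have "\<alpha> \<noteq> 0" using h nz by blast
    then have "reflection \<alpha> \<beta> \<bullet> \<alpha> \<noteq> 0" using False by (simp add: reflection_inner_self)
    then show ?thesis using const[OF refl[OF h] h(1)] const[OF h(2,1) False] by simp
  qed
  have "minuscule_roots ((\<lambda>\<alpha>. k \<alpha> *\<^sub>R \<alpha>) ` R) a"
  proof
    show "finite ((\<lambda>\<alpha>. k \<alpha> *\<^sub>R \<alpha>) ` R)" using fin by simp
    show "0 \<notin> (\<lambda>\<alpha>. k \<alpha> *\<^sub>R \<alpha>) ` R" using nz k0 by auto
  next
    fix \<alpha>' \<beta>' assume "\<alpha>' \<in> (\<lambda>\<alpha>. k \<alpha> *\<^sub>R \<alpha>) ` R" "\<beta>' \<in> (\<lambda>\<alpha>. k \<alpha> *\<^sub>R \<alpha>) ` R"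
    then obtain \<alpha> \<beta> where \<alpha>: "\<alpha> \<in> R" "\<alpha>' = k \<alpha> *\<^sub>R \<alpha>" and \<beta>: "\<beta> \<in> R" "\<beta>' = k \<beta> *\<^sub>R \<beta>" by blast
    have "reflection \<alpha>' \<beta>' = k \<beta> *\<^sub>R reflection \<alpha> \<beta>"
      using \<alpha> \<beta> reflection_scale[OF k0] linear_scale[OF linear_reflection] by metis
    also have "k \<beta> = k (reflection \<alpha> \<beta>)" using crefl[OF \<alpha>(1) \<beta>(1)] by (simp add: k_def)
    finally show "reflection \<alpha>' \<beta>' \<in> (\<lambda>\<alpha>. k \<alpha> *\<^sub>R \<alpha>) ` R" using refl[OF \<alpha>(1) \<beta>(1)] by blast
    show "2 * (\<beta>' \<bullet> \<alpha>') / (\<alpha>' \<bullet> \<alpha>') \<in> \<int>"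
    proof (cases "\<beta> \<bullet> \<alpha> = 0")
      case True
      then show ?thesis using \<alpha> \<beta> by simp
    next
      case False
      then have "k \<beta> = k \<alpha>" using const[OF \<beta>(1) \<alpha>(1)] by (simp add: k_def)
      then have "2 * (\<beta>' \<bullet> \<alpha>') / (\<alpha>' \<bullet> \<alpha>') = 2 * (\<beta> \<bullet> \<alpha>) / (\<alpha> \<bullet> \<alpha>)"
        using k0[of \<alpha>] by (simp add: \<alpha> \<beta> field_simps)
      then show ?thesis using cryst[OF \<alpha>(1) \<beta>(1)] by simp
    qed
  next
    fix \<alpha>' r assume "\<alpha>' \<in> (\<lambda>\<alpha>. k \<alpha> *\<^sub>R \<alpha>) ` R" "r *\<^sub>R \<alpha>' \<in> (\<lambda>\<alpha>. k \<alpha> *\<^sub>R \<alpha>) ` R"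
    then obtain \<alpha> \<beta> where \<alpha>: "\<alpha> \<in> R" "\<alpha>' = k \<alpha> *\<^sub>R \<alpha>" and \<beta>: "\<beta> \<in> R" "r *\<^sub>R \<alpha>' = k \<beta> *\<^sub>R \<beta>" by blast
    have "(1 / k \<beta>) *\<^sub>R (r *\<^sub>R \<alpha>') = \<beta>" using \<beta>(2) k0[of \<beta>] by simp
    moreover define t where "t = r * k \<alpha> / k \<beta>"
    ultimately have e: "t *\<^sub>R \<alpha> = \<beta>" by (simp add: \<alpha>(2))
    \<comment> \<open>Being \<alpha> or its negative, \<beta> is not orthogonal to \<alpha>, so both
      have the same scaling factor and \<open>r\<close> equals \<open>t\<close>.\<close>
    then have t: "t = 1 \<or> t = -1" using red[OF \<alpha>(1)] \<beta>(1) by simp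
    have "\<alpha> \<noteq> 0" using \<alpha>(1) nz by blast
    then have "\<beta> \<bullet> \<alpha> \<noteq> 0" unfolding e[symmetric] using t by auto
    then have "k \<beta> = k \<alpha>" using const[OF \<beta>(1) \<alpha>(1)] by (simp add: k_def)
    then show "r = 1 \<or> r = -1" using t k0[of \<alpha>] by (simp add: t_def)
  next
    fix \<alpha>' assume "\<alpha>' \<in> (\<lambda>\<alpha>. k \<alpha> *\<^sub>R \<alpha>) ` R"
    then obtain \<alpha> where \<alpha>: "\<alpha> \<in> R" "\<alpha>' = k \<alpha> *\<^sub>R \<alpha>" by blast
    show "a \<bullet> \<alpha>' \<in> {-1, 0, 1}" using val[OF \<alpha>(1)] pos[of \<alpha>] by (auto simp: \<alpha>(2) k_def)
  qed
  then show ?thesis using that k0 by blast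
qed

theorem proposition3:
  fixes R :: "'a::euclidean_space set" and a :: 'a
  assumes "reduced_root_system R"
    and "minuscule R a"
  shows "invariant_polynomials (weyl_stabilizer R a) =
    generated_algebra (invariant_polynomials (weyl_group R) \<union>
      {\<lambda>v. f (v + a) | f. f \<in> invariant_polynomials (weyl_group R)})"
proof
  obtain k where k: "\<And>\<alpha>. k \<alpha> \<noteq> 0" and m: "minuscule_roots ((\<lambda>\<alpha>. k \<alpha> *\<^sub>R \<alpha>) ` R) a"
    using minuscule_roots_rescale[OF assms] by metis
  have W: "weyl_group ((\<lambda>\<alpha>. k \<alpha> *\<^sub>R \<alpha>) ` R) = weyl_group R" by (rule weyl_group_rescale[OF k])
  show "invariant_polynomials (weyl_stabilizer R a) \<subseteq> generated_algebra (invariant_polynomials (weyl_group R) \<union>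
      {\<lambda>v. f (v + a) | f. f \<in> invariant_polynomials (weyl_group R)})"
    using minuscule_roots.invariant_in_generated_algebra[OF m] unfolding weyl_stabilizer_def W by blast
qed (rule generated_algebra_subset_invariant)

end
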